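(* (1) The commutative unital pro-$C^*$-algebras are, up to isomorphism, precisely the algebras ${}_{\mathcal{F}}C(X)$ of continuous complex-valued functions on Tychonoff spaces $X$, equipped with the topology of uniform convergence on the members of some functionally distinguished family $\mathcal{F}\subseteq 2^X$ of compact subsets. (2) Such a pro-$C^*$-algebra ${}_{\mathcal{F}}C(X)$ ($X$ Tychonoff, $\mathcal{F}$ functionally distinguished) is barreled precisely when $\mathcal{F}$ is full (i.e. consists of all compact subsets of $X$) and every relatively pseudocompact subset of $X$ is relatively compact.
   Context: A pro-$C^*$-algebra is a cofiltered limit of $C^*$-algebras in the category of topological $*$-algebras; equivalently, a complete Hausdorff topological $*$-algebra over $\mathbb{C}$ whose topology is generated by its continuous $C^*$-seminorms. Isomorphism means isomorphism of topological $*$-algebras. A Tychonoff ($T_{3\frac12}$) space is a $T_1$ completely regular space. A family $\mathcal{F}$ of compact subsets of a topological space $X$ is functionally distinguished if it contains the singletons, is closed under taking compact subsets of its members, is closed under finite unions, and determines the continuous functions: a function $f:X\to\mathbb{R}$ is continuous if and only if $f|_F$ is continuous for all $F\in\mathcal{F}$. A subset $A\subseteq X$ is relatively compact if its closure in $X$ is compact, and relatively pseudocompact if every continuous real-valued function on $X$ is bounded on $A$. A locally convex topological vector space is barreled if every barrel (absolutely convex, absorbing, closed subset) is a neighborhood of the origin. *)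

theory Defs
  imports "HOL-Analysis.Analysis" "HOL-Algebra.QuotRing" "HOL-Algebra.Module"
begin

definition complex_field :: "complex ring" where
  "complex_field = \<lparr>carrier = UNIV, mult = (*), one = 1, zero = 0, add = (+)\<rparr>"

record 'a top_star_algebra = "(complex, 'a) module" +
  star :: "'a \<Rightarrow> 'a"
  topo :: "'a topology"

text \<open>
  Algebras need not have a unit: nothing is assumed of the record field \<open>one\<close>.
  A commutative unital algebra \<open>A\<close> is one for which, in addition, \<open>cring A\<close> holds.
\<close>

locale star_algebra = module complex_field A for A (structure) +
  assumes times_closed: "\<lbrakk>x \<in> carrier A; y \<in> carrier A\<rbrakk> \<Longrightarrow> x \<otimes> y \<in> carrier A"
    and times_assoc: "\<lbrakk>x \<in> carrier A; y \<in> carrier A; z \<in> carrier A\<rbrakk>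
      \<Longrightarrow> (x \<otimes> y) \<otimes> z = x \<otimes> (y \<otimes> z)"
    and times_l_distr: "\<lbrakk>x \<in> carrier A; y \<in> carrier A; z \<in> carrier A\<rbrakk>
      \<Longrightarrow> (x \<oplus> y) \<otimes> z = x \<otimes> z \<oplus> y \<otimes> z"
    and times_r_distr: "\<lbrakk>x \<in> carrier A; y \<in> carrier A; z \<in> carrier A\<rbrakk>
      \<Longrightarrow> z \<otimes> (x \<oplus> y) = z \<otimes> x \<oplus> z \<otimes> y"
    and smult_times_left: "\<lbrakk>x \<in> carrier A; y \<in> carrier A\<rbrakk>
      \<Longrightarrow> (c \<odot> x) \<otimes> y = c \<odot> (x \<otimes> y)"
    and smult_times_right: "\<lbrakk>x \<in> carrier A; y \<in> carrier A\<rbrakk>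
      \<Longrightarrow> x \<otimes> (c \<odot> y) = c \<odot> (x \<otimes> y)"
    and star_closed: "x \<in> carrier A \<Longrightarrow> star A x \<in> carrier A"
    and star_star: "x \<in> carrier A \<Longrightarrow> star A (star A x) = x"
    and star_add: "\<lbrakk>x \<in> carrier A; y \<in> carrier A\<rbrakk>
      \<Longrightarrow> star A (x \<oplus> y) = star A x \<oplus> star A y"
    and star_smult: "x \<in> carrier A \<Longrightarrow> star A (c \<odot> x) = cnj c \<odot> star A x"
    and star_times: "\<lbrakk>x \<in> carrier A; y \<in> carrier A\<rbrakk>
      \<Longrightarrow> star A (x \<otimes> y) = star A y \<otimes> star A x"

locale topological_star_algebra = star_algebra +
  assumes topspace_topo: "topspace (topo A) = carrier A"
    and continuous_add:
      "continuous_map (prod_topology (topo A) (topo A)) (topo A) (\<lambda>(x, y). x \<oplus> y)"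
    and continuous_smult:
      "continuous_map (prod_topology euclidean (topo A)) (topo A) (\<lambda>(c, x). c \<odot> x)"
    and continuous_times:
      "continuous_map (prod_topology (topo A) (topo A)) (topo A) (\<lambda>(x, y). x \<otimes> y)"
    and continuous_star: "continuous_map (topo A) (topo A) (star A)"

text \<open>
  Meant for unital algebras: \<^const>\<open>ring_iso\<close> also asks for preservation of the unit, which
  is then automatic.
\<close>

definition top_star_iso :: "'a top_star_algebra \<Rightarrow> 'b top_star_algebra \<Rightarrow> ('a \<Rightarrow> 'b) \<Rightarrow> bool" where
  "top_star_iso A B h \<longleftrightarrow>
     h \<in> ring_iso A B \<and>
     (\<forall>c. \<forall>x\<in>carrier A. h (c \<odot>\<^bsub>A\<^esub> x) = c \<odot>\<^bsub>B\<^esub> h x) \<and>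
     (\<forall>x\<in>carrier A. h (star A x) = star B (h x)) \<and>
     homeomorphic_map (topo A) (topo B) h"

definition top_star_isomorphic :: "'a top_star_algebra \<Rightarrow> 'b top_star_algebra \<Rightarrow> bool" where
  "top_star_isomorphic A B \<longleftrightarrow> (\<exists>h. top_star_iso A B h)"

definition cstar_seminorm :: "'a top_star_algebra \<Rightarrow> ('a \<Rightarrow> real) \<Rightarrow> bool" where
  "cstar_seminorm A p \<longleftrightarrow>
     (\<forall>x\<in>carrier A. 0 \<le> p x) \<and>
     (\<forall>x\<in>carrier A. \<forall>y\<in>carrier A. p (x \<oplus>\<^bsub>A\<^esub> y) \<le> p x + p y) \<and>
     (\<forall>c. \<forall>x\<in>carrier A. p (c \<odot>\<^bsub>A\<^esub> x) = cmod c * p x) \<and>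
     (\<forall>x\<in>carrier A. \<forall>y\<in>carrier A. p (x \<otimes>\<^bsub>A\<^esub> y) \<le> p x * p y) \<and>
     (\<forall>x\<in>carrier A. p (star A x \<otimes>\<^bsub>A\<^esub> x) = (p x)\<^sup>2)"

definition continuous_cstar_seminorms :: "'a top_star_algebra \<Rightarrow> ('a \<Rightarrow> real) set" where
  "continuous_cstar_seminorms A =
     {p. cstar_seminorm A p \<and> continuous_map (topo A) euclideanreal p}"

text \<open>
  Completeness for the uniformity of the additive group, in terms of filters as in
  \<^const>\<open>cauchy_filter\<close>.
\<close>

definition cauchy_filter_in :: "'a top_star_algebra \<Rightarrow> 'a filter \<Rightarrow> bool" where
  "cauchy_filter_in A \<F> \<longleftrightarrow>
     (\<forall>\<^sub>F x in \<F>. x \<in> carrier A) \<and>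
     (\<forall>U. openin (topo A) U \<and> \<zero>\<^bsub>A\<^esub> \<in> U \<longrightarrow>
        (\<forall>\<^sub>F (x, y) in \<F> \<times>\<^sub>F \<F>. x \<ominus>\<^bsub>A\<^esub> y \<in> U))"

definition complete_algebra :: "'a top_star_algebra \<Rightarrow> bool" where
  "complete_algebra A \<longleftrightarrow>
     (\<forall>\<F>. \<F> \<noteq> bot \<and> cauchy_filter_in A \<F> \<longrightarrow> (\<exists>l. limitin (topo A) (\<lambda>x. x) l \<F>))"

locale pro_cstar_algebra = topological_star_algebra A for A :: "'a top_star_algebra" (structure) +
  assumes Hausdorff: "Hausdorff_space (topo A)"
    and complete: "complete_algebra A"
    and generated_by_seminorms:
      "topo A = topology_generated_by
         {{y \<in> carrier A. p (y \<ominus> x) < e} | p x e.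
            p \<in> continuous_cstar_seminorms A \<and> x \<in> carrier A \<and> 0 < e}"

definition absolutely_convex :: "'a top_star_algebra \<Rightarrow> 'a set \<Rightarrow> bool" where
  "absolutely_convex A B \<longleftrightarrow>
     (\<forall>x\<in>B. \<forall>y\<in>B. \<forall>a b. cmod a + cmod b \<le> 1 \<longrightarrow> a \<odot>\<^bsub>A\<^esub> x \<oplus>\<^bsub>A\<^esub> b \<odot>\<^bsub>A\<^esub> y \<in> B)"

definition absorbing :: "'a top_star_algebra \<Rightarrow> 'a set \<Rightarrow> bool" where
  "absorbing A B \<longleftrightarrow> (\<forall>x\<in>carrier A. \<exists>r>0. \<forall>c. cmod c \<le> r \<longrightarrow> c \<odot>\<^bsub>A\<^esub> x \<in> B)"

definition barrel :: "'a top_star_algebra \<Rightarrow> 'a set \<Rightarrow> bool" where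
  "barrel A B \<longleftrightarrow> closedin (topo A) B \<and> absolutely_convex A B \<and> absorbing A B"

text \<open>Only meaningful for locally convex \<open>A\<close>, such as pro-C*-algebras.\<close>

definition barreled :: "'a top_star_algebra \<Rightarrow> bool" where
  "barreled A \<longleftrightarrow> (\<forall>B. barrel A B \<longrightarrow> (\<exists>U. openin (topo A) U \<and> \<zero>\<^bsub>A\<^esub> \<in> U \<and> U \<subseteq> B))"

definition tychonoff_space :: "'x topology \<Rightarrow> bool" where
  "tychonoff_space X \<longleftrightarrow> t1_space X \<and> completely_regular_space X"

text \<open>
  The empty union is among the finite unions, so the empty set belongs to the family
  also when \<open>X\<close> is empty.
\<close>

definition functionally_distinguished :: "'x topology \<Rightarrow> 'x set set \<Rightarrow> bool" where
  "functionally_distinguished X \<F> \<longleftrightarrow>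
     (\<forall>K\<in>\<F>. compactin X K) \<and>
     (\<forall>x\<in>topspace X. {x} \<in> \<F>) \<and>
     (\<forall>K\<in>\<F>. \<forall>L. L \<subseteq> K \<and> compactin X L \<longrightarrow> L \<in> \<F>) \<and>
     (\<forall>\<U>. finite \<U> \<and> \<U> \<subseteq> \<F> \<longrightarrow> \<Union>\<U> \<in> \<F>) \<and>
     (\<forall>f :: 'x \<Rightarrow> real. continuous_map X euclideanreal f \<longleftrightarrow>
        (\<forall>K\<in>\<F>. continuous_map (subtopology X K) euclideanreal f))"

definition full_family :: "'x topology \<Rightarrow> 'x set set \<Rightarrow> bool" where
  "full_family X \<F> \<longleftrightarrow> \<F> = {K. compactin X K}"

definition relatively_compact :: "'x topology \<Rightarrow> 'x set \<Rightarrow> bool" where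
  "relatively_compact X S \<longleftrightarrow> compactin X (X closure_of S)"

definition relatively_pseudocompact :: "'x topology \<Rightarrow> 'x set \<Rightarrow> bool" where
  "relatively_pseudocompact X S \<longleftrightarrow>
     (\<forall>f :: 'x \<Rightarrow> real. continuous_map X euclideanreal f \<longrightarrow> bounded (f ` S))"

text \<open>
  Functions on \<open>X\<close> are represented by their extensional extensions, so that equality in
  the carrier is equality on \<open>topspace X\<close>.
\<close>

definition continuous_functions :: "'x topology \<Rightarrow> ('x \<Rightarrow> complex) set" where
  "continuous_functions X = {f \<in> extensional (topspace X). continuous_map X euclidean f}"

definition function_algebra :: "'x topology \<Rightarrow> 'x set set \<Rightarrow> ('x \<Rightarrow> complex) top_star_algebra" where
  "function_algebra X \<F> =
     \<lparr>carrier = continuous_functions X,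
      mult = (\<lambda>f g. \<lambda>x\<in>topspace X. f x * g x),
      one = (\<lambda>x\<in>topspace X. 1),
      zero = (\<lambda>x\<in>topspace X. 0),
      add = (\<lambda>f g. \<lambda>x\<in>topspace X. f x + g x),
      smult = (\<lambda>c f. \<lambda>x\<in>topspace X. c * f x),
      star = (\<lambda>f. \<lambda>x\<in>topspace X. cnj (f x)),
      topo = topology_generated_by
        {{g \<in> continuous_functions X. \<forall>x\<in>K. cmod (g x - f x) < e} | f K e.
           f \<in> continuous_functions X \<and> K \<in> \<F> \<and> 0 < e}\<rparr>"

end

theory Submission
  imports Defs
begin

text \<open>
  Characters. Let \<open>A\<close> be commutative and unital. For a C*-seminorm \<open>q\<close> and a self-adjoint \<open>f\<close> with
  \<open>q f = 1\<close>, the limit of \<open>q (f\<^sup>n x)\<close> is again a C*-seminorm, which does not change under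
  multiplication by \<open>f\<close>. Hence a C*-seminorm that is minimal among those with \<open>q 1 = 1\<close> and
  \<open>q (b x) = q x\<close> is multiplicative, and Mazur's elementary argument shows that it is the modulus of a
  *-character. So every continuous C*-seminorm \<open>p\<close> is the supremum over the compact set \<open>K\<^sub>p\<close> of the
  characters dominated by \<open>p\<close>. The Stone-Weierstrass theorem on each \<open>K\<^sub>p\<close> and completeness of \<open>A\<close>
  represent every function that is continuous on all \<open>K\<^sub>p\<close> by an element of \<open>A\<close>; this gives both
  surjectivity of the Gelfand transform and functional distinguishedness of the compact subsets of
  the sets \<open>K\<^sub>p\<close>.

  Barrels. The functions bounded by 1 on \<open>S\<close> form a barrel as soon as every continuous function is
  bounded on \<open>S\<close>, and complete regularity shows that it is a neighbourhood of 0 only if \<open>S\<close> lies in a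
  member of the family. Conversely, for a barrel \<open>B\<close> let \<open>K\<close> be the set of common zeros of the largest
  ideal contained in \<open>B\<close>. A gliding hump argument shows that \<open>B\<close> contains a ball for the supremum
  norm and that \<open>K\<close> is relatively pseudocompact; as \<open>B\<close> is closed, it contains all functions vanishing
  on \<open>K\<close>. Splitting a function that is small on \<open>K\<close> into a uniformly small one and one that vanishes on
  \<open>K\<close> shows that \<open>B\<close> is a neighbourhood of 0.
\<close>

text \<open>The usual route to characters completes the quotient of \<open>A\<close> by the kernel
  of \<open>p\<close> and applies spectral theory there. Here every step stays inside
  \<open>A\<close>, with seminorms in place of quotients: the C*-identity and limits of real
  sequences suffice, and completeness of \<open>A\<close> enters where functions are turned into
  elements. Starting from the normalised square \<open>star A a \<otimes> a\<close> makes the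
  peaking element self-adjoint and lets the resulting character attain \<open>p a\<close>.

  A function on the character space can be approximated only on one compact set at a time, and the
  seminorms form a directed family rather than a sequence. Hence the approximants are collected in a
  Cauchy filter.

  For barrels the obstacle is that the function algebra is in general not metrizable. Series are
  therefore required to be summable on each member of the family separately. All their subseries
  have continuous sums, because the family determines continuity. This covers both uses of the
  gliding hump: a series dominated by a geometric one, and a series with finitely many nonzero terms
  on each member. An ideal of functions takes the place of the measures that represent the polar of
  a barrel.\<close>

section \<open>Topologies generated by directed families of balls, and complex-valued continuous
  maps\<close>

text \<open>Directedness makes the generating balls a basis and not merely a subbasis. The
  right-hand side is itself a topology, and the triangle inequality puts every ball into it, so it
  contains the generated topology. The lemma serves twice: with suprema over compact sets and with
  abstract C*-seminorms.\<close>

lemma openin_topology_generated_by_balls: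
  fixes d :: "'i \<Rightarrow> 'a \<Rightarrow> 'a \<Rightarrow> real"
  assumes zero: "\<And>i x. i \<in> I \<Longrightarrow> x \<in> C \<Longrightarrow> d i x x = 0"
    and triangle: "\<And>i x y z. \<lbrakk>i \<in> I; x \<in> C; y \<in> C; z \<in> C\<rbrakk> \<Longrightarrow> d i z x \<le> d i z y + d i y x"
    and directed: "\<And>i j. i \<in> I \<Longrightarrow> j \<in> I \<Longrightarrow>
        \<exists>k\<in>I. \<forall>x\<in>C. \<forall>y\<in>C. d i y x \<le> d k y x \<and> d j y x \<le> d k y x"
    and nonempty: "I \<noteq> {}"
  shows "openin (topology_generated_by {{y \<in> C. d i y x < e} | i x e. i \<in> I \<and> x \<in> C \<and> 0 < e}) U \<longleftrightarrow>
    U \<subseteq> C \<and> (\<forall>x\<in>U. \<exists>i\<in>I. \<exists>e>0. {y \<in> C. d i y x < e} \<subseteq> U)"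
    (is "openin (topology_generated_by ?S) U \<longleftrightarrow> ?P U")
proof
  have ist: "istopology ?P"
    unfolding istopology_def
  proof (intro conjI allI impI)
    fix S T assume S: "?P S" and T: "?P T"
    show "S \<inter> T \<subseteq> C" using S by blast
    show "\<forall>x\<in>S \<inter> T. \<exists>i\<in>I. \<exists>e>0. {y \<in> C. d i y x < e} \<subseteq> S \<inter> T"
    proof
      fix x assume x: "x \<in> S \<inter> T"
      obtain i e where i: "i \<in> I" "e > 0" "{y \<in> C. d i y x < e} \<subseteq> S" using S x by blast
      obtain j e' where j: "j \<in> I" "e' > 0" "{y \<in> C. d j y x < e'} \<subseteq> T" using T x by blast
      obtain k where k: "k \<in> I" "\<forall>x\<in>C. \<forall>y\<in>C. d i y x \<le> d k y x \<and> d j y x \<le> d k y x"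
        using directed i(1) j(1) by blast
      have "{y \<in> C. d k y x < min e e'} \<subseteq> S \<inter> T"
      proof
        fix y assume y: "y \<in> {y \<in> C. d k y x < min e e'}"
        have "x \<in> C" using x S by blast
        then have "d i y x \<le> d k y x" "d j y x \<le> d k y x" using k(2) y by blast+
        then have "d i y x < e" "d j y x < e'" using y by auto
        then show "y \<in> S \<inter> T" using i(3) j(3) y by blast
      qed
      then show "\<exists>i\<in>I. \<exists>e>0. {y \<in> C. d i y x < e} \<subseteq> S \<inter> T"
        using k(1) i(2) j(2) by (intro bexI[of _ k] exI[of _ "min e e'"]) auto
    qed
  next
    fix \<K> assume \<K>: "\<forall>K\<in>\<K>. ?P K"
    show "\<Union>\<K> \<subseteq> C" using \<K> by blast
    show "\<forall>x\<in>\<Union>\<K>. \<exists>i\<in>I. \<exists>e>0. {y \<in> C. d i y x < e} \<subseteq> \<Union>\<K>"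
    proof clarify
      fix x K assume x: "x \<in> K" "K \<in> \<K>"
      then obtain i e where "i \<in> I" "e > 0" "{y \<in> C. d i y x < e} \<subseteq> K" using \<K> by blast
      then show "\<exists>i\<in>I. \<exists>e>0. {y \<in> C. d i y x < e} \<subseteq> \<Union>\<K>"
        using x(2) by (intro bexI[of _ i] exI[of _ e] conjI) auto
    qed
  qed
  have sub: "?P S" if "S \<in> ?S" for S
  proof -
    obtain i x e where S: "S = {y \<in> C. d i y x < e}" "i \<in> I" "x \<in> C" "e > 0" using \<open>S \<in> ?S\<close> by blast
    have "{z \<in> C. d i z y < e - d i y x} \<subseteq> S" if "y \<in> S" for y
    proof
      fix z assume "z \<in> {z \<in> C. d i z y < e - d i y x}"
      moreover from this have "d i z x \<le> d i z y + d i y x" using triangle S that by auto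
      ultimately show "z \<in> S" using S by auto
    qed
    then have "\<exists>i\<in>I. \<exists>e>0. {z \<in> C. d i z y < e} \<subseteq> S" if "y \<in> S" for y
      using that S by (intro bexI[of _ i] exI[of _ "e - d i y x"]) auto
    then show ?thesis using S(1) by blast
  qed
  assume "openin (topology_generated_by ?S) U"
  then have "generate_topology_on ?S U"
    by (rule openin_topology_generated_by)
  with ist sub show "?P U"
    by (rule generate_topology_on_coarsest[of ?P ?S U])
next
  assume U: "?P U"
  have "\<exists>T. openin (topology_generated_by ?S) T \<and> x \<in> T \<and> T \<subseteq> U" if x: "x \<in> U" for x
  proof -
    obtain i e where i: "i \<in> I" "e > 0" "{y \<in> C. d i y x < e} \<subseteq> U" using U x by blast
    have "openin (topology_generated_by ?S) {y \<in> C. d i y x < e}"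
      using i U x by (intro topology_generated_by_Basis) blast
    then show ?thesis using i U x zero by (intro exI[of _ "{y \<in> C. d i y x < e}"]) auto
  qed
  then show "openin (topology_generated_by ?S) U"
    by (subst openin_subopen) blast
qed

lemma continuous_map_into_ballsI:
  assumes open_iff: "\<And>U. openin T U \<longleftrightarrow> U \<subseteq> C \<and> (\<forall>x\<in>U. \<exists>i\<in>I. \<exists>e>0. Q i x e \<subseteq> U)"
    and C: "topspace T = C"
    and into: "\<And>y. y \<in> topspace Y \<Longrightarrow> f y \<in> C"
    and nbhd: "\<And>y i e. \<lbrakk>y \<in> topspace Y; i \<in> I; (e::real) > 0\<rbrakk> \<Longrightarrow>
        \<exists>V. openin Y V \<and> y \<in> V \<and> (\<forall>z\<in>V. f z \<in> Q i (f y) e)"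
  shows "continuous_map Y T f"
  unfolding continuous_map_def
proof (intro conjI allI impI)
  show "f \<in> topspace Y \<rightarrow> topspace T" using into C by auto
  fix U assume U: "openin T U"
  show "openin Y {x \<in> topspace Y. f x \<in> U}"
  proof (subst openin_subopen, clarify)
    fix y assume y: "y \<in> topspace Y" "f y \<in> U"
    then obtain i e where i: "i \<in> I" "e > 0" "Q i (f y) e \<subseteq> U" using U open_iff by blast
    obtain V where V: "openin Y V" "y \<in> V" "\<forall>z\<in>V. f z \<in> Q i (f y) e"
      using nbhd[OF y(1) i(1,2)] by blast
    have "V \<subseteq> {x \<in> topspace Y. f x \<in> U}"
      using V i(3) openin_subset[OF V(1)] by blast
    with V show "\<exists>T. openin Y T \<and> y \<in> T \<and> T \<subseteq> {x \<in> topspace Y. f x \<in> U}"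
      by blast
  qed
qed

lemma continuous_map_complex_mult:
  fixes f g :: "'x \<Rightarrow> complex"
  assumes "continuous_map X euclidean f" "continuous_map X euclidean g"
  shows "continuous_map X euclidean (\<lambda>x. f x * g x)"
  using assms by (simp add: continuous_map_atin tendsto_mult)

lemma continuous_map_continuous_on_compose:
  assumes "continuous_map X euclidean f" "continuous_on UNIV g"
  shows "continuous_map X euclidean (\<lambda>x. g (f x))"
  using continuous_map_compose[OF assms(1), of euclidean g] assms(2) by (simp add: o_def)

lemma continuous_map_complex_iff:
  fixes f :: "'x \<Rightarrow> complex"
  shows "continuous_map X euclidean f \<longleftrightarrow>
    continuous_map X euclideanreal (\<lambda>x. Re (f x)) \<and> continuous_map X euclideanreal (\<lambda>x. Im (f x))"
proof
  assume "continuous_map X euclidean f"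
  then show "continuous_map X euclideanreal (\<lambda>x. Re (f x)) \<and> continuous_map X euclideanreal (\<lambda>x. Im (f x))"
    using continuous_map_continuous_on_compose[of X f, OF _ continuous_on_Re[OF continuous_on_id]]
      continuous_map_continuous_on_compose[of X f, OF _ continuous_on_Im[OF continuous_on_id]] by blast
next
  assume "continuous_map X euclideanreal (\<lambda>x. Re (f x)) \<and> continuous_map X euclideanreal (\<lambda>x. Im (f x))"
  moreover have "continuous_on UNIV complex_of_real" "continuous_on UNIV (\<lambda>x. \<i> * complex_of_real x)"
    by (intro continuous_intros)+
  ultimately have "continuous_map X euclidean (\<lambda>x. complex_of_real (Re (f x)))"
    "continuous_map X euclidean (\<lambda>x. \<i> * complex_of_real (Im (f x)))"
    using continuous_map_continuous_on_compose[of X "\<lambda>x. Re (f x)" complex_of_real]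
      continuous_map_continuous_on_compose[of X "\<lambda>x. Im (f x)" "\<lambda>x. \<i> * complex_of_real x"]
    by blast+
  then have "continuous_map X euclidean (\<lambda>x. complex_of_real (Re (f x)) + \<i> * complex_of_real (Im (f x)))"
    by (rule continuous_map_add)
  then show "continuous_map X euclidean f"
    by (simp flip: complex_eq)
qed

lemma continuous_map_cmod:
  fixes f :: "'x \<Rightarrow> complex"
  assumes "continuous_map X euclidean f"
  shows "continuous_map X euclideanreal (\<lambda>x. cmod (f x))"
  using assms by (rule continuous_map_norm)

text \<open>Common estimate for products and scalar multiples. Expanding around
  \<open>(c, d)\<close> leaves terms of size at most \<delta>, \<delta> M and M \<delta>, where
  \<delta> \<le> 1 absorbs the quadratic term; this is the origin of
  \<open>1 + 2 * M\<close>.\<close>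

lemma norm_mult_diff_less:
  fixes a b c d :: complex
  assumes "cmod (a - c) < \<delta>" "cmod (b - d) < \<delta>" "cmod c \<le> M" "cmod d \<le> M"
    "0 < \<delta>" "\<delta> \<le> 1" "\<delta> * (1 + 2 * M) \<le> e"
  shows "cmod (a * b - c * d) < e"
proof -
  have eq: "a * b - c * d = (a - c) * (b - d) + (a - c) * d + c * (b - d)"
    by (simp add: algebra_simps)
  have M: "0 \<le> M" using assms(3) norm_ge_zero order_trans by blast
  have "cmod (a * b - c * d) \<le> cmod (a - c) * cmod (b - d) + cmod (a - c) * cmod d + cmod c * cmod (b - d)"
    unfolding eq by (metis norm_mult norm_triangle_le norm_triangle_ineq add_mono order_refl)
  also have "\<dots> < \<delta> * 1 + \<delta> * M + M * \<delta>"
  proof -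
    have "cmod (a - c) * cmod (b - d) < \<delta> * 1"
      using assms(1,2,5,6) by (intro mult_strict_mono') auto
    moreover have "cmod (a - c) * cmod d \<le> \<delta> * M"
      using assms(1,4,5) M by (intro mult_mono) auto
    moreover have "cmod c * cmod (b - d) \<le> M * \<delta>"
      using assms(2,3,5) M by (intro mult_mono) auto
    ultimately show ?thesis by linarith
  qed
  also have "\<dots> = \<delta> * (1 + 2 * M)" by (simp add: algebra_simps)
  finally show ?thesis using assms(7) by linarith
qed

lemma exists_mult_modulus:
  assumes "(0::real) \<le> M" "0 < e"
  shows "\<exists>\<delta>>0. \<delta> \<le> 1 \<and> \<delta> * (1 + 2 * M) \<le> e"
proof (intro exI[of _ "min 1 (e / (1 + 2 * M))"] conjI)
  show "0 < min 1 (e / (1 + 2 * M))" using assms by auto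
  have "min 1 (e / (1 + 2 * M)) * (1 + 2 * M) \<le> e / (1 + 2 * M) * (1 + 2 * M)"
    using assms by (intro mult_right_mono) auto
  then show "min 1 (e / (1 + 2 * M)) * (1 + 2 * M) \<le> e" using assms by simp
qed simp

text \<open>Inserting 0 gives the empty set the zero seminorm; the empty set lies in every
  functionally distinguished family.\<close>

definition sup_seminorm :: "'x set \<Rightarrow> ('x \<Rightarrow> complex) \<Rightarrow> real" where
  "sup_seminorm K g = Sup (insert 0 ((\<lambda>x. cmod (g x)) ` K))"

text \<open>Attainment of the supremum is what compactness contributes: it lets strict pointwise
  bounds pass to the supremum, so that the strict balls in the definition of the topology are
  seminorm balls.\<close>

lemma sup_seminorm_cases:
  assumes "compactin X K" "continuous_map X euclidean g"
  shows "\<forall>x\<in>K. cmod (g x) \<le> sup_seminorm K g"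
    and "sup_seminorm K g = 0 \<or> (\<exists>x\<in>K. sup_seminorm K g = cmod (g x))"
    and "0 \<le> sup_seminorm K g"
proof -
  have "compact ((\<lambda>x. cmod (g x)) ` K)"
    using image_compactin[OF assms(1) continuous_map_cmod[OF assms(2)]] by (simp add: compactin_euclidean_iff)
  then have "compact (insert 0 ((\<lambda>x. cmod (g x)) ` K))" by simp
  then obtain s where s: "s \<in> insert 0 ((\<lambda>x. cmod (g x)) ` K)" "\<forall>t\<in>insert 0 ((\<lambda>x. cmod (g x)) ` K). t \<le> s"
    using compact_attains_sup by blast
  then have "sup_seminorm K g = s"
    unfolding sup_seminorm_def by (intro cSup_eq_maximum) auto
  with s show "\<forall>x\<in>K. cmod (g x) \<le> sup_seminorm K g"
    "sup_seminorm K g = 0 \<or> (\<exists>x\<in>K. sup_seminorm K g = cmod (g x))" "0 \<le> sup_seminorm K g"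
    by auto
qed

lemma sup_seminorm_le_iff:
  assumes "compactin X K" "continuous_map X euclidean g" "0 \<le> e"
  shows "sup_seminorm K g \<le> e \<longleftrightarrow> (\<forall>x\<in>K. cmod (g x) \<le> e)"
  using sup_seminorm_cases[OF assms(1,2)] assms(3) by force

lemma sup_seminorm_less_iff:
  assumes "compactin X K" "continuous_map X euclidean g" "0 < e"
  shows "sup_seminorm K g < e \<longleftrightarrow> (\<forall>x\<in>K. cmod (g x) < e)"
  using sup_seminorm_cases[OF assms(1,2)] assms(3) by force

lemma function_algebra_simps [simp]:
  "carrier (function_algebra X \<F>) = continuous_functions X"
  "f \<otimes>\<^bsub>function_algebra X \<F>\<^esub> g = (\<lambda>x\<in>topspace X. f x * g x)"
  "\<one>\<^bsub>function_algebra X \<F>\<^esub> = (\<lambda>x\<in>topspace X. 1)"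
  "\<zero>\<^bsub>function_algebra X \<F>\<^esub> = (\<lambda>x\<in>topspace X. 0)"
  "f \<oplus>\<^bsub>function_algebra X \<F>\<^esub> g = (\<lambda>x\<in>topspace X. f x + g x)"
  "c \<odot>\<^bsub>function_algebra X \<F>\<^esub> f = (\<lambda>x\<in>topspace X. c * f x)"
  "star (function_algebra X \<F>) f = (\<lambda>x\<in>topspace X. cnj (f x))"
  by (simp_all add: function_algebra_def)

lemma restrict_continuous_functions:
  assumes "continuous_map X euclidean f"
  shows "restrict f (topspace X) \<in> continuous_functions X"
  using assms by (auto simp: continuous_functions_def intro: continuous_map_eq[of X euclidean f])

lemma continuous_functionsD:
  "f \<in> continuous_functions X \<Longrightarrow> continuous_map X euclidean f"
  "f \<in> continuous_functions X \<Longrightarrow> f \<in> extensional (topspace X)"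
  by (auto simp: continuous_functions_def)

lemma continuous_functions_eqI:
  assumes "f \<in> continuous_functions X" "g \<in> continuous_functions X"
    "\<And>x. x \<in> topspace X \<Longrightarrow> f x = g x"
  shows "f = g"
  using assms by (auto simp: continuous_functions_def intro: extensionalityI)

lemma continuous_map_cnj:
  "continuous_map X euclidean f \<Longrightarrow> continuous_map X euclidean (\<lambda>x. cnj (f x))"
  by (rule continuous_map_continuous_on_compose) (auto intro!: continuous_intros)

lemma continuous_functions_closed:
  assumes "f \<in> continuous_functions X" "g \<in> continuous_functions X"
  shows "(\<lambda>x\<in>topspace X. f x + g x) \<in> continuous_functions X"
    "(\<lambda>x\<in>topspace X. f x - g x) \<in> continuous_functions X"
    "(\<lambda>x\<in>topspace X. f x * g x) \<in> continuous_functions X"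
  using assms[THEN continuous_functionsD(1)]
  by (auto intro!: restrict_continuous_functions continuous_map_add continuous_map_diff
      continuous_map_complex_mult)

lemma continuous_functions_closed1:
  assumes "f \<in> continuous_functions X"
  shows "(\<lambda>x\<in>topspace X. - f x) \<in> continuous_functions X"
    "(\<lambda>x\<in>topspace X. c * f x) \<in> continuous_functions X"
    "(\<lambda>x\<in>topspace X. cnj (f x)) \<in> continuous_functions X"
  using continuous_functionsD(1)[OF assms]
  by (auto intro!: restrict_continuous_functions continuous_map_minus continuous_map_complex_mult
      continuous_map_cnj)

lemma const_continuous_functions: "(\<lambda>x\<in>topspace X. c) \<in> continuous_functions X"
  by (rule restrict_continuous_functions) simp

lemma restrict_topspace_continuous_functions:
  "f \<in> continuous_functions X \<Longrightarrow> restrict f (topspace X) = f"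
  by (simp add: continuous_functions_def extensional_restrict)

lemmas continuous_functions_simps =
  continuous_functions_closed continuous_functions_closed1 const_continuous_functions restrict_topspace_continuous_functions

lemma cring_function_algebra: "cring (function_algebra X \<F>)"
proof (rule cringI)
  show "abelian_group (function_algebra X \<F>)"
  proof (rule abelian_groupI)
    fix f assume "f \<in> carrier (function_algebra X \<F>)"
    then show "\<exists>y\<in>carrier (function_algebra X \<F>). y \<oplus>\<^bsub>function_algebra X \<F>\<^esub> f = \<zero>\<^bsub>function_algebra X \<F>\<^esub>"
      by (intro bexI[of _ "\<lambda>x\<in>topspace X. - f x"]) (auto simp: continuous_functions_simps)
  qed (auto simp: continuous_functions_simps add_ac
        cong: restrict_cong)
  show "comm_monoid (function_algebra X \<F>)"
    by (rule comm_monoidI)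
      (auto simp: continuous_functions_simps mult_ac cong: restrict_cong)
qed (auto simp: algebra_simps cong: restrict_cong)

lemma cring_complex_field: "cring complex_field"
proof (rule cringI)
  show "abelian_group complex_field"
  proof (rule abelian_groupI)
    fix x assume "x \<in> carrier complex_field"
    then show "\<exists>y\<in>carrier complex_field. y \<oplus>\<^bsub>complex_field\<^esub> x = \<zero>\<^bsub>complex_field\<^esub>"
      by (intro bexI[of _ "- x"]) (auto simp: complex_field_def)
  qed (auto simp: complex_field_def)
  show "comm_monoid complex_field"
    by (rule comm_monoidI) (auto simp: complex_field_def)
qed (auto simp: complex_field_def algebra_simps)

lemma function_algebra_minus:
  assumes "f \<in> continuous_functions X" "g \<in> continuous_functions X"
  shows "f \<ominus>\<^bsub>function_algebra X \<F>\<^esub> g = (\<lambda>x\<in>topspace X. f x - g x)"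
proof -
  interpret cring "function_algebra X \<F>" by (rule cring_function_algebra)
  have "\<ominus>\<^bsub>function_algebra X \<F>\<^esub> g = (\<lambda>x\<in>topspace X. - g x)"
    using assms by (intro minus_equality) (auto simp: continuous_functions_simps)
  then show ?thesis by (auto simp: a_minus_def)
qed

lemma star_algebra_function_algebra: "star_algebra (function_algebra X \<F>)"
proof -
  interpret cring "function_algebra X \<F>" by (rule cring_function_algebra)
  have "module complex_field (function_algebra X \<F>)"
    by (rule moduleI[OF cring_complex_field abelian_group_axioms])
      (auto simp: complex_field_def continuous_functions_simps algebra_simps
        cong: restrict_cong)
  then show ?thesis
    by (rule star_algebra.intro, unfold_locales)
      (auto simp: continuous_functions_simps algebra_simps
        cong: restrict_cong)
qed

subsection \<open>The pro-C*-algebra of continuous functions\<close>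

locale distinguished_family =
  fixes X :: "'x topology" and \<F> :: "'x set set"
  assumes tychonoff: "tychonoff_space X"
    and distinguished: "functionally_distinguished X \<F>"
begin

abbreviation C where "C \<equiv> continuous_functions X"
abbreviation A where "A \<equiv> function_algebra X \<F>"
abbreviation uball where "uball K f e \<equiv> {g \<in> C. \<forall>x\<in>K. cmod (g x - f x) < e}"

lemma compact_member: "K \<in> \<F> \<Longrightarrow> compactin X K"
  using distinguished by (simp add: functionally_distinguished_def)

lemma member_subset: "K \<in> \<F> \<Longrightarrow> K \<subseteq> topspace X"
  by (rule compactin_subset_topspace[OF compact_member])

lemma singleton_member: "x \<in> topspace X \<Longrightarrow> {x} \<in> \<F>"
  using distinguished by (simp add: functionally_distinguished_def)

lemma Union_member: "finite \<U> \<Longrightarrow> \<U> \<subseteq> \<F> \<Longrightarrow> \<Union>\<U> \<in> \<F>"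
  using distinguished by (simp add: functionally_distinguished_def)

lemma empty_member: "{} \<in> \<F>"
  using Union_member[of "{}"] by simp

lemma Un_member: "K \<in> \<F> \<Longrightarrow> L \<in> \<F> \<Longrightarrow> K \<union> L \<in> \<F>"
  using Union_member[of "{K, L}"] by simp

lemma subset_member: "K \<in> \<F> \<Longrightarrow> L \<subseteq> K \<Longrightarrow> compactin X L \<Longrightarrow> L \<in> \<F>"
  using distinguished unfolding functionally_distinguished_def by blast

lemma continuous_map_real_distinguished:
  fixes f :: "'x \<Rightarrow> real"
  shows "continuous_map X euclideanreal f \<longleftrightarrow> (\<forall>K\<in>\<F>. continuous_map (subtopology X K) euclideanreal f)"
  using distinguished unfolding functionally_distinguished_def by blast

lemma continuous_map_complex_distinguished:
  fixes f :: "'x \<Rightarrow> complex"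
  assumes "\<And>K. K \<in> \<F> \<Longrightarrow> continuous_map (subtopology X K) euclidean f"
  shows "continuous_map X euclidean f"
  using assms unfolding continuous_map_complex_iff continuous_map_real_distinguished by blast

text \<open>Closure of the family under finite unions provides the directedness: the supremum over
  \<open>K \<union> L\<close> dominates those over \<open>K\<close> and \<open>L\<close>.\<close>

lemma openin_function_algebra:
  "openin (topo A) U \<longleftrightarrow> U \<subseteq> C \<and> (\<forall>f\<in>U. \<exists>K\<in>\<F>. \<exists>e>0. uball K f e \<subseteq> U)"
proof -
  let ?d = "\<lambda>K g f. sup_seminorm K (\<lambda>x. g x - f x)"
  have cont: "continuous_map X euclidean (\<lambda>x. g x - f x)" if "g \<in> C" "f \<in> C" for f g
    using that by (intro continuous_map_diff) (auto dest: continuous_functionsD)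
  have ball: "uball K f e = {g \<in> C. ?d K g f < e}" if "K \<in> \<F>" "f \<in> C" "0 < e" for K f e
    using sup_seminorm_less_iff[OF compact_member[OF that(1)] cont[OF _ that(2)] that(3)] by auto
  have T: "topo A = topology_generated_by {{g \<in> C. ?d K g f < e} | K f e. K \<in> \<F> \<and> f \<in> C \<and> 0 < e}"
    unfolding function_algebra_def top_star_algebra.simps
    by (rule arg_cong[of _ _ topology_generated_by]) (use ball in blast)
  have "openin (topo A) U \<longleftrightarrow> U \<subseteq> C \<and> (\<forall>f\<in>U. \<exists>K\<in>\<F>. \<exists>e>0. {g \<in> C. ?d K g f < e} \<subseteq> U)"
    unfolding T
  proof (rule openin_topology_generated_by_balls)
    fix K f assume "K \<in> \<F>" "f \<in> C"
    show "?d K f f = 0" using sup_seminorm_cases[of X K "\<lambda>x. 0"] compact_member[OF \<open>K \<in> \<F>\<close>] by auto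
  next
    fix K f g h assume *: "K \<in> \<F>" "f \<in> C" "g \<in> C" "h \<in> C"
    note up = sup_seminorm_cases[OF compact_member[OF *(1)] cont]
    show "?d K h f \<le> ?d K h g + ?d K g f"
    proof (subst sup_seminorm_le_iff[OF compact_member[OF *(1)] cont[OF *(4,2)]])
      show "0 \<le> ?d K h g + ?d K g f" using up(3) * by simp
      show "\<forall>x\<in>K. cmod (h x - f x) \<le> ?d K h g + ?d K g f"
      proof
        fix x assume "x \<in> K"
        then have "cmod (h x - g x) \<le> ?d K h g" "cmod (g x - f x) \<le> ?d K g f"
          using up(1)[OF *(4,3)] up(1)[OF *(3,2)] by blast+
        then show "cmod (h x - f x) \<le> ?d K h g + ?d K g f"
          using norm_diff_triangle_le by blast
      qed
    qed
  next
    fix K L assume *: "K \<in> \<F>" "L \<in> \<F>"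
    show "\<exists>M\<in>\<F>. \<forall>f\<in>C. \<forall>g\<in>C. ?d K g f \<le> ?d M g f \<and> ?d L g f \<le> ?d M g f"
    proof (intro bexI[of _ "K \<union> L"] ballI)
      fix f g assume fg: "f \<in> C" "g \<in> C"
      note up = sup_seminorm_cases[OF compact_member[OF Un_member[OF *]] cont[OF fg(2,1)]]
      show "?d K g f \<le> ?d (K \<union> L) g f \<and> ?d L g f \<le> ?d (K \<union> L) g f"
        using sup_seminorm_le_iff[OF compact_member[OF *(1)] cont[OF fg(2,1)] up(3)]
          sup_seminorm_le_iff[OF compact_member[OF *(2)] cont[OF fg(2,1)] up(3)] up(1) by blast
    qed (use Un_member * in blast)
  qed (use empty_member in blast)
  also have "\<dots> \<longleftrightarrow> U \<subseteq> C \<and> (\<forall>f\<in>U. \<exists>K\<in>\<F>. \<exists>e>0. uball K f e \<subseteq> U)"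
  proof -
    have *: "(\<exists>e>0. {g \<in> C. ?d K g f < e} \<subseteq> U) \<longleftrightarrow> (\<exists>e>0. uball K f e \<subseteq> U)"
      if "U \<subseteq> C" "f \<in> U" "K \<in> \<F>" for f K
      using that by (intro ex_cong1 conj_cong refl) (simp add: ball subset_iff)
    show ?thesis
      by (intro conj_cong refl ball_cong bex_cong) (rule *)
  qed
  finally show ?thesis .
qed

lemma topspace_function_algebra: "topspace (topo A) = C"
proof
  show "topspace (topo A) \<subseteq> C" using openin_function_algebra openin_topspace by blast
  have "openin (topo A) C"
    unfolding openin_function_algebra using empty_member by (auto intro!: exI[of _ "1::real"])
  then show "C \<subseteq> topspace (topo A)" by (rule openin_subset)
qed

lemma uball_self: "f \<in> C \<Longrightarrow> 0 < e \<Longrightarrow> f \<in> uball K f e"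
  by auto

lemma openin_uball:
  assumes "K \<in> \<F>" "f \<in> C" "0 < e"
  shows "openin (topo A) (uball K f e)"
  unfolding function_algebra_def top_star_algebra.simps
  by (rule topology_generated_by_Basis) (use assms in blast)

lemma continuous_into_function_algebra:
  assumes "\<And>y. y \<in> topspace Y \<Longrightarrow> h y \<in> C"
    and "\<And>y K e. \<lbrakk>y \<in> topspace Y; K \<in> \<F>; (e::real) > 0\<rbrakk> \<Longrightarrow>
        \<exists>V. openin Y V \<and> y \<in> V \<and> (\<forall>z\<in>V. h z \<in> uball K (h y) e)"
  shows "continuous_map Y (topo A) h"
  using continuous_map_into_ballsI[where Q = uball and I = \<F> and C = C and T = "topo A", OF openin_function_algebra topspace_function_algebra, of Y h] assms
  by blast

lemma bounded_on_member:
  assumes "K \<in> \<F>" "f \<in> C"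
  obtains M where "0 \<le> M" "\<And>x. x \<in> K \<Longrightarrow> cmod (f x) \<le> M"
  using sup_seminorm_cases[OF compact_member[OF assms(1)] continuous_functionsD(1)[OF assms(2)]] by blast

lemma continuous_add:
  "continuous_map (prod_topology (topo A) (topo A)) (topo A) (\<lambda>(f, g). f \<oplus>\<^bsub>A\<^esub> g)"
proof (rule continuous_into_function_algebra)
  fix y K and e :: real
  assume y: "y \<in> topspace (prod_topology (topo A) (topo A))" "K \<in> \<F>" "0 < e"
  then obtain f g where fg: "y = (f, g)" "f \<in> C" "g \<in> C" by (auto simp: topspace_function_algebra)
  show "\<exists>V. openin (prod_topology (topo A) (topo A)) V \<and> y \<in> V \<and>
      (\<forall>z\<in>V. (case z of (f, g) \<Rightarrow> f \<oplus>\<^bsub>A\<^esub> g) \<in> uball K (case y of (f, g) \<Rightarrow> f \<oplus>\<^bsub>A\<^esub> g) e)"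
  proof (intro exI[of _ "uball K f (e/2) \<times> uball K g (e/2)"] conjI ballI)
    show "openin (prod_topology (topo A) (topo A)) (uball K f (e/2) \<times> uball K g (e/2))"
      using y fg unfolding openin_prod_Times_iff by (intro disjI2 conjI openin_uball) auto
    fix z assume "z \<in> uball K f (e/2) \<times> uball K g (e/2)"
    then obtain f' g' where z: "z = (f', g')" "f' \<in> uball K f (e/2)" "g' \<in> uball K g (e/2)" by blast
    have "cmod (f' x + g' x - (f x + g x)) < e" if "x \<in> K" for x
      using norm_diff_triangle_ineq[of "f' x" "g' x" "f x" "g x"] z that by fastforce
    then show "(case z of (f, g) \<Rightarrow> f \<oplus>\<^bsub>A\<^esub> g) \<in> uball K (case y of (f, g) \<Rightarrow> f \<oplus>\<^bsub>A\<^esub> g) e"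
      using z fg member_subset[OF y(2)] by (auto simp: continuous_functions_simps)
  qed (use fg y in \<open>auto\<close>)
qed (auto simp: topspace_function_algebra continuous_functions_simps)

lemma continuous_mult:
  "continuous_map (prod_topology (topo A) (topo A)) (topo A) (\<lambda>(f, g). f \<otimes>\<^bsub>A\<^esub> g)"
proof (rule continuous_into_function_algebra)
  fix y K and e :: real
  assume y: "y \<in> topspace (prod_topology (topo A) (topo A))" "K \<in> \<F>" "0 < e"
  then obtain f g where fg: "y = (f, g)" "f \<in> C" "g \<in> C" by (auto simp: topspace_function_algebra)
  obtain M1 where M1: "0 \<le> M1" "\<And>x. x \<in> K \<Longrightarrow> cmod (f x) \<le> M1" using bounded_on_member y fg by blast
  obtain M2 where M2: "0 \<le> M2" "\<And>x. x \<in> K \<Longrightarrow> cmod (g x) \<le> M2" using bounded_on_member y fg by blast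
  obtain \<delta> where \<delta>: "0 < \<delta>" "\<delta> \<le> 1" "\<delta> * (1 + 2 * max M1 M2) \<le> e"
    using exists_mult_modulus[OF max.coboundedI1[OF M1(1)] y(3)] by blast
  show "\<exists>V. openin (prod_topology (topo A) (topo A)) V \<and> y \<in> V \<and>
      (\<forall>z\<in>V. (case z of (f, g) \<Rightarrow> f \<otimes>\<^bsub>A\<^esub> g) \<in> uball K (case y of (f, g) \<Rightarrow> f \<otimes>\<^bsub>A\<^esub> g) e)"
  proof (intro exI[of _ "uball K f \<delta> \<times> uball K g \<delta>"] conjI ballI)
    show "openin (prod_topology (topo A) (topo A)) (uball K f \<delta> \<times> uball K g \<delta>)"
      using openin_uball y fg \<delta> by (simp add: openin_prod_Times_iff)
    fix z assume "z \<in> uball K f \<delta> \<times> uball K g \<delta>"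
    then obtain f' g' where z: "z = (f', g')" "f' \<in> uball K f \<delta>" "g' \<in> uball K g \<delta>" by blast
    have "cmod (f' x * g' x - f x * g x) < e" if "x \<in> K" for x
      using z that M1(2)[OF that] M2(2)[OF that] \<delta> by (intro norm_mult_diff_less[of _ _ \<delta> _ _ "max M1 M2"]) auto
    then show "(case z of (f, g) \<Rightarrow> f \<otimes>\<^bsub>A\<^esub> g) \<in> uball K (case y of (f, g) \<Rightarrow> f \<otimes>\<^bsub>A\<^esub> g) e"
      using z fg member_subset[OF y(2)] by (auto simp: continuous_functions_simps)
  qed (use fg \<delta> in \<open>auto\<close>)
qed (auto simp: topspace_function_algebra continuous_functions_simps)

lemma continuous_smult:
  "continuous_map (prod_topology euclidean (topo A)) (topo A) (\<lambda>(c, f). c \<odot>\<^bsub>A\<^esub> f)"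
proof (rule continuous_into_function_algebra)
  fix y :: "complex \<times> ('x \<Rightarrow> complex)" and K and e :: real
  assume y: "y \<in> topspace (prod_topology euclidean (topo A))" "K \<in> \<F>" "0 < e"
  then obtain c g where fg: "y = (c, g)" "g \<in> C" by (auto simp: topspace_function_algebra)
  obtain M where M: "0 \<le> M" "\<And>x. x \<in> K \<Longrightarrow> cmod (g x) \<le> M" using bounded_on_member y fg by blast
  obtain \<delta> where \<delta>: "0 < \<delta>" "\<delta> \<le> 1" "\<delta> * (1 + 2 * max (cmod c) M) \<le> e"
    using exists_mult_modulus[OF max.coboundedI1[OF norm_ge_zero] y(3)] by blast
  show "\<exists>V. openin (prod_topology euclidean (topo A)) V \<and> y \<in> V \<and>
      (\<forall>z\<in>V. (case z of (c, f) \<Rightarrow> c \<odot>\<^bsub>A\<^esub> f) \<in> uball K (case y of (c, f) \<Rightarrow> c \<odot>\<^bsub>A\<^esub> f) e)"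
  proof (intro exI[of _ "ball c \<delta> \<times> uball K g \<delta>"] conjI ballI)
    show "openin (prod_topology euclidean (topo A)) (ball c \<delta> \<times> uball K g \<delta>)"
      using openin_uball y fg \<delta> by (simp add: openin_prod_Times_iff)
    fix z assume "z \<in> ball c \<delta> \<times> uball K g \<delta>"
    then obtain c' g' where z: "z = (c', g')" "cmod (c' - c) < \<delta>" "g' \<in> uball K g \<delta>"
      by (auto simp: dist_norm norm_minus_commute)
    have "cmod (c' * g' x - c * g x) < e" if "x \<in> K" for x
      using z that M(2)[OF that] \<delta> by (intro norm_mult_diff_less[of _ _ \<delta> _ _ "max (cmod c) M"]) auto
    then show "(case z of (c, f) \<Rightarrow> c \<odot>\<^bsub>A\<^esub> f) \<in> uball K (case y of (c, f) \<Rightarrow> c \<odot>\<^bsub>A\<^esub> f) e"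
      using z fg member_subset[OF y(2)] by (auto simp: continuous_functions_simps)
  qed (use fg \<delta> in \<open>auto\<close>)
qed (auto simp: topspace_function_algebra continuous_functions_simps)

lemma continuous_star: "continuous_map (topo A) (topo A) (star A)"
proof (rule continuous_into_function_algebra)
  fix f K and e :: real
  assume y: "f \<in> topspace (topo A)" "K \<in> \<F>" "0 < e"
  then have f: "f \<in> C" by (simp add: topspace_function_algebra)
  show "\<exists>V. openin (topo A) V \<and> f \<in> V \<and> (\<forall>z\<in>V. star A z \<in> uball K (star A f) e)"
  proof (intro exI[of _ "uball K f e"] conjI ballI)
    fix z assume "z \<in> uball K f e"
    then show "star A z \<in> uball K (star A f) e"
      using member_subset[OF y(2)] f by (auto simp: continuous_functions_simps simp flip: complex_cnj_diff)
  qed (use f y openin_uball in auto)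
qed (auto simp: topspace_function_algebra continuous_functions_simps)

lemma topological_star_algebra_function_algebra: "topological_star_algebra A"
  using continuous_add continuous_mult continuous_smult continuous_star
  by (intro topological_star_algebra.intro star_algebra_function_algebra topological_star_algebra_axioms.intro)
    (simp_all add: topspace_function_algebra)

lemma sup_seminorm_continuous_cstar_seminorm:
  assumes K: "K \<in> \<F>"
  shows "sup_seminorm K \<in> continuous_cstar_seminorms A"
proof -
  have cont: "continuous_map X euclidean f" if "f \<in> C" for f using that by (rule continuous_functionsD)
  note up = sup_seminorm_cases[OF compact_member[OF K] cont]
  note le_iff = sup_seminorm_le_iff[OF compact_member[OF K] cont]
  have KX: "x \<in> topspace X" if "x \<in> K" for x using member_subset[OF K] that by blast
  have "cstar_seminorm A (sup_seminorm K)"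
    unfolding cstar_seminorm_def function_algebra_simps
  proof (intro conjI ballI allI)
    fix f assume f: "f \<in> C"
    show "0 \<le> sup_seminorm K f" by (rule up(3)[OF f])
    fix c
    have cf: "(\<lambda>x\<in>topspace X. c * f x) \<in> C" using f by (simp add: continuous_functions_simps)
    show "sup_seminorm K (\<lambda>x\<in>topspace X. c * f x) = cmod c * sup_seminorm K f"
    proof (rule antisym)
      show "sup_seminorm K (\<lambda>x\<in>topspace X. c * f x) \<le> cmod c * sup_seminorm K f"
        using up[OF f] KX by (subst le_iff[OF cf]) (auto simp: norm_mult intro: mult_left_mono)
      show "cmod c * sup_seminorm K f \<le> sup_seminorm K (\<lambda>x\<in>topspace X. c * f x)"
      \<comment> \<open>The value 0 may come from the inserted element, with no point of
        \<open>K\<close> attaining it.\<close>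
      proof (cases "sup_seminorm K f = 0")
        case False
        then obtain x where x: "x \<in> K" "sup_seminorm K f = cmod (f x)" using up(2)[OF f] by blast
        then show ?thesis using up(1)[OF cf] KX[OF x(1)] by (auto simp: norm_mult dest!: bspec)
      qed (simp add: up(3)[OF cf])
    qed
    have sf: "(\<lambda>x\<in>topspace X. (\<lambda>x\<in>topspace X. cnj (f x)) x * f x) \<in> C"
      by (rule continuous_functions_closed(3)[OF continuous_functions_closed1(3)[OF f] f])
    show "sup_seminorm K (\<lambda>x\<in>topspace X. (\<lambda>x\<in>topspace X. cnj (f x)) x * f x) = (sup_seminorm K f)\<^sup>2"
    proof (rule antisym)
      show "sup_seminorm K (\<lambda>x\<in>topspace X. (\<lambda>x\<in>topspace X. cnj (f x)) x * f x) \<le> (sup_seminorm K f)\<^sup>2"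
        using up[OF f] KX by (subst le_iff[OF sf]) (auto simp: norm_mult power2_eq_square intro: mult_mono)
      show "(sup_seminorm K f)\<^sup>2 \<le> sup_seminorm K (\<lambda>x\<in>topspace X. (\<lambda>x\<in>topspace X. cnj (f x)) x * f x)"
      proof (cases "sup_seminorm K f = 0")
        case False
        then obtain x where x: "x \<in> K" "sup_seminorm K f = cmod (f x)" using up(2)[OF f] by blast
        then show ?thesis using bspec[OF up(1)[OF sf] x(1)] KX[OF x(1)] by (simp add: norm_mult power2_eq_square)
      qed (use up(3)[OF sf] in simp)
    qed
  next
    fix f g assume fg: "f \<in> C" "g \<in> C"
    note upf = up[OF fg(1)] and upg = up[OF fg(2)]
    have "(\<lambda>x\<in>topspace X. f x + g x) \<in> C" "(\<lambda>x\<in>topspace X. f x * g x) \<in> C"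
      using fg by (simp_all add: continuous_functions_simps)
    note le = le_iff[OF this(1)] le_iff[OF this(2)]
    show "sup_seminorm K (\<lambda>x\<in>topspace X. f x + g x) \<le> sup_seminorm K f + sup_seminorm K g"
      using upf upg KX by (subst le(1)) (auto intro!: norm_triangle_le add_mono)
    show "sup_seminorm K (\<lambda>x\<in>topspace X. f x * g x) \<le> sup_seminorm K f * sup_seminorm K g"
      using upf upg KX by (subst le(2)) (auto simp: norm_mult intro!: mult_mono)
  qed
  moreover have "continuous_map (topo A) euclideanreal (sup_seminorm K)"
    unfolding Met_TC.continuous_map_to_metric[where X = "topo A" and f = "sup_seminorm K", unfolded mtopology_is_euclidean]
  proof (intro ballI allI impI)
    fix f and e :: real assume "f \<in> topspace (topo A)" "0 < e"
    then have f: "f \<in> C" by (simp add: topspace_function_algebra)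
    \<comment> \<open>Half the radius, because both comparisons below yield only non-strict
      bounds.\<close>
    have "sup_seminorm K g \<in> Met_TC.mball (sup_seminorm K f) e" if "g \<in> uball K f (e/2)" for g
    proof -
      have g: "g \<in> C" "\<And>x. x \<in> K \<Longrightarrow> cmod (g x - f x) < e/2" using that by auto
      have "sup_seminorm K g \<le> sup_seminorm K f + e/2"
      proof (subst le_iff[OF g(1)])
        show "\<forall>x\<in>K. cmod (g x) \<le> sup_seminorm K f + e/2"
        proof
          fix x assume "x \<in> K"
          then show "cmod (g x) \<le> sup_seminorm K f + e/2"
            using g(2)[of x] up(1)[OF f] norm_triangle_sub[of "g x" "f x"] by fastforce
        qed
      qed (use up(3)[OF f] \<open>0 < e\<close> in simp)
      moreover have "sup_seminorm K f \<le> sup_seminorm K g + e/2"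
      proof (subst le_iff[OF f])
        show "\<forall>x\<in>K. cmod (f x) \<le> sup_seminorm K g + e/2"
        proof
          fix x assume "x \<in> K"
          then show "cmod (f x) \<le> sup_seminorm K g + e/2"
            using g(2)[of x] up(1)[OF g(1)] norm_triangle_sub[of "f x" "g x"] by (fastforce simp: norm_minus_commute)
        qed
      qed (use up(3)[OF g(1)] \<open>0 < e\<close> in simp)
      ultimately show ?thesis using \<open>0 < e\<close> by (auto simp: dist_real_def)
    qed
    then show "\<exists>U. openin (topo A) U \<and> f \<in> U \<and> (\<forall>y\<in>U. sup_seminorm K y \<in> Met_TC.mball (sup_seminorm K f) e)"
      using openin_uball[OF K f, of "e/2"] f \<open>0 < e\<close> by (intro exI[of _ "uball K f (e/2)"]) auto
  qed
  ultimately show ?thesis by (simp add: continuous_cstar_seminorms_def)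
qed

lemma Hausdorff_function_algebra: "Hausdorff_space (topo A)"
  unfolding Hausdorff_space_def topspace_function_algebra
proof (intro allI impI, elim conjE)
  fix f g assume fg: "f \<in> C" "g \<in> C" "f \<noteq> g"
  then obtain x where x: "x \<in> topspace X" "f x \<noteq> g x" using continuous_functions_eqI by blast
  let ?e = "cmod (f x - g x) / 2"
  have e: "0 < ?e" using x by simp
  have "disjnt (uball {x} f ?e) (uball {x} g ?e)"
  proof -
    have "cmod (f x - g x) \<le> cmod (h x - f x) + cmod (h x - g x)" for h :: "'x \<Rightarrow> complex"
      using norm_triangle_ineq4[of "h x - g x" "h x - f x"] by (simp add: algebra_simps)
    then have False if "h \<in> uball {x} f ?e" "h \<in> uball {x} g ?e" for h
      using that by (auto dest!: meta_spec[of _ h])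
    then show ?thesis unfolding disjnt_def by blast
  qed
  then show "\<exists>U V. openin (topo A) U \<and> openin (topo A) V \<and> f \<in> U \<and> g \<in> V \<and> disjnt U V"
    using openin_uball[OF singleton_member[OF x(1)] fg(1) e] openin_uball[OF singleton_member[OF x(1)] fg(2) e] fg e
    by (intro exI[of _ "uball {x} f ?e"] exI[of _ "uball {x} g ?e"] conjI) auto
qed

text \<open>The pointwise limit of a Cauchy filter is uniform on each member, hence continuous on
  each member. Passing from there to continuity on \<open>X\<close> is exactly the last condition of
  a functionally distinguished family.\<close>

lemma complete_function_algebra: "complete_algebra A"
  unfolding complete_algebra_def
proof (intro allI impI, elim conjE)
  fix F :: "('x \<Rightarrow> complex) filter"
  assume nb: "F \<noteq> bot" and cauchy: "cauchy_filter_in A F"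
  have evC: "\<forall>\<^sub>F f in F. f \<in> C" using cauchy by (simp add: cauchy_filter_in_def)
  have key: "\<exists>Q. eventually Q F \<and> (\<forall>f g. Q f \<longrightarrow> Q g \<longrightarrow> f \<in> C \<and> (\<forall>x\<in>K. cmod (f x - g x) < e))"
    if K: "K \<in> \<F>" and e: "0 < e" for K and e :: real
  proof -
    have "\<zero>\<^bsub>A\<^esub> \<in> C" by (simp add: const_continuous_functions)
    then have "openin (topo A) (uball K \<zero>\<^bsub>A\<^esub> e)" "\<zero>\<^bsub>A\<^esub> \<in> uball K \<zero>\<^bsub>A\<^esub> e"
      by (rule openin_uball[OF K _ e], rule uball_self[OF _ e])
    then have "\<forall>\<^sub>F (f, g) in F \<times>\<^sub>F F. f \<ominus>\<^bsub>A\<^esub> g \<in> uball K \<zero>\<^bsub>A\<^esub> e"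
      using cauchy unfolding cauchy_filter_in_def by blast
    then obtain Q where Q: "eventually Q F" "\<And>f g. Q f \<Longrightarrow> Q g \<Longrightarrow> f \<ominus>\<^bsub>A\<^esub> g \<in> uball K \<zero>\<^bsub>A\<^esub> e"
      unfolding eventually_prod_same by auto
    show ?thesis
    proof (intro exI[of _ "\<lambda>f. Q f \<and> f \<in> C"] conjI allI impI ballI)
      show "\<forall>\<^sub>F f in F. Q f \<and> f \<in> C" using Q(1) evC by (rule eventually_conj)
      fix f g x assume fg: "Q f \<and> f \<in> C" "Q g \<and> g \<in> C" "x \<in> K"
      then have "f \<ominus>\<^bsub>A\<^esub> g \<in> uball K \<zero>\<^bsub>A\<^esub> e" using Q(2) by blast
      then have "cmod ((f \<ominus>\<^bsub>A\<^esub> g) x - \<zero>\<^bsub>A\<^esub> x) < e" using fg(3) by blast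
      moreover have "x \<in> topspace X" using fg(3) member_subset[OF K] by blast
      ultimately show "cmod (f x - g x) < e"
        using fg by (simp add: function_algebra_minus)
    qed simp
  qed
  \<comment> \<open>Singletons are members, so evaluation at a point sends the filter to a Cauchy
    filter of complex numbers.\<close>
  have "\<exists>l. ((\<lambda>f. f x) \<longlongrightarrow> l) F" if x: "x \<in> topspace X" for x
  proof -
    have "cauchy_filter (filtermap (\<lambda>f. f x) F)"
      unfolding cauchy_filter_metric_filtermap dist_norm
      using key[OF singleton_member[OF x]] by simp meson
    then show ?thesis
      using complete_uniform[of "UNIV :: complex set"] complete_UNIV nb
      by (auto simp: filterlim_def filtermap_bot_iff)
  qed
  then obtain l where l: "\<And>x. x \<in> topspace X \<Longrightarrow> ((\<lambda>f. f x) \<longlongrightarrow> l x) F" by metis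
  have unif: "\<forall>\<^sub>F f in F. \<forall>x\<in>K. cmod (f x - l x) < e" if K: "K \<in> \<F>" and e: "0 < e" for K and e :: real
  proof -
    obtain Q where Q: "eventually Q F" "\<And>f g. Q f \<Longrightarrow> Q g \<Longrightarrow> f \<in> C \<and> (\<forall>x\<in>K. cmod (f x - g x) < e/2)"
      using key[OF K, of "e/2"] e by auto
    from Q(1) show ?thesis
    proof (rule eventually_mono, intro ballI)
      fix f x assume f: "Q f" and x: "x \<in> K"
      \<comment> \<open>With \<open>f\<close> fixed, \<open>g\<close> runs along the filter; limits
        keep only non-strict bounds, hence \<open>e/2\<close>.\<close>
      have "((\<lambda>g. cmod (f x - g x)) \<longlongrightarrow> cmod (f x - l x)) F"
        using l x member_subset[OF K] by (intro tendsto_intros) auto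
      moreover have "\<forall>\<^sub>F g in F. cmod (f x - g x) \<le> e/2"
        using Q(1) by (rule eventually_mono) (use Q(2)[OF f] x in \<open>auto intro: less_imp_le\<close>)
      ultimately have "cmod (f x - l x) \<le> e/2" using nb by (intro tendsto_upperbound)
      then show "cmod (f x - l x) < e" using e by simp
    qed
  qed
  have "continuous_map (subtopology X K) euclidean l" if K: "K \<in> \<F>" for K
  proof -
    have "continuous_map (subtopology X K) (Met_TC.mtopology :: complex topology) l"
    proof (rule Met_TC.continuous_map_uniform_limit[where F = F and f = "\<lambda>f. f"])
      show "\<forall>\<^sub>F f in F. continuous_map (subtopology X K) (Met_TC.mtopology :: complex topology) f"
        using evC by (rule eventually_mono)
          (auto simp: mtopology_is_euclidean intro: continuous_map_from_subtopology continuous_functionsD)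
      fix e :: real assume "0 < e"
      then show "\<forall>\<^sub>F f in F. \<forall>x\<in>topspace (subtopology X K). l x \<in> UNIV \<and> dist (f x) (l x) < e"
        using unif[OF K \<open>0 < e\<close>] by (auto simp: dist_norm elim!: eventually_mono)
    qed (use nb in simp)
    then show ?thesis by (simp add: mtopology_is_euclidean)
  qed
  then have "continuous_map X euclidean l" by (rule continuous_map_complex_distinguished)
  then have L: "restrict l (topspace X) \<in> C" by (rule restrict_continuous_functions)
  have "limitin (topo A) (\<lambda>f. f) (restrict l (topspace X)) F"
    unfolding limitin_def topspace_function_algebra
  proof (intro conjI allI impI L, elim conjE)
    fix U assume U: "openin (topo A) U" "restrict l (topspace X) \<in> U"
    then obtain K e where K: "K \<in> \<F>" "e > 0" "uball K (restrict l (topspace X)) e \<subseteq> U"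
      unfolding openin_function_algebra by blast
    have "\<forall>\<^sub>F f in F. f \<in> uball K (restrict l (topspace X)) e"
      using unif[OF K(1,2)] evC by eventually_elim (use member_subset[OF K(1)] in auto)
    then show "\<forall>\<^sub>F f in F. f \<in> U" by (rule eventually_mono) (use K(3) in blast)
  qed
  then show "\<exists>l. limitin (topo A) (\<lambda>x. x) l F" by blast
qed

text \<open>One inclusion exhibits each ball as a ball of \<open>sup_seminorm K\<close>. The other
  must handle arbitrary continuous C*-seminorms: their balls are preimages under a translation
  followed by a continuous map, so no description of these seminorms is required.\<close>

lemma function_algebra_generated_by_seminorms:
  "topo A = topology_generated_by
     {{g \<in> carrier A. p (g \<ominus>\<^bsub>A\<^esub> f) < e} | p f e. p \<in> continuous_cstar_seminorms A \<and> f \<in> carrier A \<and> 0 < e}"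
    (is "topo A = topology_generated_by ?G")
  unfolding topology_eq
proof (intro allI iffI)
  fix U assume U: "openin (topo A) U"
  show "openin (topology_generated_by ?G) U"
  proof (subst openin_subopen, intro ballI)
    fix f assume "f \<in> U"
    then obtain K e where K: "K \<in> \<F>" "e > 0" "uball K f e \<subseteq> U" and f: "f \<in> C"
      using U unfolding openin_function_algebra by blast
    have "sup_seminorm K (g \<ominus>\<^bsub>A\<^esub> f) < e \<longleftrightarrow> (\<forall>x\<in>K. cmod (g x - f x) < e)" if "g \<in> C" for g
    proof -
      have "continuous_map X euclidean (g \<ominus>\<^bsub>A\<^esub> f)"
        by (rule continuous_functionsD(1)) (simp add: that f function_algebra_minus continuous_functions_simps)
      then show ?thesis
        using that f K member_subset[OF K(1)] by (subst sup_seminorm_less_iff[OF compact_member[OF K(1)] _ K(2)])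
          (auto simp: function_algebra_minus)
    qed
    then have "uball K f e = {g \<in> carrier A. sup_seminorm K (g \<ominus>\<^bsub>A\<^esub> f) < e}" by auto
    then have "uball K f e \<in> ?G"
      using sup_seminorm_continuous_cstar_seminorm[OF K(1)] f K(2) by auto
    then have "openin (topology_generated_by ?G) (uball K f e)"
      by (rule topology_generated_by_Basis)
    with K(3) uball_self[OF f K(2)] show "\<exists>T. openin (topology_generated_by ?G) T \<and> f \<in> T \<and> T \<subseteq> U"
      by (intro exI[of _ "uball K f e"] conjI)
  qed
next
  fix U assume "openin (topology_generated_by ?G) U"
  then have "generate_topology_on ?G U" by (rule openin_topology_generated_by)
  then show "openin (topo A) U"
  proof (rule generate_topology_on_coarsest[OF istopology_openin, rotated])
    fix S assume "S \<in> ?G"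
    then obtain p f e where S: "S = {g \<in> C. p (g \<ominus>\<^bsub>A\<^esub> f) < e}" "p \<in> continuous_cstar_seminorms A" "f \<in> C"
      by auto
    have "continuous_map (topo A) (topo A) (\<lambda>g. g \<ominus>\<^bsub>A\<^esub> f)"
    proof (rule continuous_into_function_algebra)
      fix g K and e :: real
      assume "g \<in> topspace (topo A)" and K: "K \<in> \<F>" "0 < e"
      then have g: "g \<in> C" by (simp add: topspace_function_algebra)
      show "\<exists>V. openin (topo A) V \<and> g \<in> V \<and> (\<forall>z\<in>V. z \<ominus>\<^bsub>A\<^esub> f \<in> uball K (g \<ominus>\<^bsub>A\<^esub> f) e)"
        using g S(3) K openin_uball[OF K(1) g K(2)] member_subset[OF K(1)]
        by (intro exI[of _ "uball K g e"]) (auto simp: function_algebra_minus continuous_functions_simps subset_iff)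
    qed (use S in \<open>auto simp: topspace_function_algebra function_algebra_minus continuous_functions_simps\<close>)
    moreover have "continuous_map (topo A) euclideanreal p"
      using S by (simp add: continuous_cstar_seminorms_def)
    ultimately have "continuous_map (topo A) euclideanreal (p \<circ> (\<lambda>g. g \<ominus>\<^bsub>A\<^esub> f))"
      by (rule continuous_map_compose)
    then have "openin (topo A) {g \<in> topspace (topo A). (p \<circ> (\<lambda>g. g \<ominus>\<^bsub>A\<^esub> f)) g \<in> {..<e}}"
      by (rule openin_continuous_map_preimage) simp
    then show "openin (topo A) S" by (simp add: S(1) topspace_function_algebra)
  qed
qed

theorem pro_cstar_algebra_function_algebra: "pro_cstar_algebra A"
  by (intro pro_cstar_algebra.intro topological_star_algebra_function_algebra pro_cstar_algebra_axioms.intro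
      Hausdorff_function_algebra complete_function_algebra function_algebra_generated_by_seminorms)

end

subsection \<open>Barrels\<close>

text \<open>Bookkeeping for the gliding hump: stage \<open>k\<close> fixes membership of all indices
  below \<open>M k\<close> for good, so the final set is the finite set of any stage plus a tail
  that begins at \<open>M k\<close>.\<close>

lemma Union_initial_segments:
  fixes D :: "nat \<Rightarrow> nat set" and M :: "nat \<Rightarrow> nat"
  assumes step: "\<And>k. D (Suc k) \<inter> {..<M k} = D k" and M: "\<And>k. M k \<le> M (Suc k)"
    and D: "\<And>k. D k \<subseteq> {..<M k}"
  shows "(\<Union>j. D j) = D k \<union> ((\<Union>j. D j) \<inter> {M k..})"
proof -
  have stable: "x \<in> D j \<longleftrightarrow> x \<in> D i" if "i \<le> j" "x < M i" for i j x
    using that(1)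
  proof (induction j rule: dec_induct)
    case (step n)
    have "M i \<le> M n" using M step.hyps(1) by (rule lift_Suc_mono_le)
    then have "x < M n" using that(2) by simp
    then have "x \<in> D (Suc n) \<longleftrightarrow> x \<in> D n" using assms(1)[of n] by blast
    then show ?case using step.IH by simp
  qed simp
  have "x \<in> D k" if x: "x \<in> D j" "x < M k" for x j
  proof (cases "j \<le> k")
    case True
    then show ?thesis using stable[of j k x] x(1) D[of j] by auto
  next
    case False
    then show ?thesis using stable[of k j x] x by auto
  qed
  then show ?thesis by (force simp: not_less[symmetric])
qed

context distinguished_family
begin

lemma Hausdorff_X: "Hausdorff_space X"
  using tychonoff unfolding tychonoff_space_def
  by (blast intro: regular_t1_imp_Hausdorff_space completely_regular_imp_regular_space)

lemma barrel_subset: "barrel A B \<Longrightarrow> B \<subseteq> C"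
  unfolding barrel_def using closedin_subset topspace_function_algebra by blast

lemma barrel_convex:
  assumes "barrel A B" "f \<in> B" "g \<in> B" "cmod a + cmod b \<le> 1"
  shows "(\<lambda>x\<in>topspace X. a * f x + b * g x) \<in> B"
proof -
  have "a \<odot>\<^bsub>A\<^esub> f \<oplus>\<^bsub>A\<^esub> b \<odot>\<^bsub>A\<^esub> g \<in> B"
    using assms unfolding barrel_def absolutely_convex_def by blast
  then show ?thesis by (simp cong: restrict_cong)
qed

lemma barrel_absorbing:
  assumes "barrel A B" "f \<in> C"
  shows "\<exists>r>0. \<forall>c. cmod c \<le> r \<longrightarrow> (\<lambda>x\<in>topspace X. c * f x) \<in> B"
  using assms unfolding barrel_def absorbing_def by simp

lemma barrel_complement:
  assumes "barrel A B" "f \<in> C" "f \<notin> B"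
  shows "\<exists>K\<in>\<F>. \<exists>e>0. uball K f e \<inter> B = {}"
proof -
  have "openin (topo A) (C - B)"
    using assms(1) unfolding barrel_def closedin_def topspace_function_algebra by blast
  then obtain K e where "K \<in> \<F>" "e > 0" "uball K f e \<subseteq> C - B"
    using assms(2,3) unfolding openin_function_algebra by blast
  then show ?thesis by blast
qed

section \<open>Sets on which every continuous function is bounded\<close>

lemma barrel_of_bounding_set:
  assumes S: "S \<subseteq> topspace X" and bdd: "\<And>f. f \<in> C \<Longrightarrow> \<exists>M. \<forall>x\<in>S. cmod (f x) \<le> M"
  shows "barrel A {f \<in> C. \<forall>x\<in>S. cmod (f x) \<le> 1}" (is "barrel A ?B")
  unfolding barrel_def
proof (intro conjI)
  have "openin (topo A) (C - ?B)"
    unfolding openin_function_algebra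
  proof (intro conjI ballI)
    fix f assume "f \<in> C - ?B"
    then obtain x where x: "x \<in> S" "cmod (f x) > 1" and f: "f \<in> C" by auto
    \<comment> \<open>A single point witnesses the violation, and \<open>{x}\<close> is a member;
      the radius is the amount by which the bound 1 is exceeded at \<open>x\<close>.\<close>
    have "uball {x} f (cmod (f x) - 1) \<subseteq> C - ?B"
    proof
      fix g assume g: "g \<in> uball {x} f (cmod (f x) - 1)"
      then have "cmod (g x) > 1" using norm_triangle_sub[of "f x" "g x"] by (simp add: norm_minus_commute)
      then show "g \<in> C - ?B" using g x(1) by (auto simp: not_le intro!: bexI[of _ x])
    qed
    then show "\<exists>K\<in>\<F>. \<exists>e>0. uball K f e \<subseteq> C - ?B"
      using x S by (intro bexI[of _ "{x}"] exI[of _ "cmod (f x) - 1"] conjI) (auto intro: singleton_member)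
  qed blast
  then show "closedin (topo A) ?B" by (auto simp: closedin_def topspace_function_algebra)
  show "absolutely_convex A ?B"
    unfolding absolutely_convex_def
  proof (intro ballI allI impI)
    fix f g and a b :: complex assume fg: "f \<in> ?B" "g \<in> ?B" and ab: "cmod a + cmod b \<le> 1"
    have "cmod (a * f x + b * g x) \<le> 1" if "x \<in> S" for x
    proof -
      have "cmod (a * f x + b * g x) \<le> cmod a * cmod (f x) + cmod b * cmod (g x)"
        by (metis norm_mult norm_triangle_ineq)
      also have "\<dots> \<le> cmod a * 1 + cmod b * 1"
        using fg that by (intro add_mono mult_left_mono) auto
      finally show ?thesis using ab by simp
    qed
    then show "a \<odot>\<^bsub>A\<^esub> f \<oplus>\<^bsub>A\<^esub> b \<odot>\<^bsub>A\<^esub> g \<in> ?B"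
      using fg S continuous_functions_closed(1)[OF continuous_functions_closed1(2)[of f X a] continuous_functions_closed1(2)[of g X b]]
      by (auto simp: subset_iff)
  qed
  show "absorbing A ?B"
    unfolding absorbing_def function_algebra_simps
  proof
    fix f assume f: "f \<in> C"
    obtain M where M: "\<forall>x\<in>S. cmod (f x) \<le> M" using bdd[OF f] by blast
    \<comment> \<open>The bound \<open>M\<close> may be 0, or even negative if \<open>S\<close> is
      empty, hence \<open>1 + \<bar>M\<bar>\<close>.\<close>
    define r where "r = 1 / (1 + \<bar>M\<bar>)"
    have r: "r > 0" by (simp add: r_def add_pos_nonneg)
    have "cmod (c * f x) \<le> 1" if "cmod c \<le> r" "x \<in> S" for c x
    proof -
      have "cmod (c * f x) \<le> r * (1 + \<bar>M\<bar>)"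
        unfolding norm_mult using that M r by (intro mult_mono) fastforce+
      moreover have "0 < 1 + \<bar>M\<bar>" by linarith
      ultimately show ?thesis by (simp add: r_def)
    qed
    then show "\<exists>r>0. \<forall>c. cmod c \<le> r \<longrightarrow> (\<lambda>x\<in>topspace X. c * f x) \<in> ?B"
      using r f S by (intro exI[of _ r]) (auto simp: continuous_functions_simps subset_iff)
  qed
qed

lemma barreled_imp_bounding_subset_member:
  assumes bar: "barreled A" and S: "S \<subseteq> topspace X"
    and bdd: "\<And>f. f \<in> C \<Longrightarrow> \<exists>M. \<forall>x\<in>S. cmod (f x) \<le> M"
  shows "\<exists>L\<in>\<F>. S \<subseteq> L"
proof -
  let ?B = "{f \<in> C. \<forall>x\<in>S. cmod (f x) \<le> 1}"
  obtain U where U: "openin (topo A) U" "\<zero>\<^bsub>A\<^esub> \<in> U" "U \<subseteq> ?B"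
    using bar barrel_of_bounding_set[OF S bdd] unfolding barreled_def by blast
  then obtain L e where L: "L \<in> \<F>" "0 < e" "uball L \<zero>\<^bsub>A\<^esub> e \<subseteq> ?B"
    unfolding openin_function_algebra by blast
  have "x \<in> L" if x: "x \<in> S" for x
  proof (rule ccontr)
    assume "x \<notin> L"
    then have "x \<in> topspace X - L" using x S by blast
    moreover have "closedin X L"
      by (rule compactin_imp_closedin[OF Hausdorff_X compact_member[OF L(1)]])
    ultimately obtain f :: "'x \<Rightarrow> real" where f: "continuous_map X (top_of_set {0..1}) f" "f x = 0" "f ` L \<subseteq> {1}"
      using tychonoff unfolding tychonoff_space_def completely_regular_space_def by (metis (no_types, lifting))
    have "continuous_map X euclideanreal f" using f(1) by (rule continuous_map_into_fulltopology)
    \<comment> \<open>This function vanishes on \<open>L\<close>, so it lies in every ball over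
      \<open>L\<close> around 0, but takes the value 2 at \<open>x\<close> and thus breaks the bound
      1.\<close>
    then have g: "(\<lambda>x\<in>topspace X. complex_of_real (2 * (1 - f x))) \<in> C"
      by (intro restrict_continuous_functions
          continuous_map_continuous_on_compose[of X f "\<lambda>y. complex_of_real (2 * (1 - y))"])
        (auto intro!: continuous_intros)
    have "(\<lambda>x\<in>topspace X. complex_of_real (2 * (1 - f x))) \<in> uball L \<zero>\<^bsub>A\<^esub> e"
      using g f(3) L(2) member_subset[OF L(1)] by (auto simp: subset_iff image_subset_iff)
    then have "(\<lambda>x\<in>topspace X. complex_of_real (2 * (1 - f x))) \<in> ?B" using L(3) by blast
    then have "cmod ((\<lambda>x\<in>topspace X. complex_of_real (2 * (1 - f x))) x) \<le> 1" using x by blast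
    then show False using f(2) x S by (auto simp: norm_mult)
  qed
  then show ?thesis using L(1) by blast
qed

text \<open>A compact set and a relatively pseudocompact set both bound every continuous function,
  so either lies in some member \<open>L\<close>. Passing to compact subsets of \<open>L\<close>
  gives fullness; as \<open>L\<close> is compact and closed, the closure of \<open>S\<close> is
  compact too.\<close>

lemma barreled_imp_full_and_relatively_compact:
  assumes bar: "barreled A"
  shows "full_family X \<F>"
    and "S \<subseteq> topspace X \<Longrightarrow> relatively_pseudocompact X S \<Longrightarrow> relatively_compact X S"
proof -
  have "K \<in> \<F>" if K: "compactin X K" for K
  proof -
    have "\<exists>M. \<forall>x\<in>K. cmod (f x) \<le> M" if "f \<in> C" for f
      using sup_seminorm_cases(1)[OF K continuous_functionsD(1)[OF that]] by blast
    then obtain L where "L \<in> \<F>" "K \<subseteq> L"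
      using barreled_imp_bounding_subset_member[OF bar compactin_subset_topspace[OF K]] by blast
    then show ?thesis using subset_member K by blast
  qed
  then show "full_family X \<F>" unfolding full_family_def using compact_member by blast
  assume S: "S \<subseteq> topspace X" "relatively_pseudocompact X S"
  have "\<exists>M. \<forall>x\<in>S. cmod (f x) \<le> M" if "f \<in> C" for f
  proof -
    have "bounded ((\<lambda>x. cmod (f x)) ` S)"
      using S(2) continuous_map_cmod[OF continuous_functionsD(1)[OF that]]
      unfolding relatively_pseudocompact_def by blast
    then show ?thesis unfolding bounded_iff by auto
  qed
  then obtain L where L: "L \<in> \<F>" "S \<subseteq> L"
    using barreled_imp_bounding_subset_member[OF bar S(1)] by blast
  have "closedin X L"
    by (rule compactin_imp_closedin[OF Hausdorff_X compact_member[OF L(1)]])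
  then have "X closure_of S \<subseteq> L" using L(2) by (simp add: closure_of_minimal)
  then show "relatively_compact X S"
    unfolding relatively_compact_def
    using closed_compactin[OF compact_member[OF L(1)] _ closedin_closure_of] by blast
qed

text \<open>A gliding hump replaces the appeal to the Baire category theorem: otherwise one could choose
  a set \<open>D\<close> of indices such that no multiple of \<open>B\<close> contains the sum of \<open>h n\<close> over \<open>D\<close>.\<close>

lemma barrel_gliding_hump:
  assumes B: "barrel A B"
    and h: "\<And>n. h n \<in> C"
    and summ: "\<And>K. K \<in> \<F> \<Longrightarrow> \<exists>b. summable b \<and> (\<forall>n. \<forall>x\<in>K. cmod (h n x) \<le> b n)"
  shows "\<exists>n. (\<lambda>x\<in>topspace X. 1 / of_nat (Suc n) * h n x) \<in> B"
proof (rule ccontr)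
  assume "\<nexists>n. (\<lambda>x\<in>topspace X. 1 / of_nat (Suc n) * h n x) \<in> B"
  then have notin: "(\<lambda>x\<in>topspace X. 1 / of_nat (Suc n) * h n x) \<notin> B" for n by blast
  \<comment> \<open>Masked terms: \<open>s D\<close> is the sum of the subseries with indices in
    \<open>D\<close>.\<close>
  define t where "t D n x = (if n \<in> D then h n x else 0)" for D :: "nat set" and n x
  define s where "s D = (\<lambda>x\<in>topspace X. \<Sum>n. t D n x)" for D
  have t_bound: "cmod (t D n x) \<le> b n" if "\<forall>n. \<forall>x\<in>K. cmod (h n x) \<le> b n" "x \<in> K" for D n x b K
  proof -
    have "cmod (h n x) \<le> b n" using that by blast
    then show ?thesis using norm_ge_zero[of "h n x"] by (simp add: t_def del: norm_ge_zero)
  qed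
  have t_summable: "summable (\<lambda>n. t D n x)" if x: "x \<in> topspace X" for D x
  proof -
    obtain b where b: "summable b" "\<forall>n. \<forall>x\<in>{x}. cmod (h n x) \<le> b n"
      using summ[OF singleton_member[OF x]] by blast
    show ?thesis
      by (rule summable_comparison_test'[OF b(1), of 0]) (use t_bound[OF b(2)] in simp)
  qed
  \<comment> \<open>The Weierstrass test works on one member at a time; continuity on
    \<open>X\<close> follows because the family determines it.\<close>
  have s_C: "s D \<in> C" for D
    unfolding s_def
  proof (rule restrict_continuous_functions, rule continuous_map_complex_distinguished)
    fix K assume K: "K \<in> \<F>"
    obtain b where b: "summable b" "\<forall>n. \<forall>x\<in>K. cmod (h n x) \<le> b n" using summ[OF K] by blast
    have lim: "uniform_limit K (\<lambda>N x. \<Sum>n<N. t D n x) (\<lambda>x. \<Sum>n. t D n x) sequentially"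
      by (rule Weierstrass_m_test[OF t_bound[OF b(2)] b(1)])
    have "continuous_map (subtopology X K) (Met_TC.mtopology :: complex topology) (\<lambda>x. \<Sum>n. t D n x)"
    proof (rule Met_TC.continuous_map_uniform_limit[where F = sequentially and f = "\<lambda>N x. \<Sum>n<N. t D n x"])
      have "continuous_map (subtopology X K) euclidean (t D n)" for n
        unfolding t_def using h[of n]
        by (cases "n \<in> D") (auto intro: continuous_map_from_subtopology continuous_functionsD)
      then show "\<forall>\<^sub>F N in sequentially. continuous_map (subtopology X K) Met_TC.mtopology (\<lambda>x. \<Sum>n<N. t D n x)"
        by (intro always_eventually allI) (simp add: mtopology_is_euclidean continuous_map_sum)
      fix e :: real assume "0 < e"
      then show "\<forall>\<^sub>F N in sequentially. \<forall>x\<in>topspace (subtopology X K).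
          (\<Sum>n. t D n x) \<in> UNIV \<and> dist (\<Sum>n<N. t D n x) (\<Sum>n. t D n x) < e"
        using uniform_limitD[OF lim \<open>0 < e\<close>] by (auto elim!: eventually_mono)
    qed simp
    then show "continuous_map (subtopology X K) euclidean (\<lambda>x. \<Sum>n. t D n x)"
      by (simp add: mtopology_is_euclidean)
  qed
  have s_Un: "s (D \<union> E) x = s D x + s E x" if "D \<inter> E = {}" "x \<in> topspace X" for D E x
  proof -
    have "t (D \<union> E) n x = t D n x + t E n x" for n using that(1) by (auto simp: t_def)
    then show ?thesis using that(2) suminf_add[OF t_summable t_summable] by (simp add: s_def)
  qed
  have s_single: "s {m} x = h m x" if "x \<in> topspace X" for m x
  proof -
    have "(\<lambda>n. t {m} n x) sums h m x"
      using sums_single[of m "\<lambda>n. h n x"] by (simp add: t_def)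
    then show ?thesis using that by (simp add: s_def sums_iff)
  qed
  \<comment> \<open>The bound is uniform in the index set \<open>E\<close>, so a tail may be chosen
    later without disturbing what has been achieved on \<open>K\<close>.\<close>
  have tail: "\<exists>M. \<forall>E\<subseteq>{M..}. \<forall>x\<in>K. cmod (s E x) < e" if K: "K \<in> \<F>" and e: "0 < e" for K and e :: real
  proof -
    obtain b where b: "summable b" "\<forall>n. \<forall>x\<in>K. cmod (h n x) \<le> b n" using summ[OF K] by blast
    obtain M where M: "\<forall>n\<ge>M. norm (\<Sum>i. b (i + n)) < e" using suminf_exist_split[OF e b(1)] by blast
    have "cmod (s E x) < e" if E: "E \<subseteq> {M..}" and x: "x \<in> K" for E x
    proof -
      have xX: "x \<in> topspace X" using x member_subset[OF K] by blast
      have "(\<Sum>n<M. t E n x) = 0" using E by (intro sum.neutral) (auto simp: t_def)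
      then have "s E x = (\<Sum>i. t E (i + M) x)"
        using suminf_split_initial_segment[OF t_summable[OF xX, of E], of M] xX by (simp add: s_def)
      moreover have "cmod (\<Sum>i. t E (i + M) x) \<le> (\<Sum>i. b (i + M))"
        using t_bound[OF b(2) x] b(1) by (intro norm_suminf_le) (auto simp: summable_iff_shift)
      ultimately show ?thesis using M[rule_format, of M] by simp
    qed
    then show ?thesis by blast
  qed
  \<comment> \<open>\<open>out k D\<close> expresses that \<open>s D\<close> escapes the dilate of
    \<open>B\<close> by the factor \<open>Suc k\<close>.\<close>
  define out where "out k D \<longleftrightarrow> (\<lambda>x\<in>topspace X. 1 / of_nat (Suc k) * s D x) \<notin> B" for k :: nat and D
  have hump: "\<exists>D' M'. D' \<subseteq> {..<M'} \<and> D' \<inter> {..<M} = D \<and> M \<le> M' \<and> (\<forall>E\<subseteq>{M'..}. out k (D' \<union> E))"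
    if D: "D \<subseteq> {..<M}" for D M k
  proof -
    \<comment> \<open>Above \<open>M\<close> the index \<open>m\<close> is new. If \<open>D\<close>
      and \<open>insert m D\<close> both failed to be out, the difference of their sums,
      \<open>h m\<close>, scaled by \<open>1 / Suc m\<close> would be a combination of elements of
      \<open>B\<close> with coefficients \<open>r\<close> and \<open>- r\<close>;
      \<open>m \<ge> 2 * Suc k\<close> makes their moduli add up to at most 1, and
      \<open>notin\<close> is contradicted.\<close>
    define m where "m = max M (2 * Suc k)"
    define c :: complex where "c = 1 / of_nat (Suc k)"
    have mD: "m \<notin> D" using D by (auto simp: m_def)
    have "out k D \<or> out k (insert m D)"
    proof (rule ccontr)
      assume "\<not> ?thesis"
      then have in1: "(\<lambda>x\<in>topspace X. c * s (insert m D) x) \<in> B" and in2: "(\<lambda>x\<in>topspace X. c * s D x) \<in> B"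
        by (auto simp: out_def c_def)
      define r :: complex where "r = of_nat (Suc k) / of_nat (Suc m)"
      have "2 * Suc k \<le> Suc m" by (simp add: m_def)
      then have "2 * real (Suc k) \<le> real (Suc m)" by (metis of_nat_le_iff of_nat_mult of_nat_numeral)
      then have r: "cmod r + cmod (- r) \<le> 1"
        by (simp add: r_def norm_divide divide_simps del: of_nat_Suc)
      have "(\<lambda>x\<in>topspace X. r * (\<lambda>x\<in>topspace X. c * s (insert m D) x) x + (- r) * (\<lambda>x\<in>topspace X. c * s D x) x) \<in> B"
        by (rule barrel_convex[OF B in1 in2 r])
      also have "(\<lambda>x\<in>topspace X. r * (\<lambda>x\<in>topspace X. c * s (insert m D) x) x + (- r) * (\<lambda>x\<in>topspace X. c * s D x) x)
          = (\<lambda>x\<in>topspace X. 1 / of_nat (Suc m) * h m x)"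
      proof (rule restrict_ext)
        fix x assume x: "x \<in> topspace X"
        have "s (insert m D) x = h m x + s D x" using s_Un[of "{m}" D x] s_single[OF x] mD x by simp
        then have "r * (c * s (insert m D) x) + (- r) * (c * s D x) = (r * c) * h m x"
          by (simp add: algebra_simps)
        moreover have "r * c = 1 / of_nat (Suc m)" by (simp add: r_def c_def del: of_nat_Suc)
        ultimately show "r * (\<lambda>x\<in>topspace X. c * s (insert m D) x) x + (- r) * (\<lambda>x\<in>topspace X. c * s D x) x
            = 1 / of_nat (Suc m) * h m x"
          using x by simp
      qed
      finally show False using notin by blast
    qed
    then obtain D' where D': "D' = D \<or> D' = insert m D" "out k D'" by blast
    \<comment> \<open>Since \<open>B\<close> is closed, being out survives perturbations smaller
      than \<open>e\<close> on some member \<open>K\<close>, in particular the addition of any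
      sufficiently late tail.\<close>
    have "(\<lambda>x\<in>topspace X. c * s D' x) \<in> C" by (rule continuous_functions_closed1(2)[OF s_C])
    then obtain K e where K: "K \<in> \<F>" "e > 0" "uball K (\<lambda>x\<in>topspace X. c * s D' x) e \<inter> B = {}"
      using barrel_complement[OF B] D'(2) unfolding out_def c_def by blast
    obtain N where N: "\<forall>E\<subseteq>{N..}. \<forall>x\<in>K. cmod (s E x) < e" using tail[OF K(1,2)] by blast
    define M' where "M' = max N (Suc m)"
    have "out k (D' \<union> E)" if E: "E \<subseteq> {M'..}" for E
    proof -
      have "D' \<inter> E = {}" using D D' E by (force simp: M'_def m_def)
      have "E \<subseteq> {N..}" using E by (auto simp: M'_def)
      have "cmod c \<le> 1" by (simp add: c_def norm_divide divide_simps del: of_nat_Suc)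
      have "(\<lambda>x\<in>topspace X. c * s (D' \<union> E) x) \<in> uball K (\<lambda>x\<in>topspace X. c * s D' x) e"
      proof (intro CollectI conjI ballI)
        show "(\<lambda>x\<in>topspace X. c * s (D' \<union> E) x) \<in> C" by (rule continuous_functions_closed1(2)[OF s_C])
        fix x assume x: "x \<in> K"
        then have xX: "x \<in> topspace X" using member_subset[OF K(1)] by blast
        have "cmod (c * s E x) \<le> 1 * cmod (s E x)"
          unfolding norm_mult using \<open>cmod c \<le> 1\<close> by (intro mult_right_mono) auto
        also have "\<dots> < e" using N \<open>E \<subseteq> {N..}\<close> x by simp
        finally show "cmod ((\<lambda>x\<in>topspace X. c * s (D' \<union> E) x) x - (\<lambda>x\<in>topspace X. c * s D' x) x) < e"
          using s_Un[OF \<open>D' \<inter> E = {}\<close> xX] xX by (simp add: algebra_simps)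
      qed
      then show ?thesis using K(3) unfolding out_def c_def by blast
    qed
    moreover have "D' \<subseteq> {..<M'}" "D' \<inter> {..<M} = D" "M \<le> M'" using D D' by (auto simp: M'_def m_def)
    ultimately show ?thesis by blast
  qed
  \<comment> \<open>Each \<open>z k\<close> pairs the indices chosen so far with the bound below
    which nothing changes any more. The choice made at stage \<open>k\<close> already guarantees
    escape at level \<open>k\<close> for every later completion.\<close>
  have "\<exists>z. \<forall>k. (fst (z k) \<subseteq> {..<snd (z k)} \<and> (\<forall>E\<subseteq>{snd (z k)..}. out k (fst (z k) \<union> E))) \<and>
      (fst (z (Suc k)) \<inter> {..<snd (z k)} = fst (z k) \<and> snd (z k) \<le> snd (z (Suc k)))"
      (is "\<exists>z. \<forall>k. ?P z k")
  proof (rule dependent_nat_choice)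
    show "\<exists>z. fst z \<subseteq> {..<snd z} \<and> (\<forall>E\<subseteq>{snd z..}. out 0 (fst z \<union> E))"
      using hump[of "{}" 0 0] by auto
    fix z k assume "fst z \<subseteq> {..<snd z} \<and> (\<forall>E\<subseteq>{snd z..}. out k (fst z \<union> E))"
    then show "\<exists>y. (fst y \<subseteq> {..<snd y} \<and> (\<forall>E\<subseteq>{snd y..}. out (Suc k) (fst y \<union> E))) \<and>
        fst y \<inter> {..<snd z} = fst z \<and> snd z \<le> snd y"
      using hump[of "fst z" "snd z" "Suc k"] by auto
  qed
  then obtain z where z0: "\<forall>k. ?P z k" by (rule exE)
  note zk = z0[THEN spec]
  note z = zk[THEN conjunct1, THEN conjunct2] zk[THEN conjunct2, THEN conjunct1]
    zk[THEN conjunct2, THEN conjunct2] zk[THEN conjunct1, THEN conjunct1]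
  define D where "D = (\<Union>k. fst (z k))"
  have D: "D = fst (z k) \<union> (D \<inter> {snd (z k)..})" for k
    unfolding D_def by (rule Union_initial_segments) (rule z)+
  \<comment> \<open>The single function \<open>s D\<close> thus escapes all dilates of
    \<open>B\<close>, although \<open>B\<close> is absorbing.\<close>
  have "out k D" for k using z(1)[of k] D[of k] by (metis Int_lower2)
  obtain r where r: "r > 0" "\<forall>c. cmod c \<le> r \<longrightarrow> (\<lambda>x\<in>topspace X. c * s D x) \<in> B"
    using barrel_absorbing[OF B s_C[of D]] by blast
  obtain k where "inverse (real (Suc k)) < r" using reals_Archimedean[OF r(1)] by blast
  then have "cmod (1 / of_nat (Suc k)) \<le> r" by (simp add: norm_divide inverse_eq_divide del: of_nat_Suc)
  then have "(\<lambda>x\<in>topspace X. 1 / of_nat (Suc k) * s D x) \<in> B" using r(2) by blast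
  then show False using \<open>out k D\<close> unfolding out_def by blast
qed

text \<open>Analogue of the fact that a barrel in the Banach space of bounded continuous functions
  is a neighbourhood of 0, with the gliding hump in the place of Baire's theorem.\<close>

lemma barrel_contains_sup_ball:
  assumes B: "barrel A B"
  shows "\<exists>\<delta>>0. \<forall>f\<in>C. (\<forall>x\<in>topspace X. cmod (f x) \<le> \<delta>) \<longrightarrow> f \<in> B"
proof (rule ccontr)
  assume contra: "\<not> ?thesis"
  \<comment> \<open>The divisor \<open>real (Suc n)\<close> is paid back when the hump is taken to
    be \<open>Suc n\<close> times \<open>f n\<close>: a geometric majorant remains, and the factor
    \<open>1 / Suc n\<close> of the gliding hump lemma returns \<open>f n\<close> itself.\<close>
  have "\<exists>f. f \<in> C \<and> (\<forall>x\<in>topspace X. cmod (f x) \<le> (1/2)^n / real (Suc n)) \<and> f \<notin> B" for n :: nat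
  proof -
    have "(1/2)^n / real (Suc n) > 0" by simp
    then show ?thesis using contra by blast
  qed
  then obtain f where f: "\<And>n. f n \<in> C" "\<And>n x. x \<in> topspace X \<Longrightarrow> cmod (f n x) \<le> (1/2)^n / real (Suc n)"
    "\<And>n. f n \<notin> B"
    by metis
  let ?h = "\<lambda>n. \<lambda>x\<in>topspace X. of_nat (Suc n) * f n x"
  have "\<exists>n. (\<lambda>x\<in>topspace X. 1 / of_nat (Suc n) * ?h n x) \<in> B"
  proof (rule barrel_gliding_hump[OF B])
    show "?h n \<in> C" for n by (rule continuous_functions_closed1(2)[OF f(1)])
    fix K assume K: "K \<in> \<F>"
    have "cmod (?h n x) \<le> (1/2)^n" if "x \<in> K" for n x
    proof -
      have x: "x \<in> topspace X" using member_subset[OF K] that by blast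
      then have "cmod (?h n x) = real (Suc n) * cmod (f n x)" by (simp add: norm_mult del: of_nat_Suc)
      also have "\<dots> \<le> real (Suc n) * ((1/2)^n / real (Suc n))" using f(2)[OF x] by (rule mult_left_mono) simp
      finally show ?thesis by simp
    qed
    then show "\<exists>b. summable b \<and> (\<forall>n. \<forall>x\<in>K. cmod (?h n x) \<le> b n)"
      by (intro exI[of _ "\<lambda>n. (1/2)^n"]) (auto intro: summable_geometric)
  qed
  then obtain n where "(\<lambda>x\<in>topspace X. 1 / of_nat (Suc n) * ?h n x) \<in> B" by blast
  moreover have "(\<lambda>x\<in>topspace X. 1 / of_nat (Suc n) * ?h n x) = (\<lambda>x\<in>topspace X. f n x)"
    by (rule restrict_ext) (simp del: of_nat_Suc)
  moreover have "(\<lambda>x\<in>topspace X. f n x) = f n"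
    using f(1) by (rule restrict_topspace_continuous_functions)
  ultimately show False using f(3) by simp
qed

text \<open>The largest ideal contained in \<open>B\<close>; its common zeros play the role of the union of the
  supports of the functionals in the polar of \<open>B\<close>.\<close>

definition barrel_ideal :: "('x \<Rightarrow> complex) set \<Rightarrow> ('x \<Rightarrow> complex) set" where
  "barrel_ideal B = {\<phi> \<in> C. \<forall>f\<in>C. (\<lambda>x\<in>topspace X. f x * \<phi> x) \<in> B}"

definition barrel_support :: "('x \<Rightarrow> complex) set \<Rightarrow> 'x set" where
  "barrel_support B = {x \<in> topspace X. \<forall>\<phi>\<in>barrel_ideal B. \<phi> x = 0}"

lemma closedin_barrel_support: "closedin X (barrel_support B)"
proof -
  have "closedin X {x \<in> topspace X. \<phi> x \<in> {0}}" if "\<phi> \<in> barrel_ideal B" for \<phi>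
    using that by (intro closedin_continuous_map_preimage[of X euclidean])
      (auto simp: barrel_ideal_def dest: continuous_functionsD)
  then have "closedin X (topspace X \<inter> \<Inter>((\<lambda>\<phi>. {x \<in> topspace X. \<phi> x \<in> {0}}) ` barrel_ideal B))"
    by (cases "barrel_ideal B = {}") (auto intro!: closedin_Int closedin_Inter)
  also have "topspace X \<inter> \<Inter>((\<lambda>\<phi>. {x \<in> topspace X. \<phi> x \<in> {0}}) ` barrel_ideal B) = barrel_support B"
    by (auto simp: barrel_support_def)
  finally show ?thesis .
qed

text \<open>If \<open>g\<close> were unbounded on the support, bumps along ever higher level sets of
  \<open>\<bar>g\<bar>\<close> would form a series with finitely many nonzero terms on each member,
  while each bump, being nonzero at a point of the support, has a multiple outside \<open>B\<close>.
  The gliding hump excludes this.\<close>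

lemma barrel_support_relatively_pseudocompact:
  assumes B: "barrel A B"
  shows "relatively_pseudocompact X (barrel_support B)"
  unfolding relatively_pseudocompact_def
proof (intro allI impI, rule ccontr)
  fix g :: "'x \<Rightarrow> real"
  assume g: "continuous_map X euclideanreal g" and unb: "\<not> bounded (g ` barrel_support B)"
  have "\<exists>x\<in>barrel_support B. \<bar>g x\<bar> > real n" for n
    using unb unfolding bounded_iff by (auto simp: not_le)
  then obtain a where a: "\<And>n. a n \<in> barrel_support B" "\<And>n. \<bar>g (a n)\<bar> > real n" by metis
  \<comment> \<open>A tent in the variable \<open>\<bar>g x\<bar>\<close>, with value 1 at
    \<open>a n\<close> and vanishing where \<open>\<bar>g x\<bar>\<close> differs from
    \<open>\<bar>g (a n)\<bar>\<close> by at least 1.\<close>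
  define \<phi> where "\<phi> n = (\<lambda>x\<in>topspace X. complex_of_real (max 0 (1 - \<bar>\<bar>g x\<bar> - \<bar>g (a n)\<bar>\<bar>)))" for n
  have \<phi>: "\<phi> n \<in> C" for n
    unfolding \<phi>_def
    by (intro restrict_continuous_functions continuous_map_continuous_on_compose[OF g,
          of "\<lambda>y. complex_of_real (max 0 (1 - \<bar>\<bar>y\<bar> - \<bar>g (a n)\<bar>\<bar>))"]) (auto intro!: continuous_intros)
  have aX: "a n \<in> topspace X" for n using a(1) by (simp add: barrel_support_def)
  have "\<phi> n \<notin> barrel_ideal B" for n
  proof
    assume "\<phi> n \<in> barrel_ideal B"
    then have "\<phi> n (a n) = 0" using a(1)[of n] by (simp add: barrel_support_def)
    then show False using aX by (simp add: \<phi>_def)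
  qed
  then have "\<exists>f. f \<in> C \<and> (\<lambda>x\<in>topspace X. f x * \<phi> n x) \<notin> B" for n
    using \<phi> unfolding barrel_ideal_def by blast
  then obtain f where f: "\<And>n. f n \<in> C" "\<And>n. (\<lambda>x\<in>topspace X. f n x * \<phi> n x) \<notin> B" by metis
  let ?h = "\<lambda>n. \<lambda>x\<in>topspace X. of_nat (Suc n) * (\<lambda>x\<in>topspace X. f n x * \<phi> n x) x"
  have h: "?h n \<in> C" for n
    by (rule continuous_functions_closed1(2)[OF continuous_functions_closed(3)[OF f(1) \<phi>]])
  have "\<exists>n. (\<lambda>x\<in>topspace X. 1 / of_nat (Suc n) * ?h n x) \<in> B"
  proof (rule barrel_gliding_hump[OF B h])
    fix K assume K: "K \<in> \<F>"
    have "(\<lambda>x\<in>topspace X. complex_of_real (g x)) \<in> C"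
      by (intro restrict_continuous_functions continuous_map_continuous_on_compose[OF g]) (auto intro!: continuous_intros)
    then obtain R where R: "\<And>x. x \<in> K \<Longrightarrow> cmod ((\<lambda>x\<in>topspace X. complex_of_real (g x)) x) \<le> R"
      using bounded_on_member[OF K] by blast
    have gR: "\<bar>g x\<bar> \<le> R" if "x \<in> K" for x
      using R[OF that] member_subset[OF K] that by auto
    have "\<exists>M. \<forall>x\<in>K. cmod (?h n x) \<le> M" for n
      by (rule bounded_on_member[OF K h[of n]]) (rule exI, rule ballI)
    then obtain M where M: "\<And>n x. x \<in> K \<Longrightarrow> cmod (?h n x) \<le> M n" by metis
    \<comment> \<open>On \<open>K\<close> the modulus of \<open>g\<close> is at most
      \<open>R\<close>, whereas \<open>\<bar>g (a n)\<bar> > n\<close>; for \<open>n > R + 1\<close>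
      the two are more than 1 apart and the tent is 0 on \<open>K\<close>.\<close>
    let ?b = "\<lambda>n. if real n \<le> R + 1 then M n else 0"
    have "n \<le> nat \<lceil>R + 1\<rceil>" if "real n \<le> R + 1" for n
      using that by linarith
    then have "{n. real n \<le> R + 1} \<subseteq> {..nat \<lceil>R + 1\<rceil>}" by auto
    then have "finite {n. real n \<le> R + 1}" by (rule finite_subset) simp
    then have "summable ?b" by (intro summable_finite[of "{n. real n \<le> R + 1}"]) auto
    moreover have "cmod (?h n x) \<le> ?b n" if x: "x \<in> K" for n x
    proof (cases "real n \<le> R + 1")
      case False
      then have "1 - \<bar>\<bar>g x\<bar> - \<bar>g (a n)\<bar>\<bar> \<le> 0" using gR[OF x] a(2)[of n] by linarith
      then have "\<phi> n x = 0" using x member_subset[OF K] by (auto simp: \<phi>_def max_def)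
      then show ?thesis using False x member_subset[OF K] by auto
    qed (use M[OF x] in simp)
    ultimately show "\<exists>b. summable b \<and> (\<forall>n. \<forall>x\<in>K. cmod (?h n x) \<le> b n)" by blast
  qed
  then obtain n where "(\<lambda>x\<in>topspace X. 1 / of_nat (Suc n) * ?h n x) \<in> B" by blast
  moreover have "(\<lambda>x\<in>topspace X. 1 / of_nat (Suc n) * ?h n x) = (\<lambda>x\<in>topspace X. f n x * \<phi> n x)"
    by (rule restrict_ext) (simp del: of_nat_Suc)
  ultimately show False using f(2) by simp
qed

text \<open>The witness is the sum of the squared moduli of the elements of \<open>\<Phi>\<close>.
  Each square is a multiple of its function by the conjugate, hence in the ideal, and nonnegative
  summands cannot cancel.\<close>

lemma barrel_ideal_nonneg_combination:
  assumes B: "barrel A B" and "finite \<Phi>" "\<Phi> \<subseteq> barrel_ideal B"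
  shows "\<exists>\<psi>\<in>barrel_ideal B. \<forall>x\<in>topspace X. \<psi> x = complex_of_real (Re (\<psi> x)) \<and> 0 \<le> Re (\<psi> x) \<and>
    (\<forall>\<phi>\<in>\<Phi>. \<phi> x \<noteq> 0 \<longrightarrow> 0 < Re (\<psi> x))"
  using assms(2,3)
proof (induction \<Phi> rule: finite_induct)
  case empty
  have "(\<lambda>x\<in>topspace X. 0) \<in> B"
  proof -
    obtain r where r: "r > 0" "\<forall>c. cmod c \<le> r \<longrightarrow> (\<lambda>x\<in>topspace X. c * (\<lambda>x\<in>topspace X. 0) x) \<in> B"
      using barrel_absorbing[OF B const_continuous_functions[of 0 X]] by blast
    then have "(\<lambda>x\<in>topspace X. 0 * (\<lambda>x\<in>topspace X. 0 :: complex) x) \<in> B" by (metis norm_zero less_imp_le)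
    then show ?thesis by simp
  qed
  then have "(\<lambda>x\<in>topspace X. 0) \<in> barrel_ideal B"
    by (auto simp: barrel_ideal_def const_continuous_functions cong: restrict_cong)
  then show ?case by (intro bexI[of _ "\<lambda>x\<in>topspace X. 0"]) auto
next
  case (insert \<phi> \<Phi>)
  then obtain \<psi> where \<psi>: "\<psi> \<in> barrel_ideal B" "\<And>x. x \<in> topspace X \<Longrightarrow> \<psi> x = complex_of_real (Re (\<psi> x))"
    "\<And>x. x \<in> topspace X \<Longrightarrow> 0 \<le> Re (\<psi> x)"
    "\<And>x \<phi>. x \<in> topspace X \<Longrightarrow> \<phi> \<in> \<Phi> \<Longrightarrow> \<phi> x \<noteq> 0 \<Longrightarrow> 0 < Re (\<psi> x)" by auto
  have \<phi>: "\<phi> \<in> C" "\<And>f. f \<in> C \<Longrightarrow> (\<lambda>x\<in>topspace X. f x * \<phi> x) \<in> B" and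
    \<psi>C: "\<psi> \<in> C" "\<And>f. f \<in> C \<Longrightarrow> (\<lambda>x\<in>topspace X. f x * \<psi> x) \<in> B"
    using insert.prems \<psi>(1) by (auto simp: barrel_ideal_def)
  define \<psi>' where "\<psi>' = (\<lambda>x\<in>topspace X. \<psi> x + complex_of_real ((cmod (\<phi> x))\<^sup>2))"
  have \<phi>c: "(\<lambda>x\<in>topspace X. complex_of_real ((cmod (\<phi> x))\<^sup>2)) \<in> C"
    by (intro restrict_continuous_functions continuous_map_continuous_on_compose[OF continuous_functionsD(1)[OF \<phi>(1)],
          of "\<lambda>z. complex_of_real ((cmod z)\<^sup>2)"]) (auto intro!: continuous_intros)
  have "\<psi>' = (\<lambda>x\<in>topspace X. \<psi> x + (\<lambda>x\<in>topspace X. complex_of_real ((cmod (\<phi> x))\<^sup>2)) x)"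
    unfolding \<psi>'_def by (rule restrict_ext) simp
  then have \<psi>': "\<psi>' \<in> C" using continuous_functions_closed(1)[OF \<psi>C(1) \<phi>c] by simp
  have "\<psi>' \<in> barrel_ideal B"
    unfolding barrel_ideal_def
  proof (intro CollectI conjI \<psi>' ballI)
    fix f assume f: "f \<in> C"
    \<comment> \<open>Absolute convexity only allows weights 1/2 and 1/2 for a sum; doubling the
      multiplier compensates, because the ideal admits every multiplier.\<close>
    have f2: "(\<lambda>x\<in>topspace X. 2 * f x) \<in> C" by (rule continuous_functions_closed1(2)[OF f])
    have f3: "(\<lambda>x\<in>topspace X. (\<lambda>x\<in>topspace X. 2 * f x) x * (\<lambda>x\<in>topspace X. cnj (\<phi> x)) x) \<in> C"
      by (rule continuous_functions_closed(3)[OF f2 continuous_functions_closed1(3)[OF \<phi>(1)]])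
    have "(\<lambda>x\<in>topspace X. 1/2 * (\<lambda>x\<in>topspace X. (\<lambda>x\<in>topspace X. 2 * f x) x * \<psi> x) x +
        1/2 * (\<lambda>x\<in>topspace X. (\<lambda>x\<in>topspace X. (\<lambda>x\<in>topspace X. 2 * f x) x * (\<lambda>x\<in>topspace X. cnj (\<phi> x)) x) x * \<phi> x) x) \<in> B"
      by (rule barrel_convex[OF B \<psi>C(2)[OF f2] \<phi>(2)[OF f3]]) simp
    also have "(\<lambda>x\<in>topspace X. 1/2 * (\<lambda>x\<in>topspace X. (\<lambda>x\<in>topspace X. 2 * f x) x * \<psi> x) x +
        1/2 * (\<lambda>x\<in>topspace X. (\<lambda>x\<in>topspace X. (\<lambda>x\<in>topspace X. 2 * f x) x * (\<lambda>x\<in>topspace X. cnj (\<phi> x)) x) x * \<phi> x) x)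
        = (\<lambda>x\<in>topspace X. f x * \<psi>' x)"
      by (rule restrict_ext) (simp add: \<psi>'_def complex_norm_square[symmetric] algebra_simps
          flip: complex_norm_square)
    finally show "(\<lambda>x\<in>topspace X. f x * \<psi>' x) \<in> B" .
  qed
  moreover have "\<psi>' x = complex_of_real (Re (\<psi>' x)) \<and> 0 \<le> Re (\<psi>' x) \<and>
      (\<forall>\<phi>\<in>insert \<phi> \<Phi>. \<phi> x \<noteq> 0 \<longrightarrow> 0 < Re (\<psi>' x))" if x: "x \<in> topspace X" for x
  proof -
    have "\<psi>' x = complex_of_real (Re (\<psi> x) + (cmod (\<phi> x))\<^sup>2)"
      using x \<psi>(2)[OF x] by (simp add: \<psi>'_def)
    then show ?thesis
      using \<psi>(3)[OF x] \<psi>(4)[OF x] by (auto intro: add_pos_nonneg add_nonneg_pos)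
  qed
  ultimately show ?case by blast
qed

text \<open>As \<open>B\<close> is closed, it is enough to approximate \<open>f\<close> within
  \<open>e\<close> on a given member \<open>L\<close> by elements of \<open>B\<close>. On the
  compact part of \<open>L\<close> where \<open>f\<close> is not small the ideal has no common zero,
  so finitely many of its elements combine to a \<open>\<psi>\<close> bounded away from 0 there, and
  \<open>f\<close> times a suitable multiple of \<open>\<psi>\<close> is the approximant.\<close>

lemma vanishing_on_barrel_support:
  assumes B: "barrel A B" and f: "f \<in> C" and zero: "\<And>x. x \<in> barrel_support B \<Longrightarrow> f x = 0"
  shows "f \<in> B"
proof (rule ccontr)
  assume "f \<notin> B"
  then obtain L e where L: "L \<in> \<F>" "e > 0" "uball L f e \<inter> B = {}"
    using barrel_complement[OF B f] by blast
  have contf: "continuous_map X euclidean f" using f by (rule continuous_functionsD)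
  \<comment> \<open>Off \<open>L'\<close> the function is already smaller than \<open>e\<close>, so
    shrinking its values there is harmless.\<close>
  define L' where "L' = L \<inter> {x \<in> topspace X. cmod (f x) \<in> {e..}}"
  have "closedin X {x \<in> topspace X. cmod (f x) \<in> {e..}}"
    by (rule closedin_continuous_map_preimage[OF continuous_map_cmod[OF contf]]) simp
  then have L': "compactin X L'"
    unfolding L'_def using compact_Int_closedin compact_member[OF L(1)] by blast
  define V where "V \<phi> = {x \<in> topspace X. \<phi> x \<in> - {0 :: complex}}" for \<phi>
  have openV: "openin X (V \<phi>)" if "\<phi> \<in> barrel_ideal B" for \<phi>
    unfolding V_def using that
    by (intro openin_continuous_map_preimage[of X euclidean]) (auto simp: barrel_ideal_def dest: continuous_functionsD)
  have "L' \<subseteq> \<Union>(V ` barrel_ideal B)"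
  proof
    fix x assume x: "x \<in> L'"
    then have "x \<in> topspace X" "f x \<noteq> 0" using L(2) by (auto simp: L'_def)
    then show "x \<in> \<Union>(V ` barrel_ideal B)" using zero[of x] by (auto simp: barrel_support_def V_def)
  qed
  then have "\<exists>\<V>. finite \<V> \<and> \<V> \<subseteq> V ` barrel_ideal B \<and> L' \<subseteq> \<Union>\<V>"
    using L' openV unfolding compactin_def by (metis (no_types, lifting) imageE)
  then obtain \<Phi> where \<Phi>: "finite \<Phi>" "\<Phi> \<subseteq> barrel_ideal B" "L' \<subseteq> \<Union>(V ` \<Phi>)"
    by (metis finite_subset_image)
  obtain \<psi> where \<psi>: "\<psi> \<in> barrel_ideal B" "\<And>x. x \<in> topspace X \<Longrightarrow> \<psi> x = complex_of_real (Re (\<psi> x))"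
    "\<And>x. x \<in> topspace X \<Longrightarrow> 0 \<le> Re (\<psi> x)"
    "\<And>x \<phi>. x \<in> topspace X \<Longrightarrow> \<phi> \<in> \<Phi> \<Longrightarrow> \<phi> x \<noteq> 0 \<Longrightarrow> 0 < Re (\<psi> x)"
    using barrel_ideal_nonneg_combination[OF B \<Phi>(1,2)] by auto
  have \<psi>C: "\<psi> \<in> C" "\<And>f. f \<in> C \<Longrightarrow> (\<lambda>x\<in>topspace X. f x * \<psi> x) \<in> B"
    using \<psi>(1) by (auto simp: barrel_ideal_def)
  have cont\<psi>: "continuous_map X euclidean \<psi>" using \<psi>C(1) by (rule continuous_functionsD)
  have "\<exists>c>0. \<forall>x\<in>L'. c \<le> Re (\<psi> x)"
  proof (cases "L' = {}")
    case False
    have "compact ((\<lambda>x. Re (\<psi> x)) ` L')"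
      using image_compactin[OF L', of euclideanreal "\<lambda>x. Re (\<psi> x)"] cont\<psi>
      unfolding continuous_map_complex_iff[of X \<psi>] by (simp add: compactin_euclidean_iff)
    then obtain x where x: "x \<in> L'" "\<forall>y\<in>L'. Re (\<psi> x) \<le> Re (\<psi> y)"
      using compact_attains_inf[of "(\<lambda>x. Re (\<psi> x)) ` L'"] False by auto
    then have "0 < Re (\<psi> x)" using \<Phi>(3) \<psi>(4)[of x] by (auto simp: V_def)
    then show ?thesis using x by blast
  qed (auto intro: exI[of _ 1])
  then obtain c where c: "c > 0" "\<And>x. x \<in> L' \<Longrightarrow> c \<le> Re (\<psi> x)" by blast
  \<comment> \<open>Truncation at \<open>c\<close> keeps the inverse continuous. The product of
    \<open>u\<close> and \<open>\<psi>\<close> has values between 0 and 1, and equals 1 on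
    \<open>L'\<close>.\<close>
  define u where "u = (\<lambda>x\<in>topspace X. complex_of_real (inverse (max c (Re (\<psi> x)))))"
  have "continuous_on UNIV (\<lambda>z. complex_of_real (inverse (max c (Re z))))"
    using c(1) by (intro continuous_intros) (auto simp: max_def)
  then have u: "u \<in> C"
    unfolding u_def by (intro restrict_continuous_functions
        continuous_map_continuous_on_compose[OF cont\<psi>, of "\<lambda>z. complex_of_real (inverse (max c (Re z)))"])
  define g where "g = (\<lambda>x\<in>topspace X. (\<lambda>x\<in>topspace X. f x * u x) x * \<psi> x)"
  have g: "g \<in> B" unfolding g_def by (rule \<psi>C(2)[OF continuous_functions_closed(3)[OF f u]])
  have "cmod (g x - f x) < e" if x: "x \<in> L" for x
  proof -
    have xX: "x \<in> topspace X" using x member_subset[OF L(1)] by blast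
    define w where "w = inverse (max c (Re (\<psi> x))) * Re (\<psi> x)"
    have w: "0 \<le> w" "w \<le> 1" using \<psi>(3)[OF xX] c(1) by (auto simp: w_def divide_simps max_def)
    have "g x = f x * complex_of_real w"
      using xX \<psi>(2)[OF xX] by (simp add: g_def u_def w_def)
    then have "g x - f x = complex_of_real (w - 1) * f x" by (simp add: algebra_simps)
    then have eq: "cmod (g x - f x) = (1 - w) * cmod (f x)" using w by (simp add: norm_mult del: of_real_diff)
    show ?thesis
    proof (cases "x \<in> L'")
      case True
      then have "w = 1" using c(2)[OF True] c(1) by (simp add: w_def max_def)
      then show ?thesis using eq L(2) by simp
    next
      case False
      then have "cmod (f x) < e" using x xX by (auto simp: L'_def)
      moreover have "(1 - w) * cmod (f x) \<le> 1 * cmod (f x)" using w by (intro mult_right_mono) auto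
      ultimately show ?thesis using eq by simp
    qed
  qed
  then have "g \<in> uball L f e" using barrel_subset[OF B] g by blast
  then show False using L(3) g by blast
qed

text \<open>The hypotheses combine to make the support of \<open>B\<close> a member: it is closed
  and relatively pseudocompact, hence compact, and fullness turns compact sets into members.
  Functions small on it then form a neighbourhood of 0.\<close>

lemma full_and_relatively_compact_imp_barreled:
  assumes full: "full_family X \<F>"
    and rel: "\<And>S. S \<subseteq> topspace X \<Longrightarrow> relatively_pseudocompact X S \<Longrightarrow> relatively_compact X S"
  shows "barreled A"
  unfolding barreled_def
proof (intro allI impI)
  fix B assume B: "barrel A B"
  obtain \<delta> where \<delta>: "\<delta> > 0" "\<And>f. f \<in> C \<Longrightarrow> (\<forall>x\<in>topspace X. cmod (f x) \<le> \<delta>) \<Longrightarrow> f \<in> B"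
    using barrel_contains_sup_ball[OF B] by blast
  let ?K = "barrel_support B"
  have "relatively_compact X ?K"
    by (rule rel[OF closedin_subset[OF closedin_barrel_support] barrel_support_relatively_pseudocompact[OF B]])
  then have "compactin X ?K"
    unfolding relatively_compact_def using closure_of_closedin[OF closedin_barrel_support] by simp
  then have K: "?K \<in> \<F>" using full by (simp add: full_family_def)
  have "f \<in> B" if "f \<in> uball ?K \<zero>\<^bsub>A\<^esub> (\<delta>/2)" for f
  proof -
    have f: "f \<in> C" "\<And>x. x \<in> ?K \<Longrightarrow> cmod (f x) < \<delta>/2"
      using that closedin_subset[OF closedin_barrel_support[of B]] by (auto simp: subset_iff)
    \<comment> \<open>\<open>f1\<close> is \<open>2 * f\<close> with its modulus cut off at
      \<open>\<delta>\<close>. Where \<open>cmod (f x) \<le> \<delta>/2\<close> nothing is cut, so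
      the remainder \<open>f2\<close> vanishes on the support. The factor 2 pays for the weights 1/2
      that recombine \<open>f1\<close> and \<open>f2\<close> to \<open>f\<close>, and explains the
      radius \<open>\<delta>/2\<close>.\<close>
    define u where "u = (\<lambda>x\<in>topspace X. complex_of_real (\<delta> / max (\<delta>/2) (cmod (f x))))"
    have "continuous_on UNIV (\<lambda>z. complex_of_real (\<delta> / max (\<delta>/2) (cmod z)))"
      using \<delta>(1) by (intro continuous_intros) (auto simp: max_def)
    then have u: "u \<in> C"
      unfolding u_def by (intro restrict_continuous_functions
        continuous_map_continuous_on_compose[OF continuous_functionsD(1)[OF f(1)],
          of "\<lambda>z. complex_of_real (\<delta> / max (\<delta>/2) (cmod z))"])
    define f1 where "f1 = (\<lambda>x\<in>topspace X. f x * u x)"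
    define f2 where "f2 = (\<lambda>x\<in>topspace X. (\<lambda>x\<in>topspace X. 2 * f x) x - f1 x)"
    have f1: "f1 \<in> C" unfolding f1_def by (rule continuous_functions_closed(3)[OF f(1) u])
    have f2: "f2 \<in> C" unfolding f2_def
      by (rule continuous_functions_closed(2)[OF continuous_functions_closed1(2)[OF f(1)] f1])
    have "cmod (f1 x) \<le> \<delta>" if "x \<in> topspace X" for x
    proof -
      have m: "0 < max (\<delta>/2) (cmod (f x))" using \<delta>(1) by simp
      have "cmod (f1 x) = cmod (f x) * (\<delta> / max (\<delta>/2) (cmod (f x)))"
        using that \<delta>(1) m by (simp add: f1_def u_def norm_mult norm_divide del: of_real_divide)
      also have "\<dots> \<le> max (\<delta>/2) (cmod (f x)) * (\<delta> / max (\<delta>/2) (cmod (f x)))"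
        using \<delta>(1) m by (intro mult_right_mono) auto
      finally show ?thesis using m by simp
    qed
    then have B1: "f1 \<in> B" using \<delta>(2)[OF f1] by blast
    have "f2 x = 0" if x: "x \<in> ?K" for x
    proof -
      have "x \<in> topspace X" using x by (simp add: barrel_support_def)
      moreover have "max (\<delta>/2) (cmod (f x)) = \<delta>/2" using f(2)[OF x] by simp
      ultimately show ?thesis using \<delta>(1) by (simp add: f2_def f1_def u_def)
    qed
    then have B2: "f2 \<in> B" by (rule vanishing_on_barrel_support[OF B f2])
    have "(\<lambda>x\<in>topspace X. 1/2 * f1 x + 1/2 * f2 x) \<in> B" by (rule barrel_convex[OF B B1 B2]) simp
    also have "(\<lambda>x\<in>topspace X. 1/2 * f1 x + 1/2 * f2 x) = f"
      using f(1) by (intro extensionalityI[of _ "topspace X"])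
        (auto simp: f2_def field_simps dest: continuous_functionsD)
    finally show ?thesis .
  qed
  then have "uball ?K \<zero>\<^bsub>A\<^esub> (\<delta>/2) \<subseteq> B" by (rule subsetI)
  moreover have "\<zero>\<^bsub>A\<^esub> \<in> C" by (simp add: const_continuous_functions)
  moreover have "0 < \<delta>/2" using \<delta>(1) by simp
  ultimately show "\<exists>U. openin (topo A) U \<and> \<zero>\<^bsub>A\<^esub> \<in> U \<and> U \<subseteq> B"
    by (intro exI[of _ "uball ?K \<zero>\<^bsub>A\<^esub> (\<delta>/2)"] conjI openin_uball[OF K] uball_self)
qed

theorem barreled_function_algebra_iff:
  "barreled A \<longleftrightarrow> full_family X \<F> \<and>
    (\<forall>S \<subseteq> topspace X. relatively_pseudocompact X S \<longrightarrow> relatively_compact X S)"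
proof
  assume "barreled A"
  then show "full_family X \<F> \<and>
      (\<forall>S \<subseteq> topspace X. relatively_pseudocompact X S \<longrightarrow> relatively_compact X S)"
    by (intro conjI allI impI barreled_imp_full_and_relatively_compact)
next
  assume *: "full_family X \<F> \<and>
      (\<forall>S \<subseteq> topspace X. relatively_pseudocompact X S \<longrightarrow> relatively_compact X S)"
  show "barreled A"
    by (rule full_and_relatively_compact_imp_barreled) (use * in auto)
qed

end

subsection \<open>Commutative C*-seminorms and characters\<close>

text \<open>Extensionality makes a character determined by its values on the carrier, so that
  distinct characters are separated by elements of the algebra. Continuity will come from domination
  by a continuous seminorm.\<close>

definition star_character :: "'a top_star_algebra \<Rightarrow> ('a \<Rightarrow> complex) \<Rightarrow> bool" where
  "star_character A \<phi> \<longleftrightarrow> \<phi> \<in> extensional (carrier A) \<and> \<phi> \<one>\<^bsub>A\<^esub> = 1 \<and>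
     (\<forall>x\<in>carrier A. \<forall>y\<in>carrier A. \<phi> (x \<oplus>\<^bsub>A\<^esub> y) = \<phi> x + \<phi> y) \<and>
     (\<forall>x\<in>carrier A. \<forall>y\<in>carrier A. \<phi> (x \<otimes>\<^bsub>A\<^esub> y) = \<phi> x * \<phi> y) \<and>
     (\<forall>c. \<forall>x\<in>carrier A. \<phi> (c \<odot>\<^bsub>A\<^esub> x) = c * \<phi> x) \<and>
     (\<forall>x\<in>carrier A. \<phi> (star A x) = cnj (\<phi> x))"

lemma complex_field_simps [simp]:
  "carrier complex_field = UNIV"
  "x \<otimes>\<^bsub>complex_field\<^esub> y = x * y"
  "x \<oplus>\<^bsub>complex_field\<^esub> y = x + y"
  "\<one>\<^bsub>complex_field\<^esub> = 1"
  "\<zero>\<^bsub>complex_field\<^esub> = 0"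
  by (simp_all add: complex_field_def)

locale comm_star_algebra = star_algebra A + cring A for A :: "'a top_star_algebra" (structure)
begin

lemma scale_closed [simp]: "x \<in> carrier A \<Longrightarrow> c \<odot> x \<in> carrier A"
  by simp

lemma scale_add_left: "x \<in> carrier A \<Longrightarrow> (c + d) \<odot> x = c \<odot> x \<oplus> d \<odot> x"
  using smult_l_distr[of c d x] by simp

lemma scale_scale: "x \<in> carrier A \<Longrightarrow> c \<odot> (d \<odot> x) = (c * d) \<odot> x"
  using smult_assoc1[of c d x] by simp

lemma scale_one: "x \<in> carrier A \<Longrightarrow> 1 \<odot> x = x"
  using smult_one[of x] by simp

lemma scale_zero: "x \<in> carrier A \<Longrightarrow> 0 \<odot> x = \<zero>"
  using smult_l_null[of x] by simp

lemma minus_eq_scale: "x \<in> carrier A \<Longrightarrow> \<ominus> x = (-1) \<odot> x"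
proof (rule minus_equality)
  assume x: "x \<in> carrier A"
  have "(-1) \<odot> x \<oplus> 1 \<odot> x = \<zero>"
    using scale_add_left[OF x, of "-1" 1] scale_zero[OF x] by simp
  then show "(-1) \<odot> x \<oplus> x = \<zero>" by (simp add: scale_one x)
qed simp_all

lemma scale_minus: "x \<in> carrier A \<Longrightarrow> (- c) \<odot> x = \<ominus> (c \<odot> x)"
  by (simp add: minus_eq_scale scale_scale)

lemma scale_one_mult: "x \<in> carrier A \<Longrightarrow> (c \<odot> \<one>) \<otimes> x = c \<odot> x"
  by (simp add: smult_times_left)

lemma scale_diff: "x \<in> carrier A \<Longrightarrow> (c - d) \<odot> x = c \<odot> x \<ominus> d \<odot> x"
  using scale_add_left[of x c "- d"] by (simp add: scale_minus a_minus_def)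

lemma star_one [simp]: "star A \<one> = \<one>"
proof -
  have "star A (star A \<one> \<otimes> \<one>) = star A \<one> \<otimes> star A (star A \<one>)"
    by (rule star_times) (simp_all add: star_closed)
  then show ?thesis by (simp add: star_closed star_star)
qed

lemma star_diff:
  assumes "x \<in> carrier A" "y \<in> carrier A"
  shows "star A (x \<ominus> y) = star A x \<ominus> star A y"
  using assms star_smult[of y "-1"] by (simp add: a_minus_def star_add minus_eq_scale star_closed)

lemma cstar_seminorm_cong:
  assumes "cstar_seminorm A p" "\<And>x. x \<in> carrier A \<Longrightarrow> p x = q x"
  shows "cstar_seminorm A q"
  using assms unfolding cstar_seminorm_def by (simp add: star_closed)

context
  fixes q assumes q: "cstar_seminorm A q"
begin

lemma seminorm_nonneg: "x \<in> carrier A \<Longrightarrow> 0 \<le> q x"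
  and seminorm_add: "x \<in> carrier A \<Longrightarrow> y \<in> carrier A \<Longrightarrow> q (x \<oplus> y) \<le> q x + q y"
  and seminorm_scale: "x \<in> carrier A \<Longrightarrow> q (c \<odot> x) = cmod c * q x"
  and seminorm_mult: "x \<in> carrier A \<Longrightarrow> y \<in> carrier A \<Longrightarrow> q (x \<otimes> y) \<le> q x * q y"
  and seminorm_cstar: "x \<in> carrier A \<Longrightarrow> q (star A x \<otimes> x) = (q x)\<^sup>2"
  using q by (simp_all add: cstar_seminorm_def)

lemma seminorm_zero: "q \<zero> = 0"
  using seminorm_scale[of \<zero> 0] by (simp add: scale_zero)

lemma seminorm_minus: "x \<in> carrier A \<Longrightarrow> q (\<ominus> x) = q x"
  by (simp add: minus_eq_scale seminorm_scale)

lemma seminorm_diff: "x \<in> carrier A \<Longrightarrow> y \<in> carrier A \<Longrightarrow> q (x \<ominus> y) \<le> q x + q y"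
  using seminorm_add[of x "\<ominus> y"] by (simp add: a_minus_def seminorm_minus)

lemma seminorm_triangle_sub: "x \<in> carrier A \<Longrightarrow> y \<in> carrier A \<Longrightarrow> q x \<le> q y + q (x \<ominus> y)"
proof -
  assume xy: "x \<in> carrier A" "y \<in> carrier A"
  then have "y \<oplus> (x \<ominus> y) = x" by algebra
  then show ?thesis using seminorm_add[of y "x \<ominus> y"] xy by simp
qed

lemma seminorm_diff_commute: "x \<in> carrier A \<Longrightarrow> y \<in> carrier A \<Longrightarrow> q (x \<ominus> y) = q (y \<ominus> x)"
proof -
  assume xy: "x \<in> carrier A" "y \<in> carrier A"
  then have "y \<ominus> x = \<ominus> (x \<ominus> y)" by algebra
  then show ?thesis using seminorm_minus[of "x \<ominus> y"] xy by simp
qed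

lemma seminorm_triangle_diff:
  assumes "x \<in> carrier A" "y \<in> carrier A" "z \<in> carrier A"
  shows "q (x \<ominus> z) \<le> q (x \<ominus> y) + q (y \<ominus> z)"
proof -
  have "x \<ominus> z = (x \<ominus> y) \<oplus> (y \<ominus> z)" using assms by algebra
  then show ?thesis using seminorm_add[of "x \<ominus> y" "y \<ominus> z"] assms by simp
qed

text \<open>The C*-identity bounds the square of \<open>q y\<close> by
  \<open>q (star A y) * q y\<close>; cancel \<open>q y\<close>, then apply the result to
  \<open>star A x\<close>.\<close>

lemma seminorm_star: "x \<in> carrier A \<Longrightarrow> q (star A x) = q x"
proof -
  have le: "q y \<le> q (star A y)" if y: "y \<in> carrier A" for y
  proof (cases "q y = 0")
    case False
    have "q y * q y \<le> q (star A y) * q y"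
      using seminorm_mult[of "star A y" y] seminorm_cstar[OF y] y by (simp add: star_closed power2_eq_square)
    then show ?thesis using False seminorm_nonneg[OF y] by simp
  qed (simp add: seminorm_nonneg star_closed y)
  assume x: "x \<in> carrier A"
  show ?thesis using le[OF x] le[OF star_closed[OF x]] x by (simp add: star_star)
qed

end

text \<open>Where \<open>q\<close> is the supremum over a compact set, the limit below is the supremum over the part of
  that set where \<open>\<bar>f\<bar> = 1\<close>.\<close>

lemma cstar_seminorm_peak:
  assumes q: "cstar_seminorm A q" and f: "f \<in> carrier A" "star A f = f" "q f = 1"
  shows "\<exists>r. cstar_seminorm A r \<and> (\<forall>x\<in>carrier A. r x \<le> q x) \<and>
    (\<forall>x\<in>carrier A. r (f \<otimes> x) = r x) \<and> r \<one> = 1 \<and>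
    (\<forall>b\<in>carrier A. (\<forall>y\<in>carrier A. q (b \<otimes> y) = q y) \<longrightarrow> (\<forall>x\<in>carrier A. r (b \<otimes> x) = r x))"
proof -
  note nonneg = seminorm_nonneg[OF q]
  \<comment> \<open>Decreasing in \<open>n\<close>, because \<open>q f = 1\<close>.\<close>
  define s where "s n x = q (f [^] n \<otimes> x)" for n :: nat and x
  have fn [simp]: "f [^] n \<in> carrier A" for n :: nat using f by simp
  have star_fn: "star A (f [^] n) = f [^] n" for n :: nat
    by (induction n) (simp_all add: star_times f m_comm)
  have s_Suc: "s (Suc n) x \<le> s n x" if x: "x \<in> carrier A" for n x
  proof -
    have "f [^] Suc n \<otimes> x = f \<otimes> (f [^] n \<otimes> x)" using x f(1) fn[of n] by (simp add: m_ac)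
    then have "s (Suc n) x \<le> q f * s n x"
      unfolding s_def using seminorm_mult[OF q f(1), of "f [^] n \<otimes> x"] x by simp
    then show ?thesis by (simp add: f)
  qed
  have s_nonneg: "0 \<le> s n x" if "x \<in> carrier A" for n x unfolding s_def using that by (simp add: nonneg)
  have conv: "\<exists>l. (\<lambda>n. s n x) \<longlonglongrightarrow> l \<and> (\<forall>n. l \<le> s n x)" if x: "x \<in> carrier A" for x
  proof -
    have "decseq (\<lambda>n. s n x)" using s_Suc[OF x] by (simp add: decseq_Suc_iff)
    then show ?thesis using decseq_convergent[of "\<lambda>n. s n x" 0] s_nonneg[OF x] by metis
  qed
  define r where "r x = lim (\<lambda>n. s n x)" for x
  have r: "(\<lambda>n. s n x) \<longlonglongrightarrow> r x" "r x \<le> s n x" if x: "x \<in> carrier A" for x n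
    using conv[OF x] unfolding r_def by (auto dest: limI)
  \<comment> \<open>Laws involving products hold along even exponents only: by commutativity,
    \<open>n + n\<close> factors \<open>f\<close> can be shared equally between the two factors of a
    product.\<close>
  have double: "(\<lambda>n. s (n + n) x) \<longlonglongrightarrow> r x" if "x \<in> carrier A" for x
    using LIMSEQ_subseq_LIMSEQ[OF r(1)[OF that], of "\<lambda>n. n + n"] by (simp add: o_def strict_mono_def)
  have fnn: "f [^] (n + n) \<otimes> (x \<otimes> y) = (f [^] n \<otimes> x) \<otimes> (f [^] n \<otimes> y)"
    if "x \<in> carrier A" "y \<in> carrier A" for n :: nat and x y
    using that by (simp add: nat_pow_mult[symmetric] f m_ac)
  have "cstar_seminorm A r"
    unfolding cstar_seminorm_def
  proof (intro conjI ballI allI)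
    fix x assume x: "x \<in> carrier A"
    show "0 \<le> r x" using r(1)[OF x] s_nonneg[OF x] by (intro LIMSEQ_le_const) auto
    fix c
    have "s n (c \<odot> x) = cmod c * s n x" for n
      using x by (simp add: s_def smult_times_right seminorm_scale[OF q])
    then have "(\<lambda>n. s n (c \<odot> x)) \<longlonglongrightarrow> cmod c * r x" using tendsto_mult_left[OF r(1)[OF x]] by simp
    then show "r (c \<odot> x) = cmod c * r x" using LIMSEQ_unique r(1)[of "c \<odot> x"] x by simp
    have "s (n + n) (star A x \<otimes> x) = (s n x)\<^sup>2" for n
    proof -
      have "f [^] (n + n) \<otimes> (star A x \<otimes> x) = star A (f [^] n \<otimes> x) \<otimes> (f [^] n \<otimes> x)"
        using fnn[OF star_closed[OF x] x, of n] x by (simp add: star_times star_fn m_comm star_closed)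
      then show ?thesis unfolding s_def using x by (simp add: seminorm_cstar[OF q])
    qed
    then have "(\<lambda>n. s (n + n) (star A x \<otimes> x)) \<longlonglongrightarrow> (r x)\<^sup>2" using tendsto_power[OF r(1)[OF x]] by simp
    then show "r (star A x \<otimes> x) = (r x)\<^sup>2"
      using LIMSEQ_unique double[of "star A x \<otimes> x"] x by (simp add: star_closed)
  next
    fix x y assume xy: "x \<in> carrier A" "y \<in> carrier A"
    have "s n (x \<oplus> y) \<le> s n x + s n y" for n
      using xy seminorm_add[OF q, of "f [^] n \<otimes> x" "f [^] n \<otimes> y"] by (simp add: s_def r_distr)
    then show "r (x \<oplus> y) \<le> r x + r y"
      using xy by (intro LIMSEQ_le[OF r(1) tendsto_add[OF r(1) r(1)]]) auto
    have "s (n + n) (x \<otimes> y) \<le> s n x * s n y" for n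
      using xy seminorm_mult[OF q, of "f [^] n \<otimes> x" "f [^] n \<otimes> y"] fnn[OF xy] by (simp add: s_def)
    then show "r (x \<otimes> y) \<le> r x * r y"
      using xy by (intro LIMSEQ_le[OF double tendsto_mult[OF r(1) r(1)]]) auto
  qed
  moreover have "r x \<le> q x" if "x \<in> carrier A" for x
    using r(2)[OF that, of 0] that by (simp add: s_def)
  moreover have "r (f \<otimes> x) = r x" if x: "x \<in> carrier A" for x
  proof -
    have "s n (f \<otimes> x) = s (Suc n) x" for n using x f(1) fn[of n] by (simp add: s_def m_ac)
    then have "(\<lambda>n. s (Suc n) x) \<longlonglongrightarrow> r (f \<otimes> x)" using r(1)[of "f \<otimes> x"] x f(1) by simp
    then show ?thesis using LIMSEQ_Suc[OF r(1)[OF x]] LIMSEQ_unique by blast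
  qed
  moreover have "r \<one> = 1"
  proof -
    \<comment> \<open>For the self-adjoint \<open>f\<close> the C*-identity computes the seminorm of
      a square exactly, which gives exponents that are powers of two; monotonicity will fill the
      gaps.\<close>
    have pow: "s (2 ^ k) \<one> = 1" for k
    proof (induction k)
      case 0
      then show ?case using f by (simp add: s_def)
    next
      case (Suc k)
      have "f [^] (2 ^ k + 2 ^ k :: nat) = star A (f [^] (2 ^ k :: nat)) \<otimes> f [^] (2 ^ k :: nat)"
        by (simp add: star_fn nat_pow_mult f)
      then have "q (f [^] (2 ^ k + 2 ^ k :: nat)) = (q (f [^] (2 ^ k :: nat)))\<^sup>2"
        by (simp add: seminorm_cstar[OF q])
      then show ?case using Suc by (simp add: s_def mult_2)
    qed
    have "decseq (\<lambda>n. s n \<one>)" using s_Suc[of \<one>] by (simp add: decseq_Suc_iff)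
    then have "s n \<one> \<ge> 1" for n
      using decseqD[of "\<lambda>n. s n \<one>" n "2 ^ n"] pow[of n] less_exp[of n] by (simp add: less_imp_le)
    moreover have "s n \<one> \<le> 1" for n
    proof -
      have "s n \<one> \<le> s 0 \<one>" using \<open>decseq (\<lambda>n. s n \<one>)\<close> by (rule decseqD) simp
      also have "s 0 \<one> = q \<one>" by (simp add: s_def)
      also have "q \<one> = (q \<one>)\<^sup>2" using seminorm_cstar[OF q, of \<one>] by simp
      then have "q \<one> \<le> 1" by (auto simp: power2_eq_square)
      finally show ?thesis .
    qed
    ultimately have "s n \<one> = 1" for n by (simp add: antisym)
    then show ?thesis using r(1)[of \<one>] by (simp add: LIMSEQ_const_iff)
  qed
  \<comment> \<open>Invariance under previous elements is inherited; this keeps the limit in the set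
    in which minimality is tested.\<close>
  moreover have "r (b \<otimes> x) = r x"
    if b: "b \<in> carrier A" "\<And>y. y \<in> carrier A \<Longrightarrow> q (b \<otimes> y) = q y" and x: "x \<in> carrier A" for b x
  proof -
    have "s n (b \<otimes> x) = s n x" for n
    proof -
      have "f [^] n \<otimes> (b \<otimes> x) = b \<otimes> (f [^] n \<otimes> x)" using b(1) x fn[of n] by (simp add: m_ac)
      then show ?thesis using b(2)[of "f [^] n \<otimes> x"] x by (simp add: s_def)
    qed
    then show ?thesis by (simp add: r_def)
  qed
  ultimately show ?thesis by blast
qed

section \<open>Minimal C*-seminorms are multiplicative\<close>

text \<open>Invariance under \<open>b\<close> together with \<open>q \<one> = 1\<close> forces
  \<open>q b = 1\<close>, so shrinking a seminorm inside this set never loses its value at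
  \<open>b\<close>. Extensionality makes the pointwise order on the carrier antisymmetric.\<close>

definition peaking_seminorms where
  "peaking_seminorms p b = {q \<in> extensional (carrier A). cstar_seminorm A q \<and>
     (\<forall>x\<in>carrier A. q x \<le> p x) \<and> (\<forall>x\<in>carrier A. q (b \<otimes> x) = q x) \<and> q \<one> = 1}"

text \<open>In a chain the smaller of two approximants is good at both points, so one sequence
  serves any finite set. Each law of a C*-seminorm mentions finitely many elements and therefore
  passes to the infimum.\<close>

lemma chain_infimum_approx:
  fixes Q :: "('a \<Rightarrow> real) set"
  assumes "Q \<noteq> {}" and chain: "\<And>q r. q \<in> Q \<Longrightarrow> r \<in> Q \<Longrightarrow> (\<forall>x\<in>S. q x \<le> r x) \<or> (\<forall>x\<in>S. r x \<le> q x)"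
    and nonneg: "\<And>q x. q \<in> Q \<Longrightarrow> x \<in> S \<Longrightarrow> 0 \<le> q x"
    and F: "finite F" "F \<subseteq> S"
  obtains r where "\<And>n::nat. r n \<in> Q" "\<And>x. x \<in> F \<Longrightarrow> (\<lambda>n. r n x) \<longlonglongrightarrow> (INF q\<in>Q. q x)"
proof -
  have bdd: "bdd_below ((\<lambda>q. q x) ` Q)" if "x \<in> S" for x
    using nonneg that by (intro bdd_belowI[of _ 0]) auto
  have approx: "\<exists>q\<in>Q. \<forall>x\<in>F. q x < (INF q\<in>Q. q x) + e" if "e > 0" for e
    using F
  proof (induction F rule: finite_induct)
    case empty
    then show ?case using assms(1) by auto
  next
    case (insert x F)
    then obtain q where q: "q \<in> Q" "\<forall>x\<in>F. q x < (INF q\<in>Q. q x) + e" by auto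
    obtain r where r: "r \<in> Q" "r x < (INF q\<in>Q. q x) + e"
      using cINF_less_iff[OF assms(1) bdd, of x "(INF q\<in>Q. q x) + e"] insert.prems \<open>e > 0\<close> by auto
    from chain[OF q(1) r(1)] show ?case
    proof
      assume *: "\<forall>x\<in>S. q x \<le> r x"
      then have "q x < (INF q\<in>Q. q x) + e" using r(2) insert.prems by fastforce
      then show ?thesis using q by blast
    next
      assume *: "\<forall>x\<in>S. r x \<le> q x"
      have "r y < (INF q\<in>Q. q y) + e" if "y \<in> F" for y
      proof -
        have "r y \<le> q y" using * insert.prems that by blast
        also have "q y < (INF q\<in>Q. q y) + e" using q(2) that by blast
        finally show ?thesis .
      qed
      then show ?thesis using r by blast
    qed
  qed
  have "\<exists>q\<in>Q. \<forall>x\<in>F. q x < (INF q\<in>Q. q x) + inverse (real (Suc n))" for n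
    by (rule approx) simp
  then obtain r where r: "\<And>n. r n \<in> Q" "\<And>n x. x \<in> F \<Longrightarrow> r n x < (INF q\<in>Q. q x) + inverse (real (Suc n))"
    by metis
  have "(\<lambda>n. r n x) \<longlonglongrightarrow> (INF q\<in>Q. q x)" if x: "x \<in> F" for x
  proof (rule tendsto_sandwich)
    have "x \<in> S" using x F(2) by blast
    then show "\<forall>\<^sub>F n in sequentially. (INF q\<in>Q. q x) \<le> r n x"
      using r(1) bdd by (intro always_eventually allI cINF_lower) auto
    show "\<forall>\<^sub>F n in sequentially. r n x \<le> (INF q\<in>Q. q x) + inverse (real (Suc n))"
      using r(2)[OF x] by (intro always_eventually allI less_imp_le)
    show "(\<lambda>n. (INF q\<in>Q. q x) + inverse (real (Suc n))) \<longlonglongrightarrow> (INF q\<in>Q. q x)"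
      using tendsto_add[OF tendsto_const LIMSEQ_inverse_real_of_nat] by simp
  qed simp
  with r(1) show ?thesis by (rule that)
qed

lemma minimal_peaking_seminorm:
  assumes "peaking_seminorms p b \<noteq> {}" and b: "b \<in> carrier A"
  obtains q where "q \<in> peaking_seminorms p b"
    "\<And>r. r \<in> peaking_seminorms p b \<Longrightarrow> \<forall>x\<in>carrier A. r x \<le> q x \<Longrightarrow> r = q"
proof -
  \<comment> \<open>The order is reversed, so that maximal elements are minimal seminorms and upper
    bounds of chains are infima.\<close>
  let ?P = "\<lambda>q r. \<forall>x\<in>carrier A. r x \<le> (q x :: real)"
  have "\<exists>m\<in>peaking_seminorms p b. \<forall>a\<in>peaking_seminorms p b. ?P m a \<longrightarrow> a = m"
  proof (rule predicate_Zorn)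
    show "partial_order_on (peaking_seminorms p b) (relation_of ?P (peaking_seminorms p b))"
    proof (rule partial_order_on_relation_ofI)
      fix q r assume "q \<in> peaking_seminorms p b" "r \<in> peaking_seminorms p b" "?P q r" "?P r q"
      then show "q = r"
        by (intro extensionalityI[of _ "carrier A"]) (auto simp: peaking_seminorms_def intro: antisym)
    qed (auto intro: order_trans)
  next
    fix Q assume Q: "Q \<in> Chains (relation_of ?P (peaking_seminorms p b))"
    show "\<exists>u\<in>peaking_seminorms p b. \<forall>a\<in>Q. ?P a u"
    proof (cases "Q = {}")
      case False
      have sub: "q \<in> peaking_seminorms p b" if "q \<in> Q" for q
        using Q that by (auto simp: Chains_def relation_of_def)
      have chain: "?P q r \<or> ?P r q" if "q \<in> Q" "r \<in> Q" for q r
        using Q that unfolding Chains_def relation_of_def by blast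
      have cs: "cstar_seminorm A q" if "q \<in> Q" for q using sub[OF that] by (simp add: peaking_seminorms_def)
      define u where "u = (\<lambda>x\<in>carrier A. INF q\<in>Q. q x)"
      have approx: "\<exists>r. (\<forall>n::nat. r n \<in> Q) \<and> (\<forall>x\<in>F. (\<lambda>n. r n x) \<longlonglongrightarrow> u x)" if F: "finite F" "F \<subseteq> carrier A" for F
      proof -
        obtain r where r: "\<And>n::nat. r n \<in> Q" "\<And>x. x \<in> F \<Longrightarrow> (\<lambda>n. r n x) \<longlonglongrightarrow> (INF q\<in>Q. q x)"
          by (rule chain_infimum_approx[OF False _ _ F]) (use chain seminorm_nonneg[OF cs] in blast)+
        then show ?thesis using F(2) by (intro exI[of _ r]) (auto simp: u_def)
      qed
      have "cstar_seminorm A u"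
        unfolding cstar_seminorm_def
      proof (intro conjI ballI allI)
        fix x assume x: "x \<in> carrier A"
        show "0 \<le> u x" using x seminorm_nonneg[OF cs] False by (auto simp: u_def intro: cINF_greatest)
        fix c
        obtain r where r: "\<And>n::nat. r n \<in> Q" "(\<lambda>n. r n x) \<longlonglongrightarrow> u x" "(\<lambda>n. r n (c \<odot> x)) \<longlonglongrightarrow> u (c \<odot> x)"
          using approx[of "{x, c \<odot> x}"] x by auto
        have "(\<lambda>n. r n (c \<odot> x)) \<longlonglongrightarrow> cmod c * u x"
          using tendsto_mult_left[OF r(2), of "cmod c"] seminorm_scale[OF cs[OF r(1)] x] by simp
        then show "u (c \<odot> x) = cmod c * u x" using LIMSEQ_unique r(3) by blast
      next
        fix x assume x: "x \<in> carrier A"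
        obtain r where r: "\<And>n::nat. r n \<in> Q" "(\<lambda>n. r n x) \<longlonglongrightarrow> u x"
          "(\<lambda>n. r n (star A x \<otimes> x)) \<longlonglongrightarrow> u (star A x \<otimes> x)"
          using approx[of "{x, star A x \<otimes> x}"] x by (auto simp: star_closed)
        have "(\<lambda>n. r n (star A x \<otimes> x)) \<longlonglongrightarrow> (u x)\<^sup>2"
          using tendsto_power[OF r(2), of 2] seminorm_cstar[OF cs[OF r(1)] x] by simp
        then show "u (star A x \<otimes> x) = (u x)\<^sup>2" using LIMSEQ_unique r(3) by blast
      next
        fix x y assume xy: "x \<in> carrier A" "y \<in> carrier A"
        obtain r where r: "\<And>n::nat. r n \<in> Q" "(\<lambda>n. r n x) \<longlonglongrightarrow> u x" "(\<lambda>n. r n y) \<longlonglongrightarrow> u y"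
          "(\<lambda>n. r n (x \<oplus> y)) \<longlonglongrightarrow> u (x \<oplus> y)" "(\<lambda>n. r n (x \<otimes> y)) \<longlonglongrightarrow> u (x \<otimes> y)"
          using approx[of "{x, y, x \<oplus> y, x \<otimes> y}"] xy by auto
        show "u (x \<oplus> y) \<le> u x + u y"
          by (rule LIMSEQ_le[OF r(4) tendsto_add[OF r(2,3)]]) (use seminorm_add[OF cs[OF r(1)] xy] in blast)
        show "u (x \<otimes> y) \<le> u x * u y"
          by (rule LIMSEQ_le[OF r(5) tendsto_mult[OF r(2,3)]]) (use seminorm_mult[OF cs[OF r(1)] xy] in blast)
      qed
      moreover have lower: "u x \<le> q x" if "q \<in> Q" "x \<in> carrier A" for q x
        using that seminorm_nonneg[OF cs] by (auto simp: u_def intro!: cINF_lower bdd_belowI[of _ 0])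
      moreover have "u x \<le> p x" if "x \<in> carrier A" for x
      proof -
        obtain q where "q \<in> Q" using False by blast
        then show ?thesis using lower[of q x] sub[of q] that by (force simp: peaking_seminorms_def)
      qed
      moreover have "u (b \<otimes> x) = u x" if x: "x \<in> carrier A" for x
      proof -
        have "(INF q\<in>Q. q (b \<otimes> x)) = (INF q\<in>Q. q x)"
          by (rule INF_cong) (use sub x in \<open>auto simp: peaking_seminorms_def\<close>)
        then show ?thesis using x b by (simp add: u_def)
      qed
      moreover have "u \<one> = 1"
      proof -
        have "(INF q\<in>Q. q \<one>) = (INF q\<in>Q. 1)"
          by (rule INF_cong) (use sub in \<open>auto simp: peaking_seminorms_def\<close>)
        then show ?thesis using False by (simp add: u_def)
      qed
      ultimately have "u \<in> peaking_seminorms p b" by (simp add: peaking_seminorms_def u_def)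
      then show ?thesis using lower by blast
    qed (use assms(1) in blast)
  qed
  then show ?thesis using that by blast
qed

lemma restrict_peaking_seminorm:
  assumes "cstar_seminorm A r" "\<And>x. x \<in> carrier A \<Longrightarrow> r x \<le> p x"
    "\<And>x. x \<in> carrier A \<Longrightarrow> r (b \<otimes> x) = r x" "r \<one> = 1" "b \<in> carrier A"
  shows "restrict r (carrier A) \<in> peaking_seminorms p b"
  using assms cstar_seminorm_cong[OF assms(1), of "restrict r (carrier A)"]
  by (simp add: peaking_seminorms_def)

text \<open>By minimality, passing to a limit seminorm with \<open>cstar_seminorm_peak\<close>
  changes nothing, so every self-adjoint element of seminorm 1 acts isometrically. Applied to the
  normalised square of \<open>x\<close>, this turns the square of \<open>q (x \<otimes> y)\<close>
  into the product of the squares.\<close>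

lemma exists_multiplicative_seminorm:
  assumes p: "cstar_seminorm A p" and b: "b \<in> carrier A" "star A b = b" "p b = 1"
  obtains q where "cstar_seminorm A q" "\<And>x. x \<in> carrier A \<Longrightarrow> q x \<le> p x" "q b = 1" "q \<one> = 1"
    "\<And>x y. x \<in> carrier A \<Longrightarrow> y \<in> carrier A \<Longrightarrow> q (x \<otimes> y) = q x * q y"
proof -
  obtain r where "cstar_seminorm A r" "\<And>x. x \<in> carrier A \<Longrightarrow> r x \<le> p x"
    "\<And>x. x \<in> carrier A \<Longrightarrow> r (b \<otimes> x) = r x" "r \<one> = 1"
    using cstar_seminorm_peak[OF p b] by blast
  then have "peaking_seminorms p b \<noteq> {}" using restrict_peaking_seminorm b(1) by blast
  then obtain q where q: "q \<in> peaking_seminorms p b"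
    "\<And>r. r \<in> peaking_seminorms p b \<Longrightarrow> \<forall>x\<in>carrier A. r x \<le> q x \<Longrightarrow> r = q"
    using minimal_peaking_seminorm b(1) by blast
  have cs: "cstar_seminorm A q" and le: "\<And>x. x \<in> carrier A \<Longrightarrow> q x \<le> p x" and
    qb: "\<And>x. x \<in> carrier A \<Longrightarrow> q (b \<otimes> x) = q x" and q1: "q \<one> = 1"
    using q(1) by (auto simp: peaking_seminorms_def)
  have isometric: "q (f \<otimes> x) = q x" if f: "f \<in> carrier A" "star A f = f" "q f = 1" and x: "x \<in> carrier A" for f x
  proof -
    obtain r where r: "cstar_seminorm A r" "\<forall>x\<in>carrier A. r x \<le> q x"
      "\<forall>x\<in>carrier A. r (f \<otimes> x) = r x" "r \<one> = 1"
      "\<forall>b\<in>carrier A. (\<forall>y\<in>carrier A. q (b \<otimes> y) = q y) \<longrightarrow> (\<forall>x\<in>carrier A. r (b \<otimes> x) = r x)"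
      using cstar_seminorm_peak[OF cs f] by (elim exE conjE)
    have "restrict r (carrier A) \<in> peaking_seminorms p b"
    proof (rule restrict_peaking_seminorm[OF r(1) _ _ r(4) b(1)])
      show "r x \<le> p x" if "x \<in> carrier A" for x using r(2) le that order_trans by blast
      show "r (b \<otimes> x) = r x" if "x \<in> carrier A" for x using r(5) b(1) qb that by blast
    qed
    then have "restrict r (carrier A) = q" by (rule q(2)) (simp add: r(2))
    then have "q y = r y" if "y \<in> carrier A" for y using that by (metis restrict_apply')
    then show ?thesis using r(3) f(1) x by simp
  qed
  have "q (x \<otimes> y) = q x * q y" if xy: "x \<in> carrier A" "y \<in> carrier A" for x y
  proof (cases "q x = 0")
    case True
    then show ?thesis using seminorm_mult[OF cs xy] seminorm_nonneg[OF cs, of "x \<otimes> y"] xy by simp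
  next
    case False
    \<comment> \<open>Scaled by the C*-identity to have seminorm 1; \<open>x\<close> itself need not
      be self-adjoint.\<close>
    define g where "g = complex_of_real (1 / (q x)\<^sup>2) \<odot> (star A x \<otimes> x)"
    have g: "g \<in> carrier A" "star A g = g" "q g = 1"
      using xy(1) False by (simp_all add: g_def star_closed star_smult star_times star_star
          seminorm_scale[OF cs] seminorm_cstar[OF cs] norm_divide norm_power)
    have "(q (x \<otimes> y))\<^sup>2 = q (star A (x \<otimes> y) \<otimes> (x \<otimes> y))"
      using xy by (simp add: seminorm_cstar[OF cs])
    also have "star A (x \<otimes> y) \<otimes> (x \<otimes> y) = complex_of_real ((q x)\<^sup>2) \<odot> (g \<otimes> (star A y \<otimes> y))"
    proof -
      have "complex_of_real ((q x)\<^sup>2) \<odot> (g \<otimes> (star A y \<otimes> y)) = (complex_of_real ((q x)\<^sup>2) \<odot> g) \<otimes> (star A y \<otimes> y)"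
        using xy g(1) by (simp add: smult_times_left star_closed)
      also have "complex_of_real ((q x)\<^sup>2) \<odot> g = star A x \<otimes> x"
        unfolding g_def using xy False by (simp add: scale_scale star_closed scale_one flip: of_real_mult)
      also have "(star A x \<otimes> x) \<otimes> (star A y \<otimes> y) = star A (x \<otimes> y) \<otimes> (x \<otimes> y)"
        using xy by (simp add: star_times star_closed m_ac)
      finally show ?thesis by simp
    qed
    also have "q \<dots> = (q x)\<^sup>2 * (q y)\<^sup>2"
      using xy g by (simp add: seminorm_scale[OF cs] isometric star_closed seminorm_cstar[OF cs] norm_power)
    finally have "(q (x \<otimes> y))\<^sup>2 = (q x * q y)\<^sup>2" by (simp add: power_mult_distrib)
    then show ?thesis
      using xy seminorm_nonneg[OF cs] by (simp add: power2_eq_iff_nonneg)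
  qed
  moreover have "q b = 1" using qb[of \<one>] q1 b(1) by simp
  ultimately show ?thesis using that cs le q1 by blast
qed

section \<open>Multiplicative seminorms come from characters\<close>

lemma diff_square_factor:
  assumes u: "u \<in> carrier A"
  shows "(u \<ominus> v \<odot> \<one>) \<otimes> (u \<ominus> (- v) \<odot> \<one>) = u \<otimes> u \<ominus> v\<^sup>2 \<odot> \<one>"
proof -
  define e where "e = v \<odot> \<one>"
  have e: "e \<in> carrier A" by (simp add: e_def)
  have "(- v) \<odot> \<one> = \<ominus> e" by (simp add: e_def scale_minus)
  moreover have "v\<^sup>2 \<odot> \<one> = e \<otimes> e"
    by (simp add: e_def scale_one_mult scale_scale power2_eq_square)
  moreover have "(u \<ominus> e) \<otimes> (u \<ominus> \<ominus> e) = u \<otimes> u \<ominus> e \<otimes> e" using u e by algebra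
  ultimately show ?thesis by (simp add: e_def)
qed

text \<open>Mazur's elementary argument: factor \<open>u\<^sup>n - t\<^sup>n\<close> for \<open>n\<close> a power of two.\<close>

lemma distance_constant_near_minimum:
  assumes q: "cstar_seminorm A q" and q1: "q \<one> = 1"
    and mult: "\<And>x y. x \<in> carrier A \<Longrightarrow> y \<in> carrier A \<Longrightarrow> q (x \<otimes> y) = q x * q y"
    and u: "u \<in> carrier A" "q u = m" and m: "m > 0" "\<And>z. m \<le> q (u \<ominus> z \<odot> \<one>)"
    and t: "cmod t \<le> m / 2"
  shows "q (u \<ominus> t \<odot> \<one>) = m"
proof -
  define U where "U k = ((\<lambda>x. x \<otimes> x) ^^ k) u" for k
  have U_Suc: "U (Suc k) = U k \<otimes> U k" for k by (simp add: U_def)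
  have U: "U k \<in> carrier A" for k by (induction k) (simp_all add: U_Suc, simp add: U_def u)
  have U0: "U 0 = u" by (simp add: U_def)
  have qU: "q (U k) = m ^ 2 ^ k" for k
    by (induction k) (simp_all add: U0 u U_Suc mult U power_add[symmetric] mult_2)
  \<comment> \<open>A complex square root of \<open>w\<close> splits the element at level
    \<open>Suc k\<close> into two factors at level \<open>k\<close>, so the minimality of
    \<open>m\<close> propagates to all the powers \<open>U k\<close>.\<close>
  have lower: "m ^ 2 ^ k \<le> q (U k \<ominus> w \<odot> \<one>)" for k w
  proof (induction k arbitrary: w)
    case 0
    then show ?case using m(2) by (simp add: U0)
  next
    case (Suc k)
    define v where "v = csqrt w"
    have "q (U (Suc k) \<ominus> w \<odot> \<one>) = q (U k \<ominus> v \<odot> \<one>) * q (U k \<ominus> (- v) \<odot> \<one>)"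
      using diff_square_factor[OF U[of k], of v] mult[of "U k \<ominus> v \<odot> \<one>" "U k \<ominus> (- v) \<odot> \<one>"] U[of k]
      by (simp add: U_Suc v_def)
    moreover have "m ^ 2 ^ Suc k = m ^ 2 ^ k * m ^ 2 ^ k" by (simp add: mult_2 power_add)
    moreover have pos: "0 \<le> m ^ 2 ^ k" using m(1) by simp
    ultimately show ?case
      using mult_mono[OF Suc.IH[of v] Suc.IH[of "- v"] order_trans[OF pos Suc.IH] pos] by simp
  qed
  define T where "T k = q (U k \<ominus> (t ^ 2 ^ k) \<odot> \<one>)" for k
  have T_nonneg: "0 \<le> T k" for k unfolding T_def using U[of k] by (intro seminorm_nonneg[OF q]) simp
  have T_Suc: "T k * m ^ 2 ^ k \<le> T (Suc k)" for k
  proof -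
    have "T (Suc k) = T k * q (U k \<ominus> (- (t ^ 2 ^ k)) \<odot> \<one>)"
      using diff_square_factor[OF U[of k], of "t ^ 2 ^ k"]
        mult[of "U k \<ominus> (t ^ 2 ^ k) \<odot> \<one>" "U k \<ominus> (- (t ^ 2 ^ k)) \<odot> \<one>"] U[of k]
      by (simp add: T_def U_Suc power_mult[symmetric] mult.commute)
    then show ?thesis using lower[of k "- (t ^ 2 ^ k)"] T_nonneg[of k] by (simp add: mult_left_mono)
  qed
  \<comment> \<open>Iterating \<open>T_Suc\<close> collects the exponents 1, 2, 4, ..., whose sum is
    one less than \<open>2 ^ k\<close>; hence the extra factor \<open>m\<close> on the
    right.\<close>
  have T_lower: "T 0 * m ^ 2 ^ k \<le> T k * m" for k
  proof (induction k)
    case (Suc k)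
    have "T 0 * m ^ 2 ^ Suc k = (T 0 * m ^ 2 ^ k) * m ^ 2 ^ k" by (simp add: mult_2 power_add)
    also have "\<dots> \<le> (T k * m) * m ^ 2 ^ k" using Suc m(1) by (intro mult_right_mono) auto
    also have "\<dots> = (T k * m ^ 2 ^ k) * m" by simp
    also have "\<dots> \<le> T (Suc k) * m" using T_Suc m(1) by (intro mult_right_mono) auto
    finally show ?case .
  qed simp
  \<comment> \<open>The triangle inequality bounds \<open>T k\<close> from above. Since
    \<open>cmod t \<le> m / 2\<close>, the scalar term is negligible against
    \<open>m ^ 2 ^ k\<close>; its decay is weakened to \<open>(1/2) ^ k\<close> to have a plain
    geometric limit.\<close>
  have "T 0 \<le> m * (1 + (1/2) ^ k)" for k
  proof -
    have "cmod t ^ 2 ^ k \<le> (m / 2) ^ 2 ^ k" using t by (intro power_mono) auto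
    also have "\<dots> = m ^ 2 ^ k * (1/2) ^ 2 ^ k" by (simp add: power_divide)
    also have "\<dots> \<le> m ^ 2 ^ k * (1/2) ^ k"
      using m(1) less_exp[of k] by (intro mult_left_mono power_decreasing) (auto intro: less_imp_le)
    finally have tk: "cmod t ^ 2 ^ k \<le> m ^ 2 ^ k * (1/2) ^ k" .
    have "T k \<le> q (U k) + q ((t ^ 2 ^ k) \<odot> \<one>)"
      unfolding T_def by (rule seminorm_diff[OF q U]) simp
    also have "\<dots> = m ^ 2 ^ k + cmod t ^ 2 ^ k"
      by (simp add: qU seminorm_scale[OF q] q1 norm_power)
    also have "\<dots> \<le> m ^ 2 ^ k * (1 + (1/2) ^ k)" using tk by (simp add: algebra_simps)
    finally have "T k * m \<le> (m ^ 2 ^ k * (1 + (1/2) ^ k)) * m" using m(1) by (intro mult_right_mono) auto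
    then have "T 0 * m ^ 2 ^ k \<le> (m * (1 + (1/2) ^ k)) * m ^ 2 ^ k"
      using T_lower[of k] by (simp add: algebra_simps)
    then show ?thesis using m(1) by simp
  qed
  moreover have "(\<lambda>k. m * (1 + (1/2) ^ k)) \<longlonglongrightarrow> m * (1 + 0)"
    by (intro tendsto_intros LIMSEQ_realpow_zero) auto
  ultimately have "T 0 \<le> m * (1 + 0)" by (intro LIMSEQ_le_const) auto
  then show ?thesis using m(2)[of t] by (simp add: T_def U0)
qed

text \<open>The distance from \<open>x\<close> to the scalars attains a minimum. If it were
  positive, it would also be attained at every scalar within half of it, hence along an unbounded
  walk, where the distance must grow. This replaces the use of Liouville's theorem.\<close>

lemma exists_scalar_of_multiplicative:
  assumes q: "cstar_seminorm A q" and q1: "q \<one> = 1"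
    and mult: "\<And>x y. x \<in> carrier A \<Longrightarrow> y \<in> carrier A \<Longrightarrow> q (x \<otimes> y) = q x * q y"
    and x: "x \<in> carrier A"
  shows "\<exists>c. q (x \<ominus> c \<odot> \<one>) = 0"
proof -
  define N where "N z = q (x \<ominus> z \<odot> \<one>)" for z
  have N_nonneg: "0 \<le> N z" for z unfolding N_def using x by (intro seminorm_nonneg[OF q]) simp
  have lip: "N z \<le> N w + cmod (z - w)" for z w
  proof -
    have "q (w \<odot> \<one> \<ominus> z \<odot> \<one>) = cmod (z - w)"
      using seminorm_scale[OF q, of \<one> "w - z"] q1 by (simp add: scale_diff norm_minus_commute)
    then show ?thesis
      using seminorm_triangle_diff[OF q, of x "w \<odot> \<one>" "z \<odot> \<one>"] x by (simp add: N_def)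
  qed
  have coercive: "cmod z - q x \<le> N z" for z
  proof -
    have "cmod z = q (z \<odot> \<one>)" by (simp add: seminorm_scale[OF q] q1)
    also have "\<dots> \<le> q x + q (z \<odot> \<one> \<ominus> x)" using x by (intro seminorm_triangle_sub[OF q]) auto
    also have "q (z \<odot> \<one> \<ominus> x) = N z" unfolding N_def using x by (intro seminorm_diff_commute[OF q]) auto
    finally show ?thesis by simp
  qed
  \<comment> \<open>Outside this ball the distance exceeds \<open>q x\<close>, its value at 0, so a
    minimum over the ball is global.\<close>
  have "continuous_on (cball 0 (2 * q x)) N"
    unfolding continuous_on_iff dist_norm real_norm_def
  proof (intro ballI allI impI)
    fix w and e :: real assume "0 < e"
    have "\<bar>N z - N w\<bar> \<le> cmod (z - w)" for z
      using lip[of z w] lip[of w z] by (simp add: norm_minus_commute abs_le_iff)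
    then show "\<exists>d>0. \<forall>z\<in>cball 0 (2 * q x). cmod (z - w) < d \<longrightarrow> \<bar>N z - N w\<bar> < e"
      using \<open>0 < e\<close> by (intro exI[of _ e]) (auto intro: le_less_trans)
  qed
  moreover have "cball 0 (2 * q x) \<noteq> ({} :: complex set)" using seminorm_nonneg[OF q x] by simp
  ultimately obtain z0 where z0: "z0 \<in> cball 0 (2 * q x)" "\<And>z. z \<in> cball 0 (2 * q x) \<Longrightarrow> N z0 \<le> N z"
    using continuous_attains_inf[of "cball 0 (2 * q x)" N] compact_cball by blast
  define m where "m = N z0"
  have min: "m \<le> N z" for z
  proof (cases "z \<in> cball 0 (2 * q x)")
    case False
    have "x \<ominus> \<zero> = x" using x by algebra
    then have "N 0 = q x" using x by (simp add: N_def scale_zero)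
    moreover have "m \<le> N 0" unfolding m_def using seminorm_nonneg[OF q x] by (intro z0(2)) simp
    ultimately show ?thesis using coercive[of z] False by (simp add: dist_norm)
  qed (use z0 m_def in simp)
  have "m = 0"
  proof (rule ccontr)
    assume "m \<noteq> 0"
    then have m: "m > 0" using N_nonneg[of z0] by (simp add: m_def)
    have step: "N (w + t) = m" if w: "N w = m" and t: "cmod t \<le> m / 2" for w t
    proof -
      have shift: "(x \<ominus> w \<odot> \<one>) \<ominus> z \<odot> \<one> = x \<ominus> (w + z) \<odot> \<one>" for z
      proof -
        have "x \<ominus> (a \<oplus> b) = x \<ominus> a \<ominus> b" if "a \<in> carrier A" "b \<in> carrier A" for a b
          using x that by algebra
        then show ?thesis by (simp add: scale_add_left)
      qed
      have "q ((x \<ominus> w \<odot> \<one>) \<ominus> t \<odot> \<one>) = m"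
        by (rule distance_constant_near_minimum[OF q q1 mult _ _ m _ t])
          (use w x min in \<open>auto simp: shift N_def\<close>)
      then show ?thesis by (simp add: shift N_def)
    qed
    \<comment> \<open>Steps of length \<open>m / 2\<close> in a fixed direction, each of them
      allowed by \<open>step\<close>.\<close>
    have "N (z0 + of_nat n * complex_of_real (m / 2)) = m" for n
    proof (induction n)
      case (Suc n)
      have "N (z0 + of_nat n * complex_of_real (m / 2) + complex_of_real (m / 2)) = m"
        using m by (intro step[OF Suc]) (simp del: of_real_divide)
      moreover have "z0 + of_nat (Suc n) * complex_of_real (m / 2) =
          z0 + of_nat n * complex_of_real (m / 2) + complex_of_real (m / 2)"
        by (simp add: distrib_right del: of_real_divide)
      ultimately show ?case by (simp only:)
    qed (simp add: m_def)
    then have bound: "real n * (m / 2) \<le> m + q x + cmod z0" for n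
    proof -
      have "real n * (m / 2) = cmod (of_nat n * complex_of_real (m / 2))"
        using m by (simp add: norm_mult del: of_real_divide)
      also have "\<dots> \<le> cmod (z0 + of_nat n * complex_of_real (m / 2)) + cmod z0"
        using norm_triangle_ineq4[of "z0 + of_nat n * complex_of_real (m / 2)" z0] by simp
      also have "\<dots> \<le> m + q x + cmod z0"
        using coercive[of "z0 + of_nat n * complex_of_real (m / 2)"]
          \<open>N (z0 + of_nat n * complex_of_real (m / 2)) = m\<close> by simp
      finally show ?thesis .
    qed
    obtain n where "m + q x + cmod z0 < real n * (m / 2)"
      using reals_Archimedean3[OF half_gt_zero[OF m]] by blast
    then show False using bound[of n] by simp
  qed
  then show ?thesis unfolding m_def N_def by blast
qed

text \<open>The multiplicative seminorm \<open>q\<close> leaves exactly one scalar at distance 0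
  from each \<open>x\<close>, and that scalar is the value of the character. The normalisation of
  \<open>b\<close> is chosen so that \<open>q b = 1\<close> says that
  \<open>q a = p a\<close>.\<close>

theorem exists_norming_character:
  assumes p: "cstar_seminorm A p" and a: "a \<in> carrier A" "p a \<noteq> 0"
  obtains \<phi> where "star_character A \<phi>" "\<And>x. x \<in> carrier A \<Longrightarrow> cmod (\<phi> x) \<le> p x" "cmod (\<phi> a) = p a"
proof -
  define b where "b = complex_of_real (1 / (p a)\<^sup>2) \<odot> (star A a \<otimes> a)"
  have b: "b \<in> carrier A" "star A b = b" "p b = 1"
    using a by (simp_all add: b_def star_closed star_smult star_times star_star
        seminorm_scale[OF p] seminorm_cstar[OF p] norm_divide norm_power)
  obtain q where q: "cstar_seminorm A q" and le: "\<And>x. x \<in> carrier A \<Longrightarrow> q x \<le> p x" and qb: "q b = 1"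
    and q1: "q \<one> = 1" and mult: "\<And>x y. x \<in> carrier A \<Longrightarrow> y \<in> carrier A \<Longrightarrow> q (x \<otimes> y) = q x * q y"
    using exists_multiplicative_seminorm[OF p b] by metis
  define \<phi> where "\<phi> = (\<lambda>x\<in>carrier A. SOME c. q (x \<ominus> c \<odot> \<one>) = 0)"
  have \<phi>: "q (x \<ominus> \<phi> x \<odot> \<one>) = 0" if "x \<in> carrier A" for x
    using someI_ex[OF exists_scalar_of_multiplicative[OF q q1 mult that]] that by (simp add: \<phi>_def)
  \<comment> \<open>On scalars \<open>q\<close> is the modulus, so the scalar is unique; each law of
    a character is then verified by showing that the expected value has distance 0.\<close>
  have unique: "\<phi> x = c" if x: "x \<in> carrier A" and c: "q (x \<ominus> c \<odot> \<one>) \<le> 0" for x c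
  proof -
    have "cmod (\<phi> x - c) = q (\<phi> x \<odot> \<one> \<ominus> c \<odot> \<one>)"
      using seminorm_scale[OF q, of \<one> "\<phi> x - c"] q1 by (simp add: scale_diff)
    also have "\<dots> \<le> q (\<phi> x \<odot> \<one> \<ominus> x) + q (x \<ominus> c \<odot> \<one>)"
      using x by (intro seminorm_triangle_diff[OF q]) auto
    also have "q (\<phi> x \<odot> \<one> \<ominus> x) = q (x \<ominus> \<phi> x \<odot> \<one>)"
      using x by (intro seminorm_diff_commute[OF q]) auto
    finally have "cmod (\<phi> x - c) \<le> 0" using \<phi>[OF x] c by linarith
    then show ?thesis by simp
  qed
  have norm: "cmod (\<phi> x) = q x" if x: "x \<in> carrier A" for x
  proof -
    have "q (\<phi> x \<odot> \<one>) = cmod (\<phi> x)" by (simp add: seminorm_scale[OF q] q1)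
    moreover have "q x \<le> q (\<phi> x \<odot> \<one>) + q (x \<ominus> \<phi> x \<odot> \<one>)"
      using x by (intro seminorm_triangle_sub[OF q]) auto
    moreover have "q (\<phi> x \<odot> \<one>) \<le> q x + q (\<phi> x \<odot> \<one> \<ominus> x)"
      using x by (intro seminorm_triangle_sub[OF q]) auto
    moreover have "q (\<phi> x \<odot> \<one> \<ominus> x) = q (x \<ominus> \<phi> x \<odot> \<one>)"
      using x by (intro seminorm_diff_commute[OF q]) auto
    ultimately show ?thesis using \<phi>[OF x] by simp
  qed
  have "star_character A \<phi>"
    unfolding star_character_def
  proof (intro conjI ballI allI)
    show "\<phi> \<in> extensional (carrier A)" by (simp add: \<phi>_def)
    have "\<one> \<ominus> \<one> = \<zero>" by algebra
    then show "\<phi> \<one> = 1" by (intro unique) (simp_all add: scale_one seminorm_zero[OF q])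
  next
    fix x y assume xy: "x \<in> carrier A" "y \<in> carrier A"
    note cx = \<phi>[OF xy(1)] and cy = \<phi>[OF xy(2)]
    define e d where "e = \<phi> x \<odot> \<one>" and "d = \<phi> y \<odot> \<one>"
    have ed: "e \<in> carrier A" "d \<in> carrier A" by (simp_all add: e_def d_def)
    show "\<phi> (x \<oplus> y) = \<phi> x + \<phi> y"
    proof (rule unique)
      have "(x \<oplus> y) \<ominus> (\<phi> x + \<phi> y) \<odot> \<one> = (x \<ominus> e) \<oplus> (y \<ominus> d)"
      proof -
        have "(x \<oplus> y) \<ominus> (e \<oplus> d) = (x \<ominus> e) \<oplus> (y \<ominus> d)" using xy ed by algebra
        then show ?thesis by (simp add: scale_add_left e_def d_def)
      qed
      then show "q ((x \<oplus> y) \<ominus> (\<phi> x + \<phi> y) \<odot> \<one>) \<le> 0"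
        using seminorm_add[OF q, of "x \<ominus> e" "y \<ominus> d"] cx cy xy ed by (simp add: e_def d_def)
    qed (use xy in simp)
    show "\<phi> (x \<otimes> y) = \<phi> x * \<phi> y"
    proof (rule unique)
      have "(x \<otimes> y) \<ominus> (\<phi> x * \<phi> y) \<odot> \<one> = (x \<ominus> e) \<otimes> y \<oplus> e \<otimes> (y \<ominus> d)"
      proof -
        have "(x \<otimes> y) \<ominus> e \<otimes> d = (x \<ominus> e) \<otimes> y \<oplus> e \<otimes> (y \<ominus> d)" using xy ed by algebra
        moreover have "e \<otimes> d = (\<phi> x * \<phi> y) \<odot> \<one>" by (simp add: e_def d_def scale_one_mult scale_scale)
        ultimately show ?thesis by simp
      qed
      then show "q ((x \<otimes> y) \<ominus> (\<phi> x * \<phi> y) \<odot> \<one>) \<le> 0"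
        using seminorm_add[OF q, of "(x \<ominus> e) \<otimes> y" "e \<otimes> (y \<ominus> d)"] cx cy xy ed
        by (simp add: mult e_def d_def)
    qed (use xy in simp)
  next
    fix x c assume x: "x \<in> carrier A"
    show "\<phi> (c \<odot> x) = c * \<phi> x"
    proof (rule unique)
      have "(c \<odot> x) \<ominus> (c * \<phi> x) \<odot> \<one> = c \<odot> (x \<ominus> \<phi> x \<odot> \<one>)"
        using x smult_r_distr[of c x "\<ominus> (\<phi> x \<odot> \<one>)"] by (simp add: a_minus_def minus_eq_scale scale_scale)
      then show "q ((c \<odot> x) \<ominus> (c * \<phi> x) \<odot> \<one>) \<le> 0"
        using x \<phi>[OF x] by (simp add: seminorm_scale[OF q])
    qed (use x in simp)
  next
    fix x assume x: "x \<in> carrier A"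
    show "\<phi> (star A x) = cnj (\<phi> x)"
    proof (rule unique)
      have "star A x \<ominus> cnj (\<phi> x) \<odot> \<one> = star A (x \<ominus> \<phi> x \<odot> \<one>)"
        using x by (simp add: star_diff star_smult)
      then show "q (star A x \<ominus> cnj (\<phi> x) \<odot> \<one>) \<le> 0"
        using x \<phi>[OF x] by (simp add: seminorm_star[OF q])
    qed (use x in \<open>simp add: star_closed\<close>)
  qed
  moreover have "cmod (\<phi> x) \<le> p x" if "x \<in> carrier A" for x
    using norm[OF that] le[OF that] by simp
  moreover have "cmod (\<phi> a) = p a"
  proof -
    have "1 = q b" by (simp add: qb)
    also have "\<dots> = (q a)\<^sup>2 / (p a)\<^sup>2"
      using a by (simp add: b_def star_closed seminorm_scale[OF q] seminorm_cstar[OF q] norm_divide norm_power)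
    finally have "(q a)\<^sup>2 = (p a)\<^sup>2" using a(2) by (simp add: field_simps)
    then have "q a = p a"
      using seminorm_nonneg[OF q a(1)] seminorm_nonneg[OF p a(1)] by (simp add: power2_eq_iff_nonneg)
    then show ?thesis using norm[OF a(1)] by simp
  qed
  ultimately show ?thesis by (rule that)
qed

end

subsection \<open>The Gelfand representation\<close>

lemma open_Collect_eval: "open U \<Longrightarrow> open {h::'a \<Rightarrow> 'b::topological_space. h x \<in> U}"
  using open_vimage[OF _ continuous_on_product_coordinates, of U x] by (simp add: vimage_def)

text \<open>Evaluation at a point where two functions differ pulls separating open sets back.
  Characters live in a function type, and the Stone-Weierstrass locale asks for a Hausdorff type,
  whose class extends \<open>t0_space\<close> and \<open>t1_space\<close>.\<close>

instance "fun" :: (type, t0_space) t0_space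
proof
  fix f g :: "'a \<Rightarrow> 'b"
  assume "f \<noteq> g"
  then obtain x where x: "f x \<noteq> g x" by auto
  obtain U where "open U" "\<not> (f x \<in> U \<longleftrightarrow> g x \<in> U)"
    using t0_space_class.t0_space[OF x] by blast
  then show "\<exists>U. open U \<and> \<not> (f \<in> U \<longleftrightarrow> g \<in> U)"
    by (intro exI[of _ "{h. h x \<in> U}"]) (simp add: open_Collect_eval)
qed

instance "fun" :: (type, t1_space) t1_space
proof
  fix f g :: "'a \<Rightarrow> 'b"
  assume "f \<noteq> g"
  then obtain x where x: "f x \<noteq> g x" by auto
  obtain U where "open U" "f x \<in> U" "g x \<notin> U"
    using t1_space_class.t1_space[OF x] by blast
  then show "\<exists>U. open U \<and> f \<in> U \<and> g \<notin> U"
    by (intro exI[of _ "{h. h x \<in> U}"]) (simp add: open_Collect_eval)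
qed

instance "fun" :: (type, t2_space) t2_space
proof
  fix f g :: "'a \<Rightarrow> 'b"
  assume "f \<noteq> g"
  then obtain x where x: "f x \<noteq> g x" by auto
  obtain U V where "open U" "open V" "f x \<in> U" "g x \<in> V" "U \<inter> V = {}"
    using t2_space_class.hausdorff[OF x] by blast
  then show "\<exists>U V. open U \<and> open V \<and> f \<in> U \<and> g \<in> V \<and> U \<inter> V = {}"
    by (intro exI[of _ "{h. h x \<in> U}"] exI[of _ "{h. h x \<in> V}"])
       (auto simp: open_Collect_eval)
qed

locale comm_pro_cstar_algebra = pro_cstar_algebra A + cring A for A :: "'a top_star_algebra" (structure)

sublocale comm_pro_cstar_algebra \<subseteq> comm_star_algebra ..

context comm_pro_cstar_algebra
begin

abbreviation "SN \<equiv> continuous_cstar_seminorms A"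

lemma SN_cstar: "p \<in> SN \<Longrightarrow> cstar_seminorm A p"
  by (simp add: continuous_cstar_seminorms_def)

lemma SN_zero: "(\<lambda>_. 0) \<in> SN"
  by (simp add: continuous_cstar_seminorms_def cstar_seminorm_def)

text \<open>The source of directedness. A maximum is taken because, unlike a sum, it preserves the
  C*-identity.\<close>

lemma SN_max:
  assumes p: "p \<in> SN" and q: "q \<in> SN"
  shows "(\<lambda>x. max (p x) (q x)) \<in> SN"
proof -
  note pq = SN_cstar[OF p] SN_cstar[OF q]
  have "cstar_seminorm A (\<lambda>x. max (p x) (q x))"
    unfolding cstar_seminorm_def
  proof (intro conjI ballI allI)
    fix x assume x: "x \<in> carrier A"
    show "0 \<le> max (p x) (q x)" using seminorm_nonneg[OF pq(1) x] by simp
    show "max (p (c \<odot> x)) (q (c \<odot> x)) = cmod c * max (p x) (q x)" for c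
      using x by (simp add: seminorm_scale[OF pq(1)] seminorm_scale[OF pq(2)] max_mult_distrib_left)
    show "max (p (star A x \<otimes> x)) (q (star A x \<otimes> x)) = (max (p x) (q x))\<^sup>2"
      using x seminorm_nonneg[OF pq(1) x] seminorm_nonneg[OF pq(2) x]
      by (auto simp: seminorm_cstar[OF pq(1)] seminorm_cstar[OF pq(2)] max_def power_mono_iff)
  next
    fix x y assume xy: "x \<in> carrier A" "y \<in> carrier A"
    show "max (p (x \<oplus> y)) (q (x \<oplus> y)) \<le> max (p x) (q x) + max (p y) (q y)"
      using seminorm_add[OF pq(1) xy] seminorm_add[OF pq(2) xy] by linarith
    have "p x * p y \<le> max (p x) (q x) * max (p y) (q y)" "q x * q y \<le> max (p x) (q x) * max (p y) (q y)"
      using seminorm_nonneg[OF pq(1)] seminorm_nonneg[OF pq(2)] xy by (auto intro!: mult_mono simp: le_max_iff_disj)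
    then show "max (p (x \<otimes> y)) (q (x \<otimes> y)) \<le> max (p x) (q x) * max (p y) (q y)"
      using seminorm_mult[OF pq(1) xy] seminorm_mult[OF pq(2) xy] by linarith
  qed
  moreover have "continuous_map (topo A) euclideanreal (\<lambda>x. max (p x) (q x))"
    using p q by (intro continuous_map_real_max) (simp_all add: continuous_cstar_seminorms_def)
  ultimately show ?thesis by (simp add: continuous_cstar_seminorms_def)
qed

lemma openin_iff_seminorm_balls:
  "openin (topo A) U \<longleftrightarrow>
    U \<subseteq> carrier A \<and> (\<forall>x\<in>U. \<exists>p\<in>SN. \<exists>e>0. {y \<in> carrier A. p (y \<ominus> x) < e} \<subseteq> U)"
proof (subst generated_by_seminorms, rule openin_topology_generated_by_balls)
  fix p x assume "p \<in> SN" "x \<in> carrier A"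
  moreover from this have "x \<ominus> x = \<zero>" by algebra
  ultimately show "p (x \<ominus> x) = 0" using seminorm_zero[OF SN_cstar] by simp
next
  fix p x y z assume "p \<in> SN" "x \<in> carrier A" "y \<in> carrier A" "z \<in> carrier A"
  then show "p (z \<ominus> x) \<le> p (z \<ominus> y) + p (y \<ominus> x)" using seminorm_triangle_diff[OF SN_cstar] by blast
next
  fix p q assume "p \<in> SN" "q \<in> SN"
  then show "\<exists>r\<in>SN. \<forall>x\<in>carrier A. \<forall>y\<in>carrier A. p (y \<ominus> x) \<le> r (y \<ominus> x) \<and> q (y \<ominus> x) \<le> r (y \<ominus> x)"
    by (intro bexI[of _ "\<lambda>x. max (p x) (q x)"] SN_max) auto
qed (use SN_zero in blast)

lemma openin_seminorm_ball:
  assumes "p \<in> SN" "x \<in> carrier A" "0 < e"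
  shows "openin (topo A) {y \<in> carrier A. p (y \<ominus> x) < e}"
  by (subst generated_by_seminorms, rule topology_generated_by_Basis) (use assms in blast)

section \<open>Compact sets of characters and functions on them\<close>

definition dominated_characters :: "('a \<Rightarrow> real) \<Rightarrow> ('a \<Rightarrow> complex) set" where
  "dominated_characters p = {\<phi>. star_character A \<phi> \<and> (\<forall>x\<in>carrier A. cmod (\<phi> x) \<le> p x)}"

text \<open>These are the continuous characters: the modulus of a continuous one is itself a
  continuous C*-seminorm.\<close>

definition spectrum :: "('a \<Rightarrow> complex) set" where
  "spectrum = (\<Union>p\<in>SN. dominated_characters p)"

lemma characterD:
  assumes "\<phi> \<in> spectrum"
  shows "\<phi> \<one> = 1"
    and "x \<in> carrier A \<Longrightarrow> y \<in> carrier A \<Longrightarrow> \<phi> (x \<oplus> y) = \<phi> x + \<phi> y"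
    and "x \<in> carrier A \<Longrightarrow> y \<in> carrier A \<Longrightarrow> \<phi> (x \<otimes> y) = \<phi> x * \<phi> y"
    and "x \<in> carrier A \<Longrightarrow> \<phi> (c \<odot> x) = c * \<phi> x"
    and "x \<in> carrier A \<Longrightarrow> \<phi> (star A x) = cnj (\<phi> x)"
    and "x \<in> carrier A \<Longrightarrow> y \<in> carrier A \<Longrightarrow> \<phi> (x \<ominus> y) = \<phi> x - \<phi> y"
proof -
  have \<phi>: "star_character A \<phi>" using assms by (auto simp: spectrum_def dominated_characters_def)
  show *: "\<phi> \<one> = 1"
    "x \<in> carrier A \<Longrightarrow> y \<in> carrier A \<Longrightarrow> \<phi> (x \<oplus> y) = \<phi> x + \<phi> y"
    "x \<in> carrier A \<Longrightarrow> y \<in> carrier A \<Longrightarrow> \<phi> (x \<otimes> y) = \<phi> x * \<phi> y"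
    "x \<in> carrier A \<Longrightarrow> \<phi> (c \<odot> x) = c * \<phi> x"
    "x \<in> carrier A \<Longrightarrow> \<phi> (star A x) = cnj (\<phi> x)" for x y c
    using \<phi> by (simp_all add: star_character_def)
  show "x \<in> carrier A \<Longrightarrow> y \<in> carrier A \<Longrightarrow> \<phi> (x \<ominus> y) = \<phi> x - \<phi> y"
    by (simp add: a_minus_def minus_eq_scale *)
qed

lemma dominated_subset_spectrum: "p \<in> SN \<Longrightarrow> dominated_characters p \<subseteq> spectrum"
  by (auto simp: spectrum_def)

lemma dominated_mono:
  assumes "\<And>x. x \<in> carrier A \<Longrightarrow> p x \<le> q x"
  shows "dominated_characters p \<subseteq> dominated_characters q"
  using assms by (force simp: dominated_characters_def)

lemma continuous_on_eval: "continuous_on T (\<lambda>\<phi> :: 'a \<Rightarrow> complex. \<phi> x)"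
  by (rule continuous_on_subset[OF continuous_on_product_coordinates]) simp

text \<open>As in the Banach-Alaoglu theorem: the characters form a closed subset, cut out by
  equations between evaluations, of a product of closed discs, compact by Tychonoff.\<close>

lemma compact_dominated_characters: "compact (dominated_characters p)"
proof -
  \<comment> \<open>The one-point factors off the carrier encode extensionality inside the
    product.\<close>
  define D where "D x = (if x \<in> carrier A then cball 0 (p x) else {undefined :: complex})" for x
  have "compactin (product_topology (\<lambda>_. euclidean) UNIV) (PiE UNIV D)"
    unfolding compactin_PiE by (auto simp: D_def)
  then have cD: "compact (PiE UNIV D)" by (simp add: euclidean_product_topology)
  define E where "E = {\<phi> :: 'a \<Rightarrow> complex. \<phi> \<one> = 1} \<inter>
     (\<Inter>x\<in>carrier A. \<Inter>y\<in>carrier A. {\<phi>. \<phi> (x \<oplus> y) = \<phi> x + \<phi> y} \<inter> {\<phi>. \<phi> (x \<otimes> y) = \<phi> x * \<phi> y}) \<inter>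
     (\<Inter>c. \<Inter>x\<in>carrier A. {\<phi>. \<phi> (c \<odot> x) = c * \<phi> x}) \<inter>
     (\<Inter>x\<in>carrier A. {\<phi>. \<phi> (star A x) = cnj (\<phi> x)})"
  have "closed E"
    unfolding E_def
    by (intro closed_Int closed_INT ballI closed_Collect_eq continuous_intros continuous_on_eval)
  moreover have "dominated_characters p = PiE UNIV D \<inter> E"
    by (auto simp: dominated_characters_def star_character_def E_def D_def PiE_iff extensional_def split: if_splits)
  ultimately show ?thesis using compact_Int_closed[OF cD] by simp
qed

lemma seminorm_le_of_characters:
  assumes p: "p \<in> SN" and a: "a \<in> carrier A" and e: "0 \<le> e"
    and bound: "\<And>\<phi>. \<phi> \<in> dominated_characters p \<Longrightarrow> cmod (\<phi> a) \<le> e"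
  shows "p a \<le> e"
proof (cases "p a = 0")
  case False
  obtain \<phi> where "star_character A \<phi>" "\<And>x. x \<in> carrier A \<Longrightarrow> cmod (\<phi> x) \<le> p x" "cmod (\<phi> a) = p a"
    using exists_norming_character[OF SN_cstar[OF p] a False] by blast
  then show ?thesis using bound[of \<phi>] by (simp add: dominated_characters_def)
qed (use e in simp)

lemma approximate_real_function:
  fixes g :: "('a \<Rightarrow> complex) \<Rightarrow> real"
  assumes p: "p \<in> SN" and g: "continuous_on (dominated_characters p) g" and e: "0 < e"
  shows "\<exists>a\<in>carrier A. \<forall>\<phi>\<in>dominated_characters p. cmod (\<phi> a - complex_of_real (g \<phi>)) < e"
proof -
  let ?K = "dominated_characters p"
  have KS: "\<phi> \<in> spectrum" if "\<phi> \<in> ?K" for \<phi> using dominated_subset_spectrum[OF p] that by blast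
  \<comment> \<open>Real functions represented exactly by an element. The real part of an evaluation
    belongs to \<open>R\<close>, by the self-adjoint part of the element.\<close>
  define R where "R = {g. continuous_on ?K g \<and> (\<exists>a\<in>carrier A. \<forall>\<phi>\<in>?K. \<phi> a = complex_of_real (g \<phi>))}"
  have R_Re: "(\<lambda>\<phi>. Re (\<phi> a)) \<in> R" if a: "a \<in> carrier A" for a
    unfolding R_def
  proof (intro CollectI conjI bexI[of _ "(1/2) \<odot> (a \<oplus> star A a)"] ballI)
    show "continuous_on ?K (\<lambda>\<phi>. Re (\<phi> a))" by (intro continuous_intros continuous_on_eval)
    fix \<phi> assume "\<phi> \<in> ?K"
    then show "\<phi> ((1/2) \<odot> (a \<oplus> star A a)) = complex_of_real (Re (\<phi> a))"
      using a by (simp add: characterD KS star_closed complex_add_cnj)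
  qed (use a in \<open>simp add: star_closed\<close>)
  interpret function_ring_on R ?K
  proof
    show "compact ?K" by (rule compact_dominated_characters)
    show "continuous_on ?K f" if "f \<in> R" for f using that by (simp add: R_def)
    fix f h assume "f \<in> R" "h \<in> R"
    then obtain a b where ab: "a \<in> carrier A" "b \<in> carrier A" "\<forall>\<phi>\<in>?K. \<phi> a = complex_of_real (f \<phi>)"
      "\<forall>\<phi>\<in>?K. \<phi> b = complex_of_real (h \<phi>)" and cont: "continuous_on ?K f" "continuous_on ?K h"
      by (auto simp: R_def)
    show "(\<lambda>\<phi>. f \<phi> + h \<phi>) \<in> R"
      unfolding R_def using ab cont
      by (intro CollectI conjI continuous_intros bexI[of _ "a \<oplus> b"]) (auto simp: characterD KS)
    show "(\<lambda>\<phi>. f \<phi> * h \<phi>) \<in> R"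
      unfolding R_def using ab cont
      by (intro CollectI conjI continuous_intros bexI[of _ "a \<otimes> b"]) (auto simp: characterD KS)
  next
    show "(\<lambda>_. c) \<in> R" for c
      unfolding R_def
      by (intro CollectI conjI continuous_intros bexI[of _ "complex_of_real c \<odot> \<one>"]) (auto simp: characterD KS)
  next
    fix \<phi> \<psi> assume *: "\<phi> \<in> ?K" "\<psi> \<in> ?K" "\<phi> \<noteq> \<psi>"
    have "\<exists>a\<in>carrier A. \<phi> a \<noteq> \<psi> a"
    proof (rule ccontr)
      assume "\<not> ?thesis"
      then have "\<phi> = \<psi>" using * by (intro extensionalityI[of _ "carrier A"])
        (auto simp: dominated_characters_def star_character_def)
      then show False using * by blast
    qed
    then obtain a where a: "a \<in> carrier A" "\<phi> a \<noteq> \<psi> a" by blast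
    show "\<exists>f\<in>R. f \<phi> \<noteq> f \<psi>"
    \<comment> \<open>Elements of \<open>R\<close> see real parts only; multiplying \<open>a\<close>
      by the imaginary unit exposes a difference in the imaginary parts.\<close>
    proof (cases "Re (\<phi> a) = Re (\<psi> a)")
      case True
      then have "Im (\<phi> a) \<noteq> Im (\<psi> a)" using a(2) complex_eq_iff by blast
      then have "Re (\<phi> (\<i> \<odot> a)) \<noteq> Re (\<psi> (\<i> \<odot> a))" using a(1) * by (simp add: characterD KS)
      then show ?thesis by (rule bexI[OF _ R_Re]) (simp add: a(1))
    next
      case False
      then show ?thesis by (rule bexI[OF _ R_Re[OF a(1)]])
    qed
  qed
  obtain g' where g': "g' \<in> R" "\<forall>\<phi>\<in>?K. \<bar>g \<phi> - g' \<phi>\<bar> < e"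
    using Stone_Weierstrass_basic[OF g e] by blast
  then obtain a where a: "a \<in> carrier A" "\<forall>\<phi>\<in>?K. \<phi> a = complex_of_real (g' \<phi>)" by (auto simp: R_def)
  have "cmod (\<phi> a - complex_of_real (g \<phi>)) < e" if "\<phi> \<in> ?K" for \<phi>
  proof -
    have "\<phi> a - complex_of_real (g \<phi>) = complex_of_real (g' \<phi> - g \<phi>)" using a(2) that by simp
    then have "cmod (\<phi> a - complex_of_real (g \<phi>)) = \<bar>g' \<phi> - g \<phi>\<bar>" by (simp only: norm_of_real)
    then show ?thesis using g'(2) that by (simp add: abs_minus_commute)
  qed
  then show ?thesis using a(1) by blast
qed

lemma approximate_function:
  fixes f :: "('a \<Rightarrow> complex) \<Rightarrow> complex"
  assumes p: "p \<in> SN" and f: "continuous_on (dominated_characters p) f" and e: "0 < e"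
  shows "\<exists>a\<in>carrier A. \<forall>\<phi>\<in>dominated_characters p. cmod (\<phi> a - f \<phi>) < e"
proof -
  let ?K = "dominated_characters p"
  obtain a where a: "a \<in> carrier A" "\<And>\<phi>. \<phi> \<in> ?K \<Longrightarrow> cmod (\<phi> a - complex_of_real (Re (f \<phi>))) < e/2"
    using approximate_real_function[OF p, of "\<lambda>\<phi>. Re (f \<phi>)" "e/2"] f e by (auto intro: continuous_intros)
  obtain b where b: "b \<in> carrier A" "\<And>\<phi>. \<phi> \<in> ?K \<Longrightarrow> cmod (\<phi> b - complex_of_real (Im (f \<phi>))) < e/2"
    using approximate_real_function[OF p, of "\<lambda>\<phi>. Im (f \<phi>)" "e/2"] f e by (auto intro: continuous_intros)
  have "cmod (\<phi> (a \<oplus> \<i> \<odot> b) - f \<phi>) < e" if \<phi>: "\<phi> \<in> ?K" for \<phi>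
  proof -
    have "\<phi> \<in> spectrum" using dominated_subset_spectrum[OF p] \<phi> by blast
    then have "\<phi> (a \<oplus> \<i> \<odot> b) - f \<phi> =
        (\<phi> a - complex_of_real (Re (f \<phi>))) + \<i> * (\<phi> b - complex_of_real (Im (f \<phi>)))"
      using a(1) b(1) complex_eq[of "f \<phi>"] by (simp add: characterD algebra_simps)
    also have "cmod \<dots> \<le> cmod (\<phi> a - complex_of_real (Re (f \<phi>))) + cmod (\<i> * (\<phi> b - complex_of_real (Im (f \<phi>))))"
      by (rule norm_triangle_ineq)
    also have "\<dots> < e" using a(2)[OF \<phi>] b(2)[OF \<phi>] by (simp add: norm_mult)
    finally show ?thesis .
  qed
  then show ?thesis using a(1) b(1) by (intro bexI[of _ "a \<oplus> \<i> \<odot> b"]) auto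
qed

text \<open>The sets \<open>N (p, e)\<close> of elements that approximate \<open>f\<close> within
  \<open>e\<close> on one compact set form a filter base. The filter is Cauchy since
  \<open>p\<close> is controlled by the characters it dominates, and its limit represents
  \<open>f\<close>. Continuity is assumed on the compact sets only, which is what makes the lemma
  yield functional distinguishedness as well.\<close>

lemma represent_function:
  fixes f :: "('a \<Rightarrow> complex) \<Rightarrow> complex"
  assumes f: "\<And>p. p \<in> SN \<Longrightarrow> continuous_on (dominated_characters p) f"
  shows "\<exists>a\<in>carrier A. \<forall>\<phi>\<in>spectrum. \<phi> a = f \<phi>"
proof -
  define N where "N i = {a \<in> carrier A. \<forall>\<phi>\<in>dominated_characters (fst i). cmod (\<phi> a - f \<phi>) < snd i}"
    for i :: "('a \<Rightarrow> real) \<times> real"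
  define I where "I = SN \<times> {0 :: real<..}"
  define F where "F = (INF i\<in>I. principal (N i))"
  have N_nonempty: "N i \<noteq> {}" if "i \<in> I" for i
    using approximate_function[OF _ f, of "fst i" "snd i"] that by (auto simp: I_def N_def)
  have I_nonempty: "I \<noteq> {}" using SN_zero by (auto simp: I_def intro: exI[of _ 1])
  have ev_F: "eventually P F \<longleftrightarrow> (\<exists>i\<in>I. \<forall>a\<in>N i. P a)" for P
    unfolding F_def
  proof (subst eventually_INF_base[OF I_nonempty])
    fix i j assume ij: "i \<in> I" "j \<in> I"
    \<comment> \<open>A larger seminorm dominates more characters and a smaller tolerance is
      stricter, so \<open>N k\<close> lies in both sets.\<close>
    define k where "k = (\<lambda>x. max (fst i x) (fst j x), min (snd i) (snd j))"
    have "k \<in> I" using ij SN_max[of "fst i" "fst j"] by (auto simp: I_def k_def)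
    moreover have "dominated_characters (fst i) \<subseteq> dominated_characters (fst k)"
      "dominated_characters (fst j) \<subseteq> dominated_characters (fst k)"
      by (auto simp: k_def intro!: dominated_mono)
    then have "N k \<subseteq> N i \<inter> N j" by (fastforce simp: N_def k_def)
    ultimately show "\<exists>k\<in>I. principal (N k) \<le> inf (principal (N i)) (principal (N j))" by auto
  qed (simp add: eventually_principal)
  have "F \<noteq> bot"
    unfolding trivial_limit_def ev_F using N_nonempty by blast
  moreover have "cauchy_filter_in A F"
    unfolding cauchy_filter_in_def
  proof (intro conjI allI impI)
    show "\<forall>\<^sub>F x in F. x \<in> carrier A"
      unfolding ev_F using I_nonempty by (auto simp: N_def)
    fix U assume "openin (topo A) U \<and> \<zero> \<in> U"
    then obtain p e where p: "p \<in> SN" "e > 0" "{y \<in> carrier A. p (y \<ominus> \<zero>) < e} \<subseteq> U"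
      unfolding openin_iff_seminorm_balls by blast
    \<comment> \<open>Two errors below \<open>e/3\<close> give a non-strict bound
      \<open>2 * (e/3)\<close>, still strictly below \<open>e\<close>.\<close>
    define i where "i = (p, e/3)"
    have i: "i \<in> I" using p by (simp add: i_def I_def)
    have "a \<ominus> b \<in> U" if ab: "a \<in> N i" "b \<in> N i" for a b
    proof -
      have abA: "a \<in> carrier A" "b \<in> carrier A" using ab by (auto simp: N_def)
      have "p (a \<ominus> b) \<le> 2 * (e/3)"
      proof (rule seminorm_le_of_characters[OF p(1)])
        fix \<phi> assume \<phi>: "\<phi> \<in> dominated_characters p"
        then have "cmod (\<phi> a - f \<phi>) < e/3" "cmod (\<phi> b - f \<phi>) < e/3" using ab by (auto simp: N_def i_def)
        moreover have "\<phi> \<in> spectrum" using dominated_subset_spectrum[OF p(1)] \<phi> by blast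
        then have "\<phi> (a \<ominus> b) = (\<phi> a - f \<phi>) - (\<phi> b - f \<phi>)" using abA by (simp add: characterD)
        ultimately show "cmod (\<phi> (a \<ominus> b)) \<le> 2 * (e/3)"
          using norm_triangle_ineq4[of "\<phi> a - f \<phi>" "\<phi> b - f \<phi>"] by simp
      qed (use abA p in auto)
      moreover have "(a \<ominus> b) \<ominus> \<zero> = a \<ominus> b" using abA by algebra
      ultimately show ?thesis using p(2,3) abA by auto
    qed
    then show "\<forall>\<^sub>F (x, y) in F \<times>\<^sub>F F. x \<ominus> y \<in> U"
      unfolding eventually_prod_same using i by (intro exI[of _ "\<lambda>a. a \<in> N i"]) (auto simp: ev_F)
  qed
  ultimately obtain l where l: "limitin (topo A) (\<lambda>x. x) l F"
    using complete unfolding complete_algebra_def by blast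
  then have lA: "l \<in> carrier A" by (simp add: limitin_def topspace_topo)
  have "\<phi> l = f \<phi>" if \<phi>: "\<phi> \<in> spectrum" for \<phi>
  proof -
    obtain p where p: "p \<in> SN" "\<phi> \<in> dominated_characters p" using \<phi> by (auto simp: spectrum_def)
    have bound: "cmod (\<phi> l - f \<phi>) \<le> 2 * e" if e: "e > 0" for e
    proof -
      have "\<forall>\<^sub>F x in F. x \<in> {y \<in> carrier A. p (y \<ominus> l) < e}"
      proof -
        have "l \<ominus> l = \<zero>" using lA by algebra
        then have "l \<in> {y \<in> carrier A. p (y \<ominus> l) < e}" using lA e seminorm_zero[OF SN_cstar[OF p(1)]] by simp
        then show ?thesis using l openin_seminorm_ball[OF p(1) lA e] unfolding limitin_def by blast
      qed
      moreover have "\<forall>\<^sub>F x in F. x \<in> N (p, e)" unfolding ev_F using p e by (auto simp: I_def intro!: bexI[of _ "(p, e)"])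
      ultimately have "\<forall>\<^sub>F x in F. x \<in> {y \<in> carrier A. p (y \<ominus> l) < e} \<and> x \<in> N (p, e)" by (rule eventually_conj)
      then obtain x where x: "x \<in> carrier A" "p (x \<ominus> l) < e" "x \<in> N (p, e)"
        using eventually_happens'[OF \<open>F \<noteq> bot\<close>] by blast
      have "cmod (\<phi> (x \<ominus> l)) \<le> p (x \<ominus> l)" using p(2) x(1) lA by (simp add: dominated_characters_def)
      then have "cmod (\<phi> x - \<phi> l) < e" using x(1,2) lA \<phi> by (simp add: characterD)
      moreover have "cmod (\<phi> x - f \<phi>) < e" using x(3) p(2) by (simp add: N_def)
      ultimately show ?thesis
        using norm_triangle_ineq4[of "\<phi> x - f \<phi>" "\<phi> x - \<phi> l"] by simp
    qed
    have "cmod (\<phi> l - f \<phi>) \<le> 0"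
    proof (rule field_le_epsilon)
      fix e :: real assume "0 < e"
      then show "cmod (\<phi> l - f \<phi>) \<le> 0 + e" using bound[of "e / 2"] by simp
    qed
    then show ?thesis by simp
  qed
  then show ?thesis using lA by blast
qed

section \<open>The character space and the Gelfand transform\<close>

definition spectrum_topology :: "('a \<Rightarrow> complex) topology" where
  "spectrum_topology = top_of_set spectrum"

text \<open>The sets of dominated characters are cofinal in this family; their compact subsets are
  included because a functionally distinguished family must contain them.\<close>

definition spectrum_family :: "('a \<Rightarrow> complex) set set" where
  "spectrum_family = {L. compact L \<and> (\<exists>p\<in>SN. L \<subseteq> dominated_characters p)}"

lemma dominated_characters_member: "p \<in> SN \<Longrightarrow> dominated_characters p \<in> spectrum_family"
  unfolding spectrum_family_def using compact_dominated_characters by blast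

lemma spectrum_family_subset: "L \<in> spectrum_family \<Longrightarrow> L \<subseteq> spectrum"
  using dominated_subset_spectrum by (auto simp: spectrum_family_def)

lemma tychonoff_spectrum: "tychonoff_space spectrum_topology"
proof -
  have "t1_space (product_topology (\<lambda>_ :: 'a. euclidean :: complex topology) UNIV)"
    "completely_regular_space (product_topology (\<lambda>_ :: 'a. euclidean :: complex topology) UNIV)"
    by (simp_all add: t1_space_product_topology completely_regular_space_product_topology t1_space_euclidean
        metrizable_imp_completely_regular_space metrizable_space_euclidean)
  then show ?thesis
    unfolding tychonoff_space_def spectrum_topology_def euclidean_product_topology
    by (intro conjI t1_space_subtopology completely_regular_space_subtopology)
qed

lemma subtopology_spectrum:
  "L \<in> spectrum_family \<Longrightarrow> subtopology spectrum_topology L = top_of_set L"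
  using spectrum_family_subset by (simp add: spectrum_topology_def subtopology_subtopology Int_absorb1)

lemma continuous_on_spectrum_represented:
  assumes "\<And>L. L \<in> spectrum_family \<Longrightarrow> continuous_on L f"
  shows "\<exists>a\<in>carrier A. \<forall>\<phi>\<in>spectrum. \<phi> a = f \<phi>"
  by (rule represent_function) (rule assms[OF dominated_characters_member])

text \<open>The substantial point is the last condition: a function continuous on all members is
  represented by an element, and evaluation at that element is continuous on the whole
  spectrum.\<close>

lemma functionally_distinguished_spectrum:
  "functionally_distinguished spectrum_topology spectrum_family"
  unfolding functionally_distinguished_def
proof (intro conjI ballI allI impI)
  fix L assume L: "L \<in> spectrum_family"
  then show "compactin spectrum_topology L"
    using spectrum_family_subset by (simp add: spectrum_topology_def compactin_subtopology spectrum_family_def)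
  show "M \<in> spectrum_family" if "M \<subseteq> L \<and> compactin spectrum_topology M" for M
    using L that by (auto simp: spectrum_family_def spectrum_topology_def compactin_subtopology)
next
  fix \<phi> assume "\<phi> \<in> topspace spectrum_topology"
  then show "{\<phi>} \<in> spectrum_family"
    by (auto simp: spectrum_topology_def spectrum_def spectrum_family_def)
next
  fix \<U> assume "finite \<U> \<and> \<U> \<subseteq> spectrum_family"
  then have "finite \<U>" "\<U> \<subseteq> spectrum_family" by auto
  then show "\<Union>\<U> \<in> spectrum_family"
  proof (induction \<U> rule: finite_induct)
    case empty
    then show ?case using SN_zero by (auto simp: spectrum_family_def)
  next
    case (insert L \<U>)
    then obtain p q where pq: "p \<in> SN" "q \<in> SN" "L \<subseteq> dominated_characters p" "\<Union>\<U> \<subseteq> dominated_characters q"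
      "compact L" "compact (\<Union>\<U>)" by (auto simp: spectrum_family_def)
    have "dominated_characters p \<subseteq> dominated_characters (\<lambda>x. max (p x) (q x))"
      "dominated_characters q \<subseteq> dominated_characters (\<lambda>x. max (p x) (q x))"
      by (auto intro!: dominated_mono)
    then have "\<Union>(insert L \<U>) \<subseteq> dominated_characters (\<lambda>x. max (p x) (q x))" using pq(3,4) by auto
    moreover have "compact (\<Union>(insert L \<U>))" using pq(5,6) by (simp add: compact_Un)
    ultimately show ?case using SN_max[OF pq(1,2)] unfolding spectrum_family_def by blast
  qed
next
  fix f :: "('a \<Rightarrow> complex) \<Rightarrow> real"
  show "continuous_map spectrum_topology euclideanreal f \<longleftrightarrow>
      (\<forall>K\<in>spectrum_family. continuous_map (subtopology spectrum_topology K) euclideanreal f)"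
  proof
    assume "continuous_map spectrum_topology euclideanreal f"
    then show "\<forall>K\<in>spectrum_family. continuous_map (subtopology spectrum_topology K) euclideanreal f"
      by (blast intro: continuous_map_from_subtopology)
  next
    assume *: "\<forall>K\<in>spectrum_family. continuous_map (subtopology spectrum_topology K) euclideanreal f"
    have cont: "continuous_on L (\<lambda>\<phi>. complex_of_real (f \<phi>))" if "L \<in> spectrum_family" for L
      using * that by (intro continuous_intros) (simp add: subtopology_spectrum)
    obtain a where a: "a \<in> carrier A" "\<forall>\<phi>\<in>spectrum. \<phi> a = complex_of_real (f \<phi>)"
      using continuous_on_spectrum_represented[OF cont] by blast
    have "continuous_on spectrum (\<lambda>\<phi>. Re (\<phi> a))" by (intro continuous_intros continuous_on_eval)
    then have "continuous_on spectrum f"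
      by (rule continuous_on_eq) (simp add: a)
    then show "continuous_map spectrum_topology euclideanreal f" by (simp add: spectrum_topology_def)
  qed
qed

sublocale Spec: distinguished_family spectrum_topology spectrum_family
  using tychonoff_spectrum functionally_distinguished_spectrum by unfold_locales

definition gelfand :: "'a \<Rightarrow> ('a \<Rightarrow> complex) \<Rightarrow> complex" where
  "gelfand a = (\<lambda>\<phi>\<in>spectrum. \<phi> a)"

lemma topspace_spectrum [simp]: "topspace spectrum_topology = spectrum"
  by (simp add: spectrum_topology_def)

lemma gelfand_in: "gelfand a \<in> continuous_functions spectrum_topology"
  unfolding gelfand_def using restrict_continuous_functions[of spectrum_topology "\<lambda>\<phi>. \<phi> a"]
  by (simp add: spectrum_topology_def continuous_on_eval)

lemma seminorm_eq_zero_imp_eq: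
  assumes a: "a \<in> carrier A" and b: "b \<in> carrier A" and zero: "\<And>p. p \<in> SN \<Longrightarrow> p (a \<ominus> b) = 0"
  shows "a = b"
proof (rule ccontr)
  assume "a \<noteq> b"
  then obtain U V where UV: "openin (topo A) U" "openin (topo A) V" "b \<in> U" "a \<in> V" "disjnt U V"
    using Hausdorff a b unfolding Hausdorff_space_def topspace_topo by metis
  obtain p e where p: "p \<in> SN" "e > 0" "{y \<in> carrier A. p (y \<ominus> b) < e} \<subseteq> U"
    using UV(1,3) unfolding openin_iff_seminorm_balls by blast
  have "a \<in> U" using p zero[OF p(1)] a by auto
  then show False using UV(4,5) by (auto simp: disjnt_iff)
qed

lemma bij_betw_gelfand: "bij_betw gelfand (carrier A) (continuous_functions spectrum_topology)"
  unfolding bij_betw_def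
proof (intro conjI equalityI subsetI)
  show "inj_on gelfand (carrier A)"
  proof (rule inj_onI)
    fix a b assume ab: "a \<in> carrier A" "b \<in> carrier A" "gelfand a = gelfand b"
    show "a = b"
    proof (rule seminorm_eq_zero_imp_eq[OF ab(1,2)])
      fix p assume p: "p \<in> SN"
      have "p (a \<ominus> b) \<le> 0"
      proof (rule seminorm_le_of_characters[OF p])
        fix \<phi> assume "\<phi> \<in> dominated_characters p"
        then have \<phi>: "\<phi> \<in> spectrum" using dominated_subset_spectrum[OF p] by blast
        then have "\<phi> a = \<phi> b" using fun_cong[OF ab(3), of \<phi>] by (simp add: gelfand_def)
        then show "cmod (\<phi> (a \<ominus> b)) \<le> 0" using ab \<phi> by (simp add: characterD)
      qed (use ab in auto)
      then show "p (a \<ominus> b) = 0" using seminorm_nonneg[OF SN_cstar[OF p], of "a \<ominus> b"] ab by simp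
    qed
  qed
  show "f \<in> continuous_functions spectrum_topology" if "f \<in> gelfand ` carrier A" for f
    using that gelfand_in by blast
  fix f assume f: "f \<in> continuous_functions spectrum_topology"
  then have "continuous_on spectrum f"
    using continuous_functionsD(1)[OF f] by (simp add: spectrum_topology_def)
  then have cont: "continuous_on L f" if "L \<in> spectrum_family" for L
    using spectrum_family_subset[OF that] by (rule continuous_on_subset)
  obtain a where a: "a \<in> carrier A" "\<forall>\<phi>\<in>spectrum. \<phi> a = f \<phi>"
    using continuous_on_spectrum_represented[OF cont] by blast
  have "gelfand a = f"
    by (rule continuous_functions_eqI[OF gelfand_in f]) (simp add: gelfand_def a)
  then show "f \<in> gelfand ` carrier A" using a(1) by blast
qed

text \<open>Domination gives continuity: a \<open>p\<close>-ball is sent into the ball over any set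
  of characters dominated by \<open>p\<close>. Openness is the converse estimate, that
  \<open>p\<close> is bounded by the supremum over its dominated characters.\<close>

lemma homeomorphic_map_gelfand:
  "homeomorphic_map (topo A) (topo (function_algebra spectrum_topology spectrum_family)) gelfand"
proof (rule bijective_open_imp_homeomorphic_map)
  show "continuous_map (topo A) (topo (function_algebra spectrum_topology spectrum_family)) gelfand"
  proof (rule Spec.continuous_into_function_algebra)
    fix a L and e :: real
    assume "a \<in> topspace (topo A)" and L: "L \<in> spectrum_family" and e: "0 < e"
    then have a: "a \<in> carrier A" by (simp add: topspace_topo)
    obtain p where p: "p \<in> SN" "L \<subseteq> dominated_characters p" using L by (auto simp: spectrum_family_def)
    have "gelfand y \<in> Spec.uball L (gelfand a) e" if y: "y \<in> carrier A" "p (y \<ominus> a) < e" for y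
    proof (intro CollectI conjI gelfand_in ballI)
      fix \<phi> assume "\<phi> \<in> L"
      then have \<phi>: "\<phi> \<in> dominated_characters p" "\<phi> \<in> spectrum" using p spectrum_family_subset[OF L] by auto
      then have "cmod (\<phi> (y \<ominus> a)) \<le> p (y \<ominus> a)" using y a by (simp add: dominated_characters_def)
      then show "cmod (gelfand y \<phi> - gelfand a \<phi>) < e" using y a \<phi>(2) by (simp add: gelfand_def characterD)
    qed
    moreover have "a \<in> {y \<in> carrier A. p (y \<ominus> a) < e}"
    proof -
      have "a \<ominus> a = \<zero>" using a by algebra
      then show ?thesis using a e seminorm_zero[OF SN_cstar[OF p(1)]] by simp
    qed
    ultimately show "\<exists>V. openin (topo A) V \<and> a \<in> V \<and> (\<forall>z\<in>V. gelfand z \<in> Spec.uball L (gelfand a) e)"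
      using openin_seminorm_ball[OF p(1) a e] by (intro exI[of _ "{y \<in> carrier A. p (y \<ominus> a) < e}"]) simp
  qed (rule gelfand_in)
  show "open_map (topo A) (topo (function_algebra spectrum_topology spectrum_family)) gelfand"
    unfolding open_map_def
  proof (intro allI impI)
    fix U assume U: "openin (topo A) U"
    then have UA: "U \<subseteq> carrier A" using openin_subset topspace_topo by blast
    show "openin (topo (function_algebra spectrum_topology spectrum_family)) (gelfand ` U)"
      unfolding Spec.openin_function_algebra
    proof (intro conjI ballI)
      show "gelfand ` U \<subseteq> continuous_functions spectrum_topology" using gelfand_in by blast
      fix f assume "f \<in> gelfand ` U"
      then obtain a where a: "a \<in> U" "f = gelfand a" by blast
      then obtain p e where p: "p \<in> SN" "e > 0" "{y \<in> carrier A. p (y \<ominus> a) < e} \<subseteq> U"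
        using U unfolding openin_iff_seminorm_balls by blast
      have aA: "a \<in> carrier A" using a UA by blast
      \<comment> \<open>Halved because \<open>seminorm_le_of_characters\<close> yields a non-strict
        bound.\<close>
      have "Spec.uball (dominated_characters p) f (e/2) \<subseteq> gelfand ` U"
      proof
        fix g assume g: "g \<in> Spec.uball (dominated_characters p) f (e/2)"
        then obtain y where y: "y \<in> carrier A" "g = gelfand y"
          using bij_betw_imp_surj_on[OF bij_betw_gelfand] by blast
        have "p (y \<ominus> a) \<le> e/2"
        proof (rule seminorm_le_of_characters[OF p(1)])
          fix \<phi> assume \<phi>: "\<phi> \<in> dominated_characters p"
          then have \<phi>S: "\<phi> \<in> spectrum" using dominated_subset_spectrum[OF p(1)] by blast
          have "cmod (gelfand y \<phi> - gelfand a \<phi>) < e/2" using g \<phi> y(2) a(2) by blast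
          then show "cmod (\<phi> (y \<ominus> a)) \<le> e/2" using y(1) aA \<phi>S by (simp add: gelfand_def characterD)
        qed (use y aA p in auto)
        then have "y \<in> U" using p y(1) by auto
        then show "g \<in> gelfand ` U" using y(2) by blast
      qed
      then show "\<exists>K\<in>spectrum_family. \<exists>e>0. Spec.uball K f e \<subseteq> gelfand ` U"
        using dominated_characters_member[OF p(1)] p(2) half_gt_zero by blast
    qed
  qed
  show "gelfand ` topspace (topo A) = topspace (topo (function_algebra spectrum_topology spectrum_family))"
    using bij_betw_gelfand by (simp add: bij_betw_def topspace_topo Spec.topspace_function_algebra)
  show "inj_on gelfand (topspace (topo A))"
    using bij_betw_gelfand by (simp add: bij_betw_def topspace_topo)
qed

theorem top_star_iso_gelfand:
  "top_star_iso A (function_algebra spectrum_topology spectrum_family) gelfand"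
  unfolding top_star_iso_def
proof (intro conjI allI ballI homeomorphic_map_gelfand)
  have "gelfand \<in> ring_hom A (function_algebra spectrum_topology spectrum_family)"
    by (rule ring_hom_memI) (auto simp: gelfand_in, auto simp: gelfand_def characterD cong: restrict_cong)
  then show "gelfand \<in> ring_iso A (function_algebra spectrum_topology spectrum_family)"
    using bij_betw_gelfand by (simp add: ring_iso_def)
qed (auto simp: gelfand_def characterD cong: restrict_cong)

end

text \<open>Types cannot be quantified existentially, so the representing space is placed on a
  definite type: functions from \<open>'a\<close> to the complex numbers, where the characters
  live.\<close>

theorem theoremB:
  shows "(\<forall>(X :: 'x topology) \<F>. tychonoff_space X \<and> functionally_distinguished X \<F> \<longrightarrow>
            pro_cstar_algebra (function_algebra X \<F>) \<and> cring (function_algebra X \<F>)) \<and>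
         (\<forall>A :: 'a top_star_algebra. pro_cstar_algebra A \<and> cring A \<longrightarrow>
            (\<exists>(X :: ('a \<Rightarrow> complex) topology) \<F>.
               tychonoff_space X \<and> functionally_distinguished X \<F> \<and>
               top_star_isomorphic A (function_algebra X \<F>))) \<and>
         (\<forall>(X :: 'x topology) \<F>. tychonoff_space X \<and> functionally_distinguished X \<F> \<longrightarrow>
            (barreled (function_algebra X \<F>) \<longleftrightarrow>
               full_family X \<F> \<and>
               (\<forall>S \<subseteq> topspace X. relatively_pseudocompact X S \<longrightarrow> relatively_compact X S)))"
proof (intro conjI allI impI)
  fix X :: "'x topology" and \<F>
  assume "tychonoff_space X \<and> functionally_distinguished X \<F>"
  then interpret distinguished_family X \<F> by (simp add: distinguished_family_def)
  show "pro_cstar_algebra (function_algebra X \<F>)" by (rule pro_cstar_algebra_function_algebra)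
  show "cring (function_algebra X \<F>)" by (rule cring_function_algebra)
next
  fix A :: "'a top_star_algebra"
  assume "pro_cstar_algebra A \<and> cring A"
  then interpret comm_pro_cstar_algebra A by (simp add: comm_pro_cstar_algebra_def)
  show "\<exists>(X :: ('a \<Rightarrow> complex) topology) \<F>.
      tychonoff_space X \<and> functionally_distinguished X \<F> \<and>
      top_star_isomorphic A (function_algebra X \<F>)"
    using tychonoff_spectrum functionally_distinguished_spectrum top_star_iso_gelfand
    unfolding top_star_isomorphic_def by blast
next
  fix X :: "'x topology" and \<F>
  assume "tychonoff_space X \<and> functionally_distinguished X \<F>"
  then interpret distinguished_family X \<F> by (simp add: distinguished_family_def)
  show "barreled (function_algebra X \<F>) \<longleftrightarrow>
      full_family X \<F> \<and>
      (\<forall>S \<subseteq> topspace X. relatively_pseudocompact X S \<longrightarrow> relatively_compact X S)"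
    by (rule barreled_function_algebra_iff)
qed

end
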